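(* Let $p$ be a prime and let $\mathcal F$ be a saturated fusion system over a discrete $p$-toral group $S$. Assume $G$ is a locally finite group containing $S$ such that $\mathcal F=\mathcal F_S(G)$. Then the following hold. (a) There is a countable subgroup $G_*\le G$ such that $S\le G_*$ and $\mathcal F=\mathcal F_S(G_* )$. (b) If $G$ is countable and $S\in\mathrm{Syl}_p(G)$, then there is an increasing sequence of finite subgroups $\{G_i\}_{i\ge1}$ of $G$ such that $S_i:=S\cap G_i\in\mathrm{Syl}_p(G_i)$ for each $i$, and $G=\bigcup_{i=1}^\infty G_i$. For each such sequence, (b.1) $S=\bigcup_{i=1}^\infty S_i$, and (b.2) $\mathcal F=\bigcup_{i=1}^\infty\mathcal F_{S_i}(G_i)$.
   Context: "Countable" means at most countable. A group is locally finite if all its finitely generated subgroups are finite. A Sylow $p$-subgroup of a discrete group $G$ is a $p$-subgroup (all elements of $p$-power order) that contains every other $p$-subgroup of $G$ up to conjugacy; $\mathrm{Syl}_p(G)$ is the set of these. A discrete $p$-torus is a group isomorphic to $(\mathbb Z/p^\infty)^r$ for some $r\ge0$; a discrete $p$-toral group is a group with a normal discrete $p$-torus of finite $p$-power index; its identity component is its unique discrete $p$-torus of finite index. If $P$ is discrete $p$-toral with identity component $U\cong(\mathbb Z/p^\infty)^r$, its order is $|P|=(r,|P/U|)\in\mathbb N^2$, ordered lexicographically. A fusion system $\mathcal F$ over a discrete $p$-toral group $S$ is a category whose objects are the subgroups of $S$, with $\mathrm{Hom}_S(P,Q)\subseteq\mathrm{Hom}_{\mathcal F}(P,Q)\subseteq\mathrm{Inj}(P,Q)$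 (homomorphisms induced by conjugation in $S$; injective homomorphisms), composition being composition of homomorphisms, and such that $\varphi\in\mathrm{Hom}_{\mathcal F}(P,Q)$ implies $\varphi^{-1}\in\mathrm{Hom}_{\mathcal F}(\varphi(P),P)$. Write $P^{\mathcal F}=\{\varphi(P)\mid\varphi\in\mathrm{Hom}_{\mathcal F}(P,S)\}$, $\mathrm{Aut}_{\mathcal F}(P)=\mathrm{Hom}_{\mathcal F}(P,P)$, $\mathrm{Out}_{\mathcal F}(P)=\mathrm{Aut}_{\mathcal F}(P)/\mathrm{Inn}(P)$. For a group $G$ and discrete $p$-toral $S\le G$, $\mathcal F_S(G)$ is the fusion system over $S$ with $\mathrm{Hom}_{\mathcal F_S(G)}(P,Q)=\{c_g|_P\mid g\in G,\ gPg^{-1}\le Q\}$, $c_g(x)=gxg^{-1}$. Saturation: $P\le S$ is fully centralized (fully normalized) if $|C_S(P)|\ge|C_S(P^* )|$ (resp. $|N_S(P)|\ge|N_S(P^* )|$) for all $P^*\in P^{\mathcal F}$; fully automized if $\mathrm{Out}_{\mathcal F}(P)$ is finite and $\mathrm{Out}_S(P)\in\mathrm{Syl}_p(\mathrm{Out}_{\mathcal F}(P))$; receptive if for each $Q\in P^{\mathcal F}$ and each isomorphism $\varphi\in\mathrm{Hom}_{\mathcal F}(Q,P)$, setting $N_\varphi=\{g\in N_S(Q)\mid\varphi c_g\varphi^{-1}\in\mathrm{Aut}_S(P)\}$, there is $\bar\varphi\in\mathrm{Hom}_{\mathcal F}(N_\varphi,S)$ with $\bar\varphi|_Q=\varphi$.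 $\mathcal F$ is saturated if (Sylow axiom) each fully normalized subgroup is fully automized and fully centralized; (extension axiom) each fully centralized subgroup is receptive; (continuity axiom) if $\varphi\in\mathrm{Hom}(P,S)$ is injective and $\varphi|_R\in\mathrm{Hom}_{\mathcal F}(R,S)$ for every finite $R\le P$, then $\varphi\in\mathrm{Hom}_{\mathcal F}(P,S)$. If $\mathcal F_1\le\mathcal F_2\le\cdots$ are saturated fusion systems over finite subgroups $S_1\le S_2\le\cdots$ of a discrete $p$-toral group $S=\bigcup_iS_i$, then $\bigcup_i\mathcal F_i$ is the fusion system over $S$ in which $\varphi\in\mathrm{Hom}(P,Q)$ is a morphism iff for each finite $R\le P$ there is $i$ with $R\le S_i$ and $\varphi|_R\in\mathrm{Hom}_{\mathcal F_i}(R,Q\cap S_i)$. *)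

theory Defs
  imports
    "HOL-Algebra.Multiplicative_Group"
    "HOL-Algebra.Group_Action"
    "HOL-Algebra.Generated_Groups"
    "HOL-Algebra.Product_Groups"
    "HOL-Library.Countable_Set"
    "HOL-Computational_Algebra.Primes"
    Complex_Main
begin

section \<open>Locally finite groups and Sylow subgroups of discrete groups\<close>

definition locally_finite :: "('a, 'b) monoid_scheme \<Rightarrow> bool" where
  "locally_finite G \<longleftrightarrow>
     group G \<and> (\<forall>A. A \<subseteq> carrier G \<and> finite A \<longrightarrow> finite (generate G A))"

definition conj_by :: "('a, 'b) monoid_scheme \<Rightarrow> 'a \<Rightarrow> 'a \<Rightarrow> 'a" where
  "conj_by G g x = g \<otimes>\<^bsub>G\<^esub> x \<otimes>\<^bsub>G\<^esub> inv\<^bsub>G\<^esub> g"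

text \<open>The library's \<open>ord\<close> is 0 on elements of infinite order, so these are excluded.\<close>

definition p_subgroup :: "nat \<Rightarrow> ('a, 'b) monoid_scheme \<Rightarrow> 'a set \<Rightarrow> bool" where
  "p_subgroup p G P \<longleftrightarrow> subgroup P G \<and> (\<forall>x\<in>P. \<exists>n. group.ord G x = p ^ n)"

definition Syl :: "nat \<Rightarrow> ('a, 'b) monoid_scheme \<Rightarrow> 'a set set" where
  "Syl p G = {P. p_subgroup p G P \<and>
     (\<forall>Q. p_subgroup p G Q \<longrightarrow> (\<exists>g\<in>carrier G. conj_by G g ` Q \<subseteq> P))}"


section \<open>Discrete p-toral groups\<close>

text \<open>The group \<open>\<int>/p\<^sup>\<infinity>\<close>, realised as the complex roots of unity of \<open>p\<close>-power order.\<close>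

definition pruefer :: "nat \<Rightarrow> complex monoid" where
  "pruefer p = \<lparr>carrier = {z. \<exists>n. z ^ (p ^ n) = 1}, monoid.mult = (*), one = 1\<rparr>"

definition torus_of_rank :: "nat \<Rightarrow> nat \<Rightarrow> ('a, 'b) monoid_scheme \<Rightarrow> bool" where
  "torus_of_rank p r T \<longleftrightarrow> group T \<and> T \<cong> product_group {..<r} (\<lambda>_. pruefer p)"

definition discrete_p_torus :: "nat \<Rightarrow> ('a, 'b) monoid_scheme \<Rightarrow> bool" where
  "discrete_p_torus p T \<longleftrightarrow> (\<exists>r. torus_of_rank p r T)"

definition discrete_p_toral :: "nat \<Rightarrow> ('a, 'b) monoid_scheme \<Rightarrow> bool" where
  "discrete_p_toral p P \<longleftrightarrow> group P \<and>
     (\<exists>U. U \<lhd> P \<and> discrete_p_torus p (P\<lparr>carrier := U\<rparr>) \<and>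
        finite (carrier (P Mod U)) \<and> (\<exists>n. order (P Mod U) = p ^ n))"

text \<open>The descriptions below determine a unique object only when \<open>P\<close> is discrete \<open>p\<close>-toral,
  respectively when \<open>T\<close> is a discrete \<open>p\<close>-torus (and \<open>p\<close> is prime).\<close>

definition identity_component :: "nat \<Rightarrow> ('a, 'b) monoid_scheme \<Rightarrow> 'a set" where
  "identity_component p P =
     (THE U. subgroup U P \<and> discrete_p_torus p (P\<lparr>carrier := U\<rparr>) \<and> finite (rcosets\<^bsub>P\<^esub> U))"

definition torus_rank :: "nat \<Rightarrow> ('a, 'b) monoid_scheme \<Rightarrow> nat" where
  "torus_rank p T = (THE r. torus_of_rank p r T)"

definition toral_order :: "nat \<Rightarrow> ('a, 'b) monoid_scheme \<Rightarrow> nat \<times> nat" where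
  "toral_order p P =
     (let U = identity_component p P
      in (torus_rank p (P\<lparr>carrier := U\<rparr>), order (P Mod U)))"

definition lex_le :: "nat \<times> nat \<Rightarrow> nat \<times> nat \<Rightarrow> bool" where
  "lex_le a b \<longleftrightarrow> fst a < fst b \<or> (fst a = fst b \<and> snd a \<le> snd b)"


section \<open>Fusion systems\<close>

text \<open>Homomorphisms between subgroups of \<open>S\<close>. They are extensional (undefined outside the source),
  so that equality of functions is equality of homomorphisms; the sets are empty unless \<open>P\<close> and
  \<open>Q\<close> are subgroups of \<open>S\<close>.\<close>

definition homs :: "('a, 'b) monoid_scheme \<Rightarrow> 'a set \<Rightarrow> 'a set \<Rightarrow> ('a \<Rightarrow> 'a) set" where
  "homs S P Q = {\<phi>. subgroup P S \<and> subgroup Q S \<and> \<phi> \<in> extensional P \<and>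
     \<phi> \<in> hom (S\<lparr>carrier := P\<rparr>) (S\<lparr>carrier := Q\<rparr>)}"

definition inj_homs :: "('a, 'b) monoid_scheme \<Rightarrow> 'a set \<Rightarrow> 'a set \<Rightarrow> ('a \<Rightarrow> 'a) set" where
  "inj_homs S P Q = {\<phi> \<in> homs S P Q. inj_on \<phi> P}"

text \<open>A fusion system is given by its morphism sets \<open>F P Q\<close>. They are empty unless \<open>P\<close> and \<open>Q\<close>
  are objects, so that equality of fusion systems over \<open>S\<close> is equality of functions.\<close>

type_synonym 'a fusion = "'a set \<Rightarrow> 'a set \<Rightarrow> ('a \<Rightarrow> 'a) set"

text \<open>\<open>group_fusion G S\<close> is \<open>\<F>\<^sub>S(G)\<close>.\<close>

definition group_fusion :: "('a, 'b) monoid_scheme \<Rightarrow> 'a set \<Rightarrow> 'a fusion" where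
  "group_fusion G S P Q = {restrict (conj_by G g) P | g.
     g \<in> carrier G \<and> subgroup P G \<and> P \<subseteq> S \<and> subgroup Q G \<and> Q \<subseteq> S \<and> conj_by G g ` P \<subseteq> Q}"

abbreviation Hom_S :: "('a, 'b) monoid_scheme \<Rightarrow> 'a fusion" where
  "Hom_S S \<equiv> group_fusion S (carrier S)"

definition fusion_system :: "('a, 'b) monoid_scheme \<Rightarrow> 'a fusion \<Rightarrow> bool" where
  "fusion_system S F \<longleftrightarrow>
     (\<forall>P Q. Hom_S S P Q \<subseteq> F P Q \<and> F P Q \<subseteq> inj_homs S P Q) \<and>
     (\<forall>P Q R. \<forall>\<phi>\<in>F P Q. \<forall>\<psi>\<in>F Q R. compose P \<psi> \<phi> \<in> F P R) \<and>
     (\<forall>P Q. \<forall>\<phi>\<in>F P Q. restrict (inv_into P \<phi>) (\<phi> ` P) \<in> F (\<phi> ` P) P)"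

definition fclass :: "('a, 'b) monoid_scheme \<Rightarrow> 'a fusion \<Rightarrow> 'a set \<Rightarrow> 'a set set" where
  "fclass S F P = {\<phi> ` P | \<phi>. \<phi> \<in> F P (carrier S)}"

text \<open>A set of automorphisms of \<open>P\<close> as a group under composition.\<close>

definition aut_group :: "'a set \<Rightarrow> ('a \<Rightarrow> 'a) set \<Rightarrow> ('a \<Rightarrow> 'a) monoid" where
  "aut_group P A = \<lparr>carrier = A, monoid.mult = compose P, one = (\<lambda>x\<in>P. x)\<rparr>"

definition Inn :: "('a, 'b) monoid_scheme \<Rightarrow> 'a set \<Rightarrow> ('a \<Rightarrow> 'a) set" where
  "Inn S P = (\<lambda>g. restrict (conj_by S g) P) ` P"

definition Out :: "('a, 'b) monoid_scheme \<Rightarrow> 'a fusion \<Rightarrow> 'a set \<Rightarrow> ('a \<Rightarrow> 'a) set monoid" where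
  "Out S F P = aut_group P (F P P) Mod Inn S P"

definition centralizer :: "('a, 'b) monoid_scheme \<Rightarrow> 'a set \<Rightarrow> 'a set" where
  "centralizer S P = {g \<in> carrier S. \<forall>x\<in>P. g \<otimes>\<^bsub>S\<^esub> x = x \<otimes>\<^bsub>S\<^esub> g}"

definition fully_centralized ::
    "nat \<Rightarrow> ('a, 'b) monoid_scheme \<Rightarrow> 'a fusion \<Rightarrow> 'a set \<Rightarrow> bool" where
  "fully_centralized p S F P \<longleftrightarrow>
     (\<forall>P'\<in>fclass S F P. lex_le (toral_order p (S\<lparr>carrier := centralizer S P'\<rparr>))
                               (toral_order p (S\<lparr>carrier := centralizer S P\<rparr>)))"

definition fully_normalized ::
    "nat \<Rightarrow> ('a, 'b) monoid_scheme \<Rightarrow> 'a fusion \<Rightarrow> 'a set \<Rightarrow> bool" where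
  "fully_normalized p S F P \<longleftrightarrow>
     (\<forall>P'\<in>fclass S F P. lex_le (toral_order p (S\<lparr>carrier := normalizer S P'\<rparr>))
                               (toral_order p (S\<lparr>carrier := normalizer S P\<rparr>)))"

text \<open>Elements of the quotient groups are cosets of \<open>Inn S P\<close>, so \<open>Out\<^sub>S(P)\<close> is literally a subset
  of \<open>Out\<^sub>F(P)\<close>.\<close>

definition fully_automized ::
    "nat \<Rightarrow> ('a, 'b) monoid_scheme \<Rightarrow> 'a fusion \<Rightarrow> 'a set \<Rightarrow> bool" where
  "fully_automized p S F P \<longleftrightarrow>
     finite (carrier (Out S F P)) \<and> carrier (Out S (Hom_S S) P) \<in> Syl p (Out S F P)"

definition N_phi ::
    "('a, 'b) monoid_scheme \<Rightarrow> 'a set \<Rightarrow> 'a set \<Rightarrow> ('a \<Rightarrow> 'a) \<Rightarrow> 'a set" where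
  "N_phi S Q P \<phi> = {g \<in> normalizer S Q.
     (\<lambda>x\<in>P. \<phi> (conj_by S g (inv_into Q \<phi> x))) \<in> Hom_S S P P}"

text \<open>A morphism \<open>\<phi> \<in> F Q P\<close> is an isomorphism in the category iff \<open>\<phi> ` Q = P\<close>.\<close>

definition receptive :: "('a, 'b) monoid_scheme \<Rightarrow> 'a fusion \<Rightarrow> 'a set \<Rightarrow> bool" where
  "receptive S F P \<longleftrightarrow>
     (\<forall>Q\<in>fclass S F P. \<forall>\<phi>\<in>F Q P. \<phi> ` Q = P \<longrightarrow>
        (\<exists>\<psi>\<in>F (N_phi S Q P \<phi>) (carrier S). restrict \<psi> Q = \<phi>))"

definition saturated :: "nat \<Rightarrow> ('a, 'b) monoid_scheme \<Rightarrow> 'a fusion \<Rightarrow> bool" where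
  "saturated p S F \<longleftrightarrow>
     fusion_system S F \<and>
     (\<forall>P. subgroup P S \<and> fully_normalized p S F P \<longrightarrow>
        fully_automized p S F P \<and> fully_centralized p S F P) \<and>
     (\<forall>P. subgroup P S \<and> fully_centralized p S F P \<longrightarrow> receptive S F P) \<and>
     (\<forall>P. \<forall>\<phi>\<in>inj_homs S P (carrier S).
        (\<forall>R. subgroup R S \<and> R \<subseteq> P \<and> finite R \<longrightarrow> restrict \<phi> R \<in> F R (carrier S)) \<longrightarrow>
        \<phi> \<in> F P (carrier S))"

text \<open>Union of an increasing sequence of fusion systems \<open>Fs i\<close> over finite subgroups \<open>Ss i\<close> of
  \<open>S\<close>.\<close>

definition fusion_Union ::
    "('a, 'b) monoid_scheme \<Rightarrow> (nat \<Rightarrow> 'a set) \<Rightarrow> (nat \<Rightarrow> 'a fusion) \<Rightarrow> 'a fusion" where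
  "fusion_Union S Ss Fs P Q = {\<phi> \<in> homs S P Q.
     \<forall>R. subgroup R S \<and> R \<subseteq> P \<and> finite R \<longrightarrow>
       (\<exists>i. R \<subseteq> Ss i \<and> restrict \<phi> R \<in> Fs i R (Q \<inter> Ss i))}"

definition sylow_exhaustion ::
    "nat \<Rightarrow> ('a, 'b) monoid_scheme \<Rightarrow> 'a set \<Rightarrow> (nat \<Rightarrow> 'a set) \<Rightarrow> bool" where
  "sylow_exhaustion p G S Gs \<longleftrightarrow>
     (\<forall>i. subgroup (Gs i) G \<and> finite (Gs i) \<and> Gs i \<subseteq> Gs (Suc i) \<and>
          S \<inter> Gs i \<in> Syl p (G\<lparr>carrier := Gs i\<rparr>)) \<and>
     (\<Union>i. Gs i) = carrier G"

end

theory Submission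
  imports Defs "HOL-Algebra.Sylow"
begin

text \<open>(b) Choose nested Sylow subgroups \<open>Q\<^sub>n\<close> of a finite exhaustion \<open>K\<^sub>n\<close> of \<open>G\<close>. Their union is a
  \<open>p\<close>-subgroup, hence conjugate by some \<open>g\<close> into \<open>S\<close>, and the groups \<open>g K\<^sub>n g\<^sup>-\<^sup>1\<close> are as required.
  The description of \<open>\<F>\<close> as a union is the continuity axiom.

  (a) Let \<open>T\<close> be the identity component of \<open>S\<close>. Its automizer \<open>W\<close> is finite, and morphisms between
  subgroups of \<open>T\<close> are restrictions of elements of \<open>W\<close>. For \<open>P \<le> S\<close> let \<open>B\<close> be its identity component
  and \<open>J\<close> the identity component of the fixed points in \<open>T\<close> of the pointwise stabilizer of \<open>B\<close> in \<open>W\<close>.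
  There are finitely many such \<open>J\<close>. By receptivity of fully centralized subgroups every morphism on
  \<open>P = R B\<close>, \<open>R\<close> finite, extends to \<open>R J\<close>, where it is determined by its restriction to \<open>R\<close> and by an
  element of \<open>W\<close>. So all morphisms are restrictions of countably many, and choosing an element of \<open>G\<close>
  inducing each of these gives a countable subgroup.\<close>

section \<open>Sylow theory of finite groups\<close>

text \<open>Choosing one element of \<open>G\<close> for every morphism is too expensive: once
  \<open>T\<close> has rank at least 2, \<open>S\<close> has uncountably many subgroups. Treating
  only the countably many finite subgroups is too weak: in the smaller group the restrictions of a
  morphism to different finite subgroups could be induced by different elements, while a morphism on
  an infinite \<open>P\<close> must be induced by a single one. Hence the passage from
  \<open>B\<close> to \<open>J\<close>: the groups \<open>B\<close> may be uncountably many, but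
  \<open>J\<close> depends only on a subset of the finite set \<open>W\<close>. Elements of
  \<open>W\<close> that agree on \<open>B\<close> differ by an element of its stabilizer and so
  agree on \<open>J\<close>; thus the element of \<open>W\<close> that realizes a morphism on
  \<open>B\<close> already prescribes its values on \<open>J\<close>, and only existence is at
  stake. Receptivity reaches only elements that normalize the domain. So \<open>J\<close> is
  approached through growing normalizers, and the continuity axiom carries the extension through
  unions of chains.

  In (b), a single conjugation suffices because \<open>Syl\<close> asks that every
  \<open>p\<close>-subgroup, including an infinite union, have a conjugate inside
  \<open>S\<close>.\<close>

lemma (in group_action) card_mod_fixed_points:
  assumes "prime p" "order G = p ^ k" "finite E"
  shows "card E mod p = card {x \<in> E. \<forall>g\<in>carrier G. \<phi> g x = x} mod p"
proof -
  let ?Fix = "{x \<in> E. \<forall>g\<in>carrier G. \<phi> g x = x}"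
  let ?Orb = "orbits G E \<phi>"
  have G: "group G"
    using group_hom group_hom.axioms(1) by blast
  have sub: "O' \<subseteq> E" if "O' \<in> ?Orb" for O'
    using orbits_coverture that by blast
  have fin: "finite ?Orb"
    using sub finite_subset[of ?Orb "Pow E"] assms(3) by blast
  \<comment> \<open>Orbit sizes divide the \<open>p\<close>-power group order, so an orbit of size
    prime to \<open>p\<close> is a single fixed point. All other orbits vanish modulo
    \<open>p\<close>.\<close>
  have sing: "\<exists>x\<in>?Fix. O' = {x}" if O': "O' \<in> ?Orb" "\<not> p dvd card O'" for O'
  proof -
    obtain x where x: "x \<in> E" "O' = orbit G \<phi> x"
      using O'(1) unfolding orbits_def by blast
    have "card O' * card (stabilizer G \<phi> x) = p ^ k"
      using orbit_stabilizer_theorem[OF x(1)] assms(2) x(2) by simp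
    then have "card O' dvd p ^ k"
      by (metis dvd_triv_left)
    then obtain i where "card O' = p ^ i"
      using divides_primepow_nat[OF assms(1)] by blast
    with O'(2) have "card O' = 1"
      by (cases i) auto
    then obtain y where "O' = {y}"
      using card_1_singletonE by blast
    moreover have "x \<in> O'"
      using x orbit_refl by simp
    moreover have "\<phi> g x \<in> O'" if "g \<in> carrier G" for g
      using x(2) that unfolding orbit_def by blast
    ultimately have "\<forall>g\<in>carrier G. \<phi> g x = x" "O' = {x}"
      by auto
    then show ?thesis using x(1) by blast
  qed
  have orbfix: "{x} \<in> ?Orb" if "x \<in> ?Fix" for x
  proof -
    have "orbit G \<phi> x = {x}"
      using that orbit_refl unfolding orbit_def by auto
    then show ?thesis
      using that unfolding orbits_def by force
  qed
  let ?A = "{O' \<in> ?Orb. p dvd card O'}"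
  let ?B = "{O' \<in> ?Orb. \<not> p dvd card O'}"
  have B: "?B = (\<lambda>x. {x}) ` ?Fix"
    using sing orbfix assms(1) by (auto simp: prime_nat_iff)
  have "card E = (\<Sum>O'\<in>?Orb. card O')"
    using disjoint_sum[OF assms(3), of "\<lambda>_. 1::nat"] by simp
  also have "?Orb = ?A \<union> ?B"
    by blast
  also have "(\<Sum>O'\<in>?A \<union> ?B. card O') = (\<Sum>O'\<in>?A. card O') + (\<Sum>O'\<in>?B. card O')"
    using fin by (intro sum.union_disjoint) auto
  also have "(\<Sum>O'\<in>?B. card O') = card ?Fix"
    unfolding B by (subst sum.reindex) (auto simp: inj_on_def)
  finally have eq: "card E = (\<Sum>O'\<in>?A. card O') + card ?Fix" .
  have "p dvd (\<Sum>O'\<in>?A. card O')"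
    by (rule dvd_sum) simp
  then obtain c where "(\<Sum>O'\<in>?A. card O') = p * c" ..
  then show ?thesis
    unfolding eq by simp
qed

context group
begin

lemma rcosets_right_mult:
  assumes "subgroup P G" "X \<in> rcosets P" "g \<in> carrier G"
  shows "X #> g \<in> rcosets P"
proof -
  obtain a where "a \<in> carrier G" "X = P #> a"
    using assms(2) unfolding RCOSETS_def by blast
  then have "X #> g = P #> (a \<otimes> g)" "a \<otimes> g \<in> carrier G"
    using coset_mult_assoc[of P a g] subgroup.subset[OF assms(1)] assms(3) by auto
  then show ?thesis
    unfolding RCOSETS_def by blast
qed

lemma card_rcosets_mod_fixed:
  assumes "prime p" "finite (carrier G)" "subgroup P G" "subgroup Q G" "card Q = p ^ k"
  shows "card (rcosets P) mod p = card {X \<in> rcosets P. \<forall>g\<in>Q. X #> g = X} mod p"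
proof -
  let ?E = "rcosets P"
  \<comment> \<open>The inverse turns right multiplication of cosets into a left action. Since
    \<open>Q\<close> is closed under inverses, the fixed cosets are the same.\<close>
  define \<phi> where "\<phi> g = (\<lambda>X\<in>?E. X #> inv g)" for g
  have sub: "X \<subseteq> carrier G" if "X \<in> ?E" for X
    using that rcosets_subset_PowG[OF assms(3)] by blast
  have closed: "X #> g \<in> ?E" if "X \<in> ?E" "g \<in> carrier G" for X g
    using rcosets_right_mult[OF assms(3) that] .
  have cancel: "X #> g #> inv g = X" "X #> inv g #> g = X" if "X \<in> ?E" "g \<in> carrier G" for X g
    using that sub[OF that(1)] by (simp_all add: coset_mult_assoc)
  have bij: "\<phi> g \<in> Bij ?E" if g: "g \<in> carrier G" for g
  proof -
    have "bij_betw (\<lambda>X. X #> inv g) ?E ?E"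
      by (rule bij_betwI[where g = "\<lambda>X. X #> g"]) (use g closed cancel in auto)
    then show ?thesis
      unfolding Bij_def \<phi>_def by (auto intro: bij_betw_cong[THEN iffD1, rotated])
  qed
  have Qsub: "Q \<subseteq> carrier G"
    by (rule subgroup.subset[OF assms(4)])
  have "group_hom (G\<lparr>carrier := Q\<rparr>) (BijGroup ?E) \<phi>"
  proof (intro group_hom.intro group_hom_axioms.intro subgroup_imp_group[OF assms(4)] group_BijGroup)
    show "\<phi> \<in> hom (G\<lparr>carrier := Q\<rparr>) (BijGroup ?E)"
    proof (rule homI)
      fix x y assume "x \<in> carrier (G\<lparr>carrier := Q\<rparr>)" "y \<in> carrier (G\<lparr>carrier := Q\<rparr>)"
      then have xy: "x \<in> carrier G" "y \<in> carrier G" using Qsub by auto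
      have "\<phi> (x \<otimes> y) = compose ?E (\<phi> x) (\<phi> y)"
      proof
        fix X show "\<phi> (x \<otimes> y) X = compose ?E (\<phi> x) (\<phi> y) X"
          using xy closed[of X "inv y"] sub[of X]
          by (cases "X \<in> ?E") (auto simp: \<phi>_def compose_def inv_mult_group coset_mult_assoc)
      qed
      then show "\<phi> (x \<otimes>\<^bsub>G\<lparr>carrier := Q\<rparr>\<^esub> y) = \<phi> x \<otimes>\<^bsub>BijGroup ?E\<^esub> \<phi> y"
        using bij xy by (simp add: BijGroup_def)
    qed (use bij Qsub in \<open>auto simp: BijGroup_def\<close>)
  qed
  then interpret act: group_action "G\<lparr>carrier := Q\<rparr>" ?E \<phi>
    by (rule group_action.intro)
  have finE: "finite ?E"
    using assms(2,3) rcosets_subset_PowG finite_subset by (metis finite_Pow_iff)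
  have "card ?E mod p = card {X \<in> ?E. \<forall>g\<in>Q. \<phi> g X = X} mod p"
    using act.card_mod_fixed_points[OF assms(1) _ finE, of k] assms(5) by (simp add: order_def)
  also have "{X \<in> ?E. \<forall>g\<in>Q. \<phi> g X = X} = {X \<in> ?E. \<forall>g\<in>Q. X #> g = X}"
  proof -
    have "(\<lambda>g. inv g) ` Q = Q"
    proof
      show "(\<lambda>g. inv g) ` Q \<subseteq> Q"
        using subgroup.m_inv_closed[OF assms(4)] by blast
      show "Q \<subseteq> (\<lambda>g. inv g) ` Q"
        by (metis subgroup.m_inv_closed[OF assms(4)] subsetD[OF Qsub] inv_inv image_eqI subsetI)
    qed
    then have "(\<forall>g\<in>Q. X #> inv g = X) \<longleftrightarrow> (\<forall>g\<in>Q. X #> g = X)" for X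
      by (metis (no_types, lifting) image_iff)
    then show ?thesis
      unfolding \<phi>_def by auto
  qed
  finally show ?thesis .
qed

text \<open>The bridge from fixed points to conjugacy: a coset of \<open>P\<close> with
  representative \<open>a\<close> that is fixed by all of \<open>Q\<close> yields a conjugation by
  \<open>a\<close> carrying \<open>Q\<close> into \<open>P\<close>.\<close>

lemma fixed_rcoset_conj:
  assumes "subgroup P G" "a \<in> carrier G" "g \<in> carrier G" "P #> a #> g = P #> a"
  shows "a \<otimes> g \<otimes> inv a \<in> P"
proof -
  have "P #> (a \<otimes> g) = P #> a"
    using assms coset_mult_assoc subgroup.subset by metis
  then have "a \<otimes> g \<in> P #> a"
    using rcos_self[of "a \<otimes> g" P] assms by simp
  then show ?thesis
    using assms by (metis subgroup.rcos_module_imp m_closed group_axioms)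
qed

text \<open>Cauchy's argument: for a prime \<open>q\<close> dividing the order, Sylow's theorem with
  exponent 1 gives an element of order \<open>q\<close>. That order also divides a power of
  \<open>p\<close>, so \<open>q = p\<close>.\<close>

lemma exponent_imp_p_power_card:
  assumes "prime p" "finite (carrier G)" "\<And>x. x \<in> carrier G \<Longrightarrow> \<exists>n. x [^] (p ^ n :: nat) = \<one>"
  shows "\<exists>k. order G = p ^ k"
proof -
  have q: "q = p" if q: "prime q" "q dvd order G" for q
  proof -
    obtain m where m: "order G = q ^ 1 * m"
      using q(2) by (auto elim: dvdE)
    obtain H where H: "subgroup H G" "card H = q"
      using Sylow.sylow_thm[OF q(1) group_axioms m assms(2)] by auto
    have "H \<noteq> {\<one>}"
      using H(2) q(1) by (auto simp: prime_nat_iff)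
    then obtain x where x: "x \<in> H" "x \<noteq> \<one>"
      using subgroup.one_closed[OF H(1)] by blast
    have xG: "x \<in> carrier G"
      using x H(1) subgroup.subset by blast
    interpret H: group "G\<lparr>carrier := H\<rparr>"
      using subgroup_imp_group[OF H(1)] .
    have "x [^]\<^bsub>G\<lparr>carrier := H\<rparr>\<^esub> q = \<one>"
      using H.pow_order_eq_1[of x] x H(2) by (simp add: order_def)
    then have "x [^] q = \<one>"
      using nat_pow_consistent by metis
    then have "ord x dvd q"
      using pow_eq_id xG by simp
    moreover obtain n where "x [^] (p ^ n :: nat) = \<one>"
      using assms(3) xG by blast
    then have "ord x dvd p ^ n"
      using pow_eq_id xG by simp
    moreover have "ord x \<noteq> 1"
      using x(2) xG ord_eq_1 by simp
    ultimately have "ord x = q" "q dvd p ^ n"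
      using q(1) by (auto simp: prime_nat_iff)
    then show ?thesis
      using q(1) assms(1) prime_dvd_power primes_dvd_imp_eq by blast
  qed
  have pos: "order G > 0"
    using assms(2) order_gt_0_iff_finite by blast
  show ?thesis
  proof (rule exI)
    have "prime_factors (order G) \<subseteq> {p}"
      using q by (auto simp: prime_factors_dvd)
    have "order G = (\<Prod>q\<in>prime_factors (order G). q ^ multiplicity q (order G))"
      using pos prime_factorization_nat by blast
    also have "\<dots> = (\<Prod>q\<in>{p}. q ^ multiplicity q (order G))"
      using \<open>prime_factors (order G) \<subseteq> {p}\<close> assms(1)
      by (intro prod.mono_neutral_left) (auto simp: prime_factors_multiplicity not_dvd_imp_multiplicity_0)
    finally show "order G = p ^ multiplicity p (order G)" by simp
  qed
qed

text \<open>Powers in a subgroup agree with those of the ambient group, so this form passes between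
  a group and its subgroups without any statement about \<open>ord\<close>.\<close>

lemma p_subgroup_iff:
  assumes "prime p"
  shows "p_subgroup p G P \<longleftrightarrow> subgroup P G \<and> (\<forall>x\<in>P. \<exists>n. x [^] (p ^ n :: nat) = \<one>)"
proof -
  have "(\<exists>n. ord x = p ^ n) \<longleftrightarrow> (\<exists>n. x [^] (p ^ n :: nat) = \<one>)" if "x \<in> carrier G" for x
    using pow_eq_id[OF that] divides_primepow_nat[OF assms, of "ord x"] by (metis dvd_refl)
  then show ?thesis
    unfolding p_subgroup_def using subgroup.mem_carrier by metis
qed

lemma card_p_subgroup:
  assumes "prime p" "p_subgroup p G P" "finite P"
  shows "\<exists>k. card P = p ^ k"
proof -
  have P: "subgroup P G" and tor: "\<forall>x\<in>P. \<exists>n. x [^] (p ^ n :: nat) = \<one>"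
    using assms(2) p_subgroup_iff[OF assms(1)] by auto
  interpret P: group "G\<lparr>carrier := P\<rparr>"
    using subgroup_imp_group[OF P] .
  have "\<exists>n. x [^]\<^bsub>G\<lparr>carrier := P\<rparr>\<^esub> (p ^ n :: nat) = \<one>" if "x \<in> P" for x
    using tor that by (metis nat_pow_consistent)
  then show ?thesis
    using P.exponent_imp_p_power_card[OF assms(1)] assms(3) by (simp add: order_def)
qed

lemma p_subgroup_of_card:
  assumes "prime p" "subgroup P G" "card P = p ^ k"
  shows "p_subgroup p G P"
proof -
  interpret P: group "G\<lparr>carrier := P\<rparr>"
    using subgroup_imp_group[OF assms(2)] .
  have "x [^] (p ^ k) = \<one>" if "x \<in> P" for x
    using P.pow_order_eq_1[of x] that assms(3) by (simp add: order_def flip: nat_pow_consistent)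
  then show ?thesis
    using p_subgroup_iff[OF assms(1)] assms(2) by blast
qed

text \<open>Let \<open>Q\<close> act on the cosets of \<open>P\<close>. Their number is prime to
  \<open>p\<close>, so modulo \<open>p\<close> the number of fixed cosets is not zero.\<close>

lemma Sylow_II:
  assumes "prime p" "finite (carrier G)" "subgroup P G" "\<not> p dvd card (rcosets P)" "p_subgroup p G Q"
  shows "\<exists>g\<in>carrier G. conj_by G g ` Q \<subseteq> P"
proof -
  have Q: "subgroup Q G"
    using assms(5) p_subgroup_def by blast
  then have "finite Q"
    using assms(2) subgroup.subset finite_subset by blast
  then obtain k where k: "card Q = p ^ k"
    using card_p_subgroup[OF assms(1,5)] by blast
  have "card {X \<in> rcosets P. \<forall>g\<in>Q. X #> g = X} mod p \<noteq> 0"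
    using card_rcosets_mod_fixed[OF assms(1-3) Q k] assms(4) by (simp add: dvd_eq_mod_eq_0)
  then have "{X \<in> rcosets P. \<forall>g\<in>Q. X #> g = X} \<noteq> {}"
    by (metis card.empty mod_0)
  then obtain a where "a \<in> carrier G" "\<forall>g\<in>Q. P #> a #> g = P #> a"
    unfolding RCOSETS_def by blast
  then show ?thesis
    using fixed_rcoset_conj[OF assms(3)] subgroup.mem_carrier[OF Q]
    unfolding conj_by_def by blast
qed

text \<open>Sylow's first theorem supplies a subgroup whose order is the full \<open>p\<close>-part.
  Its index is prime to \<open>p\<close>, so \<open>Sylow_II\<close> gives the conjugacy property by
  which \<open>Syl\<close> is defined.\<close>

lemma Sylow_exists:
  assumes "prime p" "finite (carrier G)"
  shows "\<exists>P. P \<in> Syl p G"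
proof -
  define a where "a = multiplicity p (order G)"
  have pos: "order G \<noteq> 0"
    using assms(2) order_gt_0_iff_finite by blast
  obtain m where m: "order G = p ^ a * m" "\<not> p dvd m"
    using multiplicity_decompose'[OF pos, of p] assms(1) unfolding a_def
    by (metis not_prime_unit)
  obtain P where P: "subgroup P G" "card P = p ^ a"
    using Sylow.sylow_thm[OF assms(1) group_axioms m(1) assms(2)] by blast
  have "card (rcosets P) * p ^ a = p ^ a * m"
    using lagrange[OF P(1)] P(2) m(1) by simp
  then have "card (rcosets P) = m"
    using assms(1) by (auto simp: prime_nat_iff)
  then show ?thesis
    using Sylow_II[OF assms P(1)] m(2) p_subgroup_of_card[OF assms(1) P] unfolding Syl_def by auto
qed

text \<open>Let \<open>H\<close> act on its own cosets. Their number is a positive power of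
  \<open>p\<close>, so \<open>p\<close> divides the number of fixed ones. The coset \<open>H\<close>
  is fixed, hence so is another one, and a representative of it conjugates \<open>H\<close> into
  itself.\<close>

lemma normalizer_grows:
  assumes "prime p" "finite (carrier G)" "order G = p ^ k" "subgroup H G" "H \<noteq> carrier G"
  shows "\<exists>g\<in>carrier G - H. conj_by G g ` H \<subseteq> H"
proof -
  obtain i where i: "card H = p ^ i"
    using lagrange[OF assms(4)] assms(1,3) divides_primepow_nat by (metis dvd_triv_right)
  have Hfin: "finite H"
    using assms(2,4) subgroup.subset finite_subset by blast
  have "card (rcosets H) dvd p ^ k"
    using lagrange[OF assms(4)] assms(3) by (metis dvd_triv_left)
  then obtain j where j: "card (rcosets H) = p ^ j"
    using assms(1) divides_primepow_nat by blast
  have "j \<noteq> 0"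
  proof
    assume "j = 0"
    then have "card H = order G"
      using lagrange[OF assms(4)] j by simp
    then show False
      using card_subset_eq[OF assms(2) subgroup.subset[OF assms(4)]] assms(5)
      unfolding order_def by blast
  qed
  let ?X = "{X \<in> rcosets H. \<forall>g\<in>H. X #> g = X}"
  have "card ?X mod p = 0"
    using card_rcosets_mod_fixed[OF assms(1,2,4,4) i] j \<open>j \<noteq> 0\<close> by simp
  moreover have "H \<in> ?X"
  proof -
    have fix_H: "H #> g = H" if "g \<in> H" for g
      using coset_join2 assms(4) subgroup.mem_carrier that by metis
    moreover have "H \<in> rcosets H"
      using fix_H[of \<one>] subgroup.one_closed[OF assms(4)] unfolding RCOSETS_def by blast
    ultimately show ?thesis by blast
  qed
  moreover have "p \<noteq> 1"
    using assms(1) by auto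
  ultimately have "?X \<noteq> {H}"
    by (auto simp: dvd_eq_mod_eq_0)
  then obtain X where X: "X \<in> ?X" "X \<noteq> H"
    using \<open>H \<in> ?X\<close> by blast
  then obtain a where a: "a \<in> carrier G" "X = H #> a"
    unfolding RCOSETS_def by blast
  then have "a \<notin> H"
    using X(2) coset_join2 assms(4) by blast
  moreover have "conj_by G a ` H \<subseteq> H"
    using fixed_rcoset_conj[OF assms(4) a(1)] X(1) a(2) subgroup.mem_carrier[OF assms(4)]
    unfolding conj_by_def by blast
  ultimately show ?thesis
    using a(1) by blast
qed

end

section \<open>Exhaustion by finite subgroups\<close>

context group
begin

section \<open>Conjugation, and Sylow subgroups of subgroups\<close>

lemma conj_by_closed [simp]: "g \<in> carrier G \<Longrightarrow> x \<in> carrier G \<Longrightarrow> conj_by G g x \<in> carrier G"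
  by (simp add: conj_by_def)

lemma conj_by_conj_by:
  "\<lbrakk>g \<in> carrier G; h \<in> carrier G; x \<in> carrier G\<rbrakk> \<Longrightarrow> conj_by G g (conj_by G h x) = conj_by G (g \<otimes> h) x"
  by (simp add: conj_by_def inv_mult_group m_assoc)

lemma conj_by_one [simp]: "x \<in> carrier G \<Longrightarrow> conj_by G \<one> x = x"
  by (simp add: conj_by_def)

lemma conj_by_mult:
  assumes "g \<in> carrier G" "x \<in> carrier G" "y \<in> carrier G"
  shows "conj_by G g (x \<otimes> y) = conj_by G g x \<otimes> conj_by G g y"
proof -
  have "inv g \<otimes> (g \<otimes> (y \<otimes> inv g)) = y \<otimes> inv g"
    using assms by (simp flip: m_assoc)
  then show ?thesis
    using assms by (simp add: conj_by_def m_assoc)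
qed

lemma conj_by_inv_cancel [simp]:
  assumes "g \<in> carrier G" "x \<in> carrier G"
  shows "conj_by G (inv g) (conj_by G g x) = x" "conj_by G g (conj_by G (inv g) x) = x"
  using assms by (simp_all add: conj_by_conj_by)

lemma conj_by_hom: "g \<in> carrier G \<Longrightarrow> group_hom G G (conj_by G g)"
  by (intro group_hom.intro group_hom_axioms.intro homI group_axioms) (auto simp: conj_by_mult)

lemma conj_by_subgroup:
  assumes "g \<in> carrier G" "subgroup H G"
  shows "subgroup (conj_by G g ` H) G"
  using group_hom.subgroup_img_is_subgroup[OF conj_by_hom[OF assms(1)] assms(2)] .

lemma inj_on_conj_by: "g \<in> carrier G \<Longrightarrow> inj_on (conj_by G g) (carrier G)"
  by (metis conj_by_inv_cancel(1) inj_onI)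

lemma conj_by_subgroup_eq:
  assumes "subgroup H G" "g \<in> H"
  shows "conj_by G g ` H = H"
proof
  have H: "H \<subseteq> carrier G" "inv g \<in> H"
    using assms subgroup.subset subgroup.m_inv_closed by auto
  have closed: "conj_by G x y \<in> H" if "x \<in> H" "y \<in> H" for x y
    using that assms(1) unfolding conj_by_def by (simp add: subgroup_def)
  then show "conj_by G g ` H \<subseteq> H" using assms(2) by blast
  show "H \<subseteq> conj_by G g ` H"
  proof
    fix x assume "x \<in> H"
    then have "conj_by G (inv g) x \<in> H" "conj_by G g (conj_by G (inv g) x) = x"
      using closed[OF H(2)] conj_by_inv_cancel(2)[of g x] subsetD[OF H(1)] assms(2) by auto
    then show "x \<in> conj_by G g ` H"
      by (metis image_eqI)
  qed
qed

lemma conj_by_pow: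
  assumes "g \<in> carrier G" "x \<in> carrier G"
  shows "conj_by G g (x [^] (n::nat)) = conj_by G g x [^] n"
  using group_hom.hom_nat_pow[OF conj_by_hom[OF assms(1)] assms(2)] .

lemma conj_by_subgroup_consistent:
  assumes "subgroup K G" "g \<in> K"
  shows "conj_by (G\<lparr>carrier := K\<rparr>) g = conj_by G g"
  using assms by (auto simp: conj_by_def)

lemma subgroup_restrict_iff:
  assumes "subgroup K G"
  shows "subgroup P (G\<lparr>carrier := K\<rparr>) \<longleftrightarrow> subgroup P G \<and> P \<subseteq> K"
  using incl_subgroup[OF assms] subgroup_incl[OF _ assms] subgroup.subset by fastforce

lemma p_subgroup_restrict_iff:
  assumes "prime p" "subgroup K G"
  shows "p_subgroup p (G\<lparr>carrier := K\<rparr>) P \<longleftrightarrow> p_subgroup p G P \<and> P \<subseteq> K"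
  unfolding p_subgroup_iff[OF assms(1)] group.p_subgroup_iff[OF subgroup_imp_group[OF assms(2)] assms(1)]
  by (auto simp: subgroup_restrict_iff[OF assms(2)] simp flip: nat_pow_consistent)

lemma Syl_restrict_iff:
  assumes "prime p" "subgroup K G"
  shows "P \<in> Syl p (G\<lparr>carrier := K\<rparr>) \<longleftrightarrow> p_subgroup p G P \<and> P \<subseteq> K \<and>
    (\<forall>Q. p_subgroup p G Q \<and> Q \<subseteq> K \<longrightarrow> (\<exists>g\<in>K. conj_by G g ` Q \<subseteq> P))"
  unfolding Syl_def mem_Collect_eq p_subgroup_restrict_iff[OF assms]
  using conj_by_subgroup_consistent[OF assms(2)] by simp

lemma p_subgroup_subset:
  assumes "prime p" "p_subgroup p G P" "subgroup Q G" "Q \<subseteq> P"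
  shows "p_subgroup p G Q"
  using assms p_subgroup_iff by blast

lemma p_subgroup_conj:
  assumes "prime p" "p_subgroup p G P" "g \<in> carrier G"
  shows "p_subgroup p G (conj_by G g ` P)"
proof -
  have P: "subgroup P G" "\<forall>x\<in>P. \<exists>n. x [^] (p ^ n :: nat) = \<one>"
    using assms p_subgroup_iff by auto
  have "\<exists>n. conj_by G g x [^] (p ^ n :: nat) = \<one>" if x: "x \<in> P" for x
  proof -
    obtain n where n: "x [^] (p ^ n :: nat) = \<one>"
      using P(2) x by blast
    have "conj_by G g x [^] (p ^ n :: nat) = conj_by G g (x [^] (p ^ n :: nat))"
      using conj_by_pow[OF assms(3)] subgroup.mem_carrier[OF P(1) x] by simp
    also have "\<dots> = \<one>"
      using n assms(3) by (simp add: conj_by_def)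
    finally show ?thesis ..
  qed
  then show ?thesis
    using p_subgroup_iff[OF assms(1)] conj_by_subgroup[OF assms(3) P(1)] by auto
qed

lemma Syl_conj:
  assumes "prime p" "subgroup K G" "P \<in> Syl p (G\<lparr>carrier := K\<rparr>)" "g \<in> carrier G"
  shows "conj_by G g ` P \<in> Syl p (G\<lparr>carrier := conj_by G g ` K\<rparr>)"
proof -
  let ?K = "conj_by G g ` K"
  have P: "p_subgroup p G P" "P \<subseteq> K"
    and max: "\<And>Q. p_subgroup p G Q \<Longrightarrow> Q \<subseteq> K \<Longrightarrow> \<exists>h\<in>K. conj_by G h ` Q \<subseteq> P"
    using assms(3) Syl_restrict_iff[OF assms(1,2)] by auto
  have KG: "K \<subseteq> carrier G"
    using assms(2) subgroup.subset by blast
  have "\<exists>h\<in>?K. conj_by G h ` Q \<subseteq> conj_by G g ` P" if Q: "p_subgroup p G Q" "Q \<subseteq> ?K" for Q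
  proof -
    have "conj_by G (inv g) ` Q \<subseteq> K"
      using Q(2) KG assms(4) conj_by_inv_cancel(1)[OF assms(4)] by fastforce
    then obtain h where h: "h \<in> K" "conj_by G h ` conj_by G (inv g) ` Q \<subseteq> P"
      using max[OF p_subgroup_conj[OF assms(1) Q(1) inv_closed[OF assms(4)]]] by blast
    \<comment> \<open>The conjugate of \<open>h\<close> by \<open>g\<close> does in the conjugate of
      \<open>K\<close> what \<open>h\<close> does in \<open>K\<close>.\<close>
    have "conj_by G (conj_by G g h) x \<in> conj_by G g ` P" if x: "x \<in> Q" for x
    proof -
      have "subgroup Q G"
        using Q(1) unfolding p_subgroup_def by blast
      then have xG: "x \<in> carrier G" and hG: "h \<in> carrier G"
        using x KG h(1) subgroup.mem_carrier by auto
      have "conj_by G (conj_by G g h) x = conj_by G (g \<otimes> h \<otimes> inv g) x"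
        by (simp add: conj_by_def)
      also have "\<dots> = conj_by G g (conj_by G h (conj_by G (inv g) x))"
        using xG hG assms(4) by (simp add: conj_by_conj_by m_assoc)
      finally show ?thesis
        using h(2) x by blast
    qed
    then show ?thesis
      using h(1) by blast
  qed
  then show ?thesis
    using P(2) p_subgroup_conj[OF assms(1) P(1) assms(4)]
    unfolding Syl_restrict_iff[OF assms(1) conj_by_subgroup[OF assms(4,2)]] by auto
qed

text \<open>\<open>Syl\<close> speaks of conjugacy, not of maximality. In a finite group the two are
  linked by counting: a conjugate of \<open>Q\<close> fits into \<open>P\<close>, so
  \<open>Q\<close> is no larger than its subgroup \<open>P\<close>.\<close>

lemma Syl_maximal:
  assumes "prime p" "subgroup K G" "P \<in> Syl p (G\<lparr>carrier := K\<rparr>)"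
    and "p_subgroup p G Q" "P \<subseteq> Q" "Q \<subseteq> K" "finite K"
  shows "Q = P"
proof -
  have P: "P \<subseteq> K" and max: "\<And>Q. p_subgroup p G Q \<Longrightarrow> Q \<subseteq> K \<Longrightarrow> \<exists>g\<in>K. conj_by G g ` Q \<subseteq> P"
    using assms(3) unfolding Syl_restrict_iff[OF assms(1,2)] by auto
  obtain g where g: "g \<in> K" "conj_by G g ` Q \<subseteq> P"
    using max[OF assms(4,6)] by blast
  have "finite Q" "finite P"
    using finite_subset[OF _ assms(7)] P assms(6) by auto
  have KG: "K \<subseteq> carrier G"
    by (rule subgroup.subset[OF assms(2)])
  have "inj_on (conj_by G g) Q"
    by (rule inj_on_subset[OF inj_on_conj_by]) (use g(1) KG assms(6) in auto)
  then have "card Q = card (conj_by G g ` Q)"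
    by (simp add: card_image)
  also have "\<dots> \<le> card P"
    using g(2) \<open>finite P\<close> by (rule card_mono[rotated])
  finally show ?thesis
    using assms(5) \<open>finite Q\<close> by (metis card_seteq)
qed

text \<open>Some Sylow subgroup contains a conjugate of \<open>Q\<close>; conjugating it back inside
  \<open>K\<close> gives one that contains \<open>Q\<close>. This is what makes a nested choice of
  Sylow subgroups possible.\<close>

lemma p_subgroup_in_Syl:
  assumes "prime p" "subgroup K G" "finite K" "p_subgroup p G Q" "Q \<subseteq> K"
  shows "\<exists>P\<in>Syl p (G\<lparr>carrier := K\<rparr>). Q \<subseteq> P"
proof -
  obtain P where P: "P \<in> Syl p (G\<lparr>carrier := K\<rparr>)"
    using group.Sylow_exists[OF subgroup_imp_group[OF assms(2)] assms(1)] assms(3) by auto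
  then obtain g where g: "g \<in> K" "conj_by G g ` Q \<subseteq> P"
    using assms(4,5) P unfolding Syl_restrict_iff[OF assms(1,2)] by auto
  have inv: "inv g \<in> K" "g \<in> carrier G"
    using assms(2) g(1) by (auto simp: subgroup.m_inv_closed subgroup.mem_carrier)
  have "conj_by G (inv g) ` P \<in> Syl p (G\<lparr>carrier := K\<rparr>)"
    using Syl_conj[OF assms(1,2) P, of "inv g"] inv conj_by_subgroup_eq[OF assms(2) inv(1)] by simp
  moreover have "Q \<subseteq> conj_by G (inv g) ` P"
  proof
    fix x assume "x \<in> Q"
    then have "conj_by G g x \<in> P" "conj_by G (inv g) (conj_by G g x) = x"
      using g(2) inv(2) assms(5) subgroup.subset[OF assms(2)] by auto
    then show "x \<in> conj_by G (inv g) ` P"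
      by (metis image_eqI)
  qed
  ultimately show ?thesis by blast
qed

lemma sylow_exhaustion_exists:
  assumes "prime p" "locally_finite G" "countable (carrier G)" "S \<in> Syl p G"
  shows "\<exists>Gs. sylow_exhaustion p G S Gs"
proof -
  have S: "p_subgroup p G S"
    and max: "\<And>Q. p_subgroup p G Q \<Longrightarrow> \<exists>g\<in>carrier G. conj_by G g ` Q \<subseteq> S"
    using assms(4) unfolding Syl_def by auto
  \<comment> \<open>\<open>from_nat_into\<close> repeats values when the group is finite, so finite
    and infinite countable groups are treated alike.\<close>
  define e where "e = from_nat_into (carrier G)"
  define K where "K n = generate G (e ` {..<n})" for n
  have e: "range e = carrier G"
    unfolding e_def using assms(3) one_closed by (metis empty_iff range_from_nat_into)
  have eG: "e ` A \<subseteq> carrier G" for A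
    using e by blast
  have K: "subgroup (K n) G" "finite (K n)" "K n \<subseteq> K (Suc n)" for n
    using generate_is_subgroup[OF eG] assms(2) eG mono_generate[of "e ` {..<n}" "e ` {..<Suc n}", OF image_mono]
    unfolding K_def locally_finite_def by auto
  have K_union: "(\<Union>n. K n) = carrier G"
  proof -
    have "e n \<in> K (Suc n)" for n
      unfolding K_def by (rule generate.incl) simp
    then have "range e \<subseteq> (\<Union>n. K n)"
      by blast
    then show ?thesis
      using e subgroup.subset[OF K(1)] by auto
  qed
  have "\<exists>Q. \<forall>n. Q n \<in> Syl p (G\<lparr>carrier := K n\<rparr>) \<and> Q n \<subseteq> Q (Suc n)"
  proof (rule dependent_nat_choice)
    show "\<exists>P. P \<in> Syl p (G\<lparr>carrier := K 0\<rparr>)"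
      using group.Sylow_exists[OF subgroup_imp_group[OF K(1)] assms(1)] K(2) by auto
  next
    fix P n assume "P \<in> Syl p (G\<lparr>carrier := K n\<rparr>)"
    then have "p_subgroup p G P" "P \<subseteq> K (Suc n)"
      using K(3) unfolding Syl_restrict_iff[OF assms(1) K(1)] by auto
    then show "\<exists>P'. P' \<in> Syl p (G\<lparr>carrier := K (Suc n)\<rparr>) \<and> P \<subseteq> P'"
      using p_subgroup_in_Syl[OF assms(1) K(1,2)[of "Suc n"]] by blast
  qed
  then obtain Q where Q: "\<And>n. Q n \<in> Syl p (G\<lparr>carrier := K n\<rparr>)" "\<And>n. Q n \<subseteq> Q (Suc n)"
    by blast
  have Qp: "p_subgroup p G (Q n)" "Q n \<subseteq> K n" for n
    using Q(1)[of n] unfolding Syl_restrict_iff[OF assms(1) K(1)] by auto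
  then have Qsub: "subgroup (Q n) G" for n
    unfolding p_subgroup_def by blast
  have mono: "Q m \<subseteq> Q n" if "m \<le> n" for m n
    using lift_Suc_mono_le[of Q, OF Q(2) that] .
  have "subgroup (\<Union>n. Q n) G"
  proof (rule subgroupI)
    show "(\<Union>n. Q n) \<subseteq> carrier G"
      using Qsub subgroup.subset by blast
    show "(\<Union>n. Q n) \<noteq> {}"
      using Qsub subgroup.one_closed by blast
    show "inv a \<in> (\<Union>n. Q n)" if "a \<in> (\<Union>n. Q n)" for a
      using that subgroup.m_inv_closed[OF Qsub] by blast
    show "a \<otimes> b \<in> (\<Union>n. Q n)" if ab: "a \<in> (\<Union>n. Q n)" "b \<in> (\<Union>n. Q n)" for a b
    proof -
      obtain m n where "a \<in> Q m" "b \<in> Q n"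
        using ab by blast
      then have "a \<in> Q (max m n)" "b \<in> Q (max m n)"
        using mono[of m "max m n"] mono[of n "max m n"] by auto
      then show ?thesis
        using subgroup.m_closed[OF Qsub] by blast
    qed
  qed
  then have "p_subgroup p G (\<Union>n. Q n)"
    using Qp(1) unfolding p_subgroup_iff[OF assms(1)] by blast
  then obtain g where g: "g \<in> carrier G" "conj_by G g ` (\<Union>n. Q n) \<subseteq> S"
    using max by blast
  define Gs where "Gs n = conj_by G g ` K n" for n
  have Gs: "subgroup (Gs n) G" "finite (Gs n)" "Gs n \<subseteq> Gs (Suc n)" for n
    using K[of n] conj_by_subgroup[OF g(1)] unfolding Gs_def by auto
  have "S \<inter> Gs n \<in> Syl p (G\<lparr>carrier := Gs n\<rparr>)" for n
  proof -
    have syl: "conj_by G g ` Q n \<in> Syl p (G\<lparr>carrier := Gs n\<rparr>)"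
      unfolding Gs_def using Syl_conj[OF assms(1) K(1) Q(1) g(1)] .
    \<comment> \<open>The intersection is a \<open>p\<close>-subgroup containing a Sylow subgroup of
      \<open>Gs n\<close>, so it equals that subgroup.\<close>
    have "S \<inter> Gs n = conj_by G g ` Q n"
    proof (rule Syl_maximal[OF assms(1) Gs(1) syl])
      show "p_subgroup p G (S \<inter> Gs n)"
        using p_subgroup_subset[OF assms(1) S] subgroups_Inter_pair Gs(1) S
        unfolding p_subgroup_def by blast
      show "conj_by G g ` Q n \<subseteq> S \<inter> Gs n"
        using g(2) Qp(2) unfolding Gs_def by blast
    qed (use Gs in auto)
    then show ?thesis
      using syl by simp
  qed
  moreover have "(\<Union>n. Gs n) = carrier G"
  proof -
    have "(\<Union>n. Gs n) = conj_by G g ` carrier G"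
      unfolding Gs_def K_union[symmetric] by blast
    then show ?thesis
      using conj_by_subgroup_eq[OF subgroup_self g(1)] by simp
  qed
  ultimately show ?thesis
    using Gs unfolding sylow_exhaustion_def by blast
qed

lemma fusion_Union_exhaustion:
  assumes "subgroup S G" "locally_finite G"
    and sat: "saturated p (G\<lparr>carrier := S\<rparr>) (group_fusion G S)"
    and exh: "sylow_exhaustion p G S Gs"
  shows "group_fusion G S = fusion_Union (G\<lparr>carrier := S\<rparr>) (\<lambda>i. S \<inter> Gs i)
    (\<lambda>i. group_fusion (G\<lparr>carrier := Gs i\<rparr>) (S \<inter> Gs i))" (is "?F = ?U")
proof (intro ext Set.set_eqI)
  have Gs: "subgroup (Gs i) G" "Gs i \<subseteq> Gs (Suc i)" "(\<Union>i. Gs i) = carrier G" for i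
    using exh unfolding sylow_exhaustion_def by auto
  have mono: "Gs m \<subseteq> Gs n" if "m \<le> n" for m n
    using lift_Suc_mono_le[of Gs, OF Gs(2) that] .
  have in_Gs: "\<exists>i. R \<subseteq> Gs i" if "finite R" "R \<subseteq> carrier G" for R
    using that
  proof (induction R rule: finite_induct)
    case (insert x R)
    then obtain i j where "R \<subseteq> Gs i" "x \<in> Gs j"
      using Gs(3) by blast
    then have "insert x R \<subseteq> Gs (max i j)"
      using mono[of i "max i j"] mono[of j "max i j"] by auto
    then show ?case ..
  qed auto
  note sub_S = subgroup_restrict_iff[OF assms(1)]
  have fus: "fusion_system (G\<lparr>carrier := S\<rparr>) ?F"
    using sat unfolding saturated_def by blast
  fix P Q \<phi>
  show "\<phi> \<in> ?F P Q \<longleftrightarrow> \<phi> \<in> ?U P Q"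
  proof
    assume \<phi>: "\<phi> \<in> ?F P Q"
    then obtain g where g: "\<phi> = restrict (conj_by G g) P" "g \<in> carrier G" "subgroup P G" "P \<subseteq> S"
      "subgroup Q G" "Q \<subseteq> S" "conj_by G g ` P \<subseteq> Q"
      unfolding group_fusion_def by blast
    have "\<exists>i. R \<subseteq> S \<inter> Gs i \<and>
        restrict \<phi> R \<in> group_fusion (G\<lparr>carrier := Gs i\<rparr>) (S \<inter> Gs i) R (Q \<inter> (S \<inter> Gs i))"
      if R: "subgroup R (G\<lparr>carrier := S\<rparr>)" "R \<subseteq> P" "finite R" for R
    proof -
      have RG: "subgroup R G" "R \<subseteq> S"
        using R(1) sub_S by auto
      \<comment> \<open>With \<open>g\<close> itself in \<open>Gs i\<close>, the conjugate of
        \<open>R\<close> by \<open>g\<close> stays in \<open>Gs i\<close> as well.\<close>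
      obtain i where i: "insert g R \<subseteq> Gs i"
        using in_Gs[of "insert g R"] R(3) g(2) RG(1) subgroup.subset by blast
      have "restrict \<phi> R = restrict (conj_by (G\<lparr>carrier := Gs i\<rparr>) g) R"
        using R(2) g(1) conj_by_subgroup_consistent[OF Gs(1), of g i] i by (auto simp: restrict_def fun_eq_iff)
      moreover have "conj_by (G\<lparr>carrier := Gs i\<rparr>) g ` R \<subseteq> Q \<inter> (S \<inter> Gs i)"
      proof
        fix y assume "y \<in> conj_by (G\<lparr>carrier := Gs i\<rparr>) g ` R"
        then obtain x where x: "x \<in> R" "y = conj_by G g x"
          using conj_by_subgroup_consistent[OF Gs(1), of g i] i by auto
        then have "y \<in> Q" "y \<in> conj_by G g ` Gs i"
          using g(7) R(2) i by auto
        then show "y \<in> Q \<inter> (S \<inter> Gs i)"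
          using conj_by_subgroup_eq[OF Gs(1), of g i] g(6) i by auto
      qed
      moreover have "subgroup (Q \<inter> (S \<inter> Gs i)) G"
        using g(5) assms(1) Gs(1) subgroups_Inter_pair by blast
      ultimately show ?thesis
        using i RG unfolding group_fusion_def subgroup_restrict_iff[OF Gs(1)] by auto
    qed
    moreover have "\<phi> \<in> homs (G\<lparr>carrier := S\<rparr>) P Q"
      using fus \<phi> unfolding fusion_system_def inj_homs_def by blast
    ultimately show "\<phi> \<in> ?U P Q"
      unfolding fusion_Union_def by blast
  next
    assume \<phi>: "\<phi> \<in> ?U P Q"
    then have hom: "\<phi> \<in> homs (G\<lparr>carrier := S\<rparr>) P Q"
      unfolding fusion_Union_def by blast
    then have P: "subgroup P G" "P \<subseteq> S" and Q: "subgroup Q G" "Q \<subseteq> S" and ext: "\<phi> \<in> extensional P"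
      and maps: "\<And>x. x \<in> P \<Longrightarrow> \<phi> x \<in> Q"
      unfolding homs_def sub_S hom_def by auto
    have local_conj: "\<exists>g\<in>carrier G. \<forall>x\<in>R. \<phi> x = conj_by G g x"
      if R: "subgroup R G" "R \<subseteq> P" "finite R" for R
    proof -
      have "subgroup R (G\<lparr>carrier := S\<rparr>)"
        using R P sub_S by blast
      then obtain i where "R \<subseteq> S \<inter> Gs i"
        "restrict \<phi> R \<in> group_fusion (G\<lparr>carrier := Gs i\<rparr>) (S \<inter> Gs i) R (Q \<inter> (S \<inter> Gs i))"
        using \<phi> R unfolding fusion_Union_def by blast
      then obtain g where g: "g \<in> Gs i" "restrict \<phi> R = restrict (conj_by (G\<lparr>carrier := Gs i\<rparr>) g) R"
        unfolding group_fusion_def by auto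
      then have "\<forall>x\<in>R. \<phi> x = conj_by G g x"
        using conj_by_subgroup_consistent[OF Gs(1)] by (metis restrict_apply')
      then show ?thesis
        using subgroup.mem_carrier[OF Gs(1) g(1)] by blast
    qed
    \<comment> \<open>Morphisms of \<open>fusion_Union\<close> are only required to be
      homomorphisms. Injectivity is tested on the finite subgroup generated by two elements, where
      \<phi> is a conjugation.\<close>
    have "inj_on \<phi> P"
    proof (rule inj_onI)
      fix x y assume xy: "x \<in> P" "y \<in> P" "\<phi> x = \<phi> y"
      have xyG: "{x, y} \<subseteq> carrier G"
        using xy P(1) subgroup.subset by blast
      let ?R = "generate G {x, y}"
      have "finite ?R" "?R \<subseteq> P" "subgroup ?R G"
        using assms(2) generate_subgroup_incl[of "{x, y}" P] P(1) xy generate_is_subgroup[OF xyG] xyG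
        unfolding locally_finite_def by auto
      then obtain g where g: "g \<in> carrier G" "\<forall>x\<in>?R. \<phi> x = conj_by G g x"
        using local_conj by blast
      moreover have "x \<in> ?R" "y \<in> ?R"
        by (auto intro: generate.incl)
      ultimately have "conj_by G g x = conj_by G g y"
        using xy(3) by metis
      then show "x = y"
        using inj_on_conj_by[OF g(1)] xyG by (auto dest: inj_onD)
    qed
    moreover have "\<phi> \<in> homs (G\<lparr>carrier := S\<rparr>) P S"
      using hom Q subgroup_self assms(1) sub_S[of S] unfolding homs_def hom_def by auto
    ultimately have inj: "\<phi> \<in> inj_homs (G\<lparr>carrier := S\<rparr>) P (carrier (G\<lparr>carrier := S\<rparr>))"
      unfolding inj_homs_def by simp
    have "restrict \<phi> R \<in> ?F R S" if R: "subgroup R (G\<lparr>carrier := S\<rparr>)" "R \<subseteq> P" "finite R" for R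
    proof -
      have RG: "subgroup R G" "R \<subseteq> S"
        using R(1) sub_S by auto
      obtain g where g: "g \<in> carrier G" "\<forall>x\<in>R. \<phi> x = conj_by G g x"
        using local_conj[OF RG(1) R(2,3)] by blast
      have "conj_by G g ` R \<subseteq> S"
        using g(2) maps R(2) Q(2) by fastforce
      moreover have "restrict \<phi> R = restrict (conj_by G g) R"
        using g(2) by (auto simp: restrict_def)
      ultimately show ?thesis
        using RG g(1) assms(1) unfolding group_fusion_def by blast
    qed
    then have "\<phi> \<in> ?F P S"
      using sat inj unfolding saturated_def by simp
    then obtain g where "\<phi> = restrict (conj_by G g) P" "g \<in> carrier G"
      unfolding group_fusion_def by blast
    \<comment> \<open>Continuity only yields a morphism into \<open>S\<close>; the smaller codomain
      \<open>Q\<close> is recovered from the values of \<phi>.\<close>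
    moreover have "conj_by G g ` P \<subseteq> Q" if "\<phi> = restrict (conj_by G g) P" for g
      using maps that by (metis image_subsetI restrict_apply')
    ultimately show "\<phi> \<in> ?F P Q"
      using P Q unfolding group_fusion_def by blast
  qed
qed

end

section \<open>Divisible abelian \<open>p\<close>-groups\<close>

text \<open>A coherent system of generators: the \<open>n\<close>-th has order \<open>p^n\<close>
  and is the \<open>p\<close>-th power of the next. Homomorphisms out of \<open>pruefer p\<close>
  thereby become chains of \<open>p\<close>-th roots.\<close>

definition root_of_unity :: "nat \<Rightarrow> nat \<Rightarrow> complex" where
  "root_of_unity p n = cis (2 * pi / real (p ^ n))"

lemma root_of_unity_0 [simp]: "root_of_unity p 0 = 1"
  by (simp add: root_of_unity_def)

lemma root_of_unity_power: "root_of_unity p n ^ j = cis (2 * pi * real j / real (p ^ n))"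
  by (simp add: root_of_unity_def DeMoivre mult_ac)

lemma root_of_unity_Suc_power:
  assumes "p > 0"
  shows "root_of_unity p (Suc n) ^ p = root_of_unity p n"
proof -
  have "2 * pi * real p / real (p ^ Suc n) = 2 * pi / real (p ^ n)"
    using assms by (simp add: field_simps)
  then show ?thesis
    unfolding root_of_unity_power by (simp add: root_of_unity_def)
qed

lemma root_of_unity_power_eq_1: "p > 0 \<Longrightarrow> root_of_unity p n ^ (p ^ n) = 1"
  unfolding root_of_unity_power by simp

lemma root_of_unity_bij: "p > 0 \<Longrightarrow> bij_betw (\<lambda>j. root_of_unity p n ^ j) {..<p ^ n} {z. z ^ (p ^ n) = 1}"
  using bij_betw_roots_unity[of "p ^ n"] unfolding root_of_unity_power by simp

lemma root_of_unity_inj: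
  assumes "p > 0" "root_of_unity p n ^ j = root_of_unity p n ^ k"
  shows "j mod p ^ n = k mod p ^ n"
proof -
  have red: "root_of_unity p n ^ i = root_of_unity p n ^ (i mod p ^ n)" for i
  proof -
    have "root_of_unity p n ^ i = root_of_unity p n ^ (p ^ n * (i div p ^ n) + i mod p ^ n)"
      by simp
    also have "\<dots> = root_of_unity p n ^ (i mod p ^ n)"
      unfolding power_add power_mult root_of_unity_power_eq_1[OF assms(1)] by simp
    finally show ?thesis .
  qed
  have "inj_on (\<lambda>j. root_of_unity p n ^ j) {..<p ^ n}"
    using root_of_unity_bij[OF assms(1)] by (rule bij_betw_imp_inj_on)
  then show ?thesis
    using assms red[of j] red[of k] by (auto dest!: inj_onD)
qed

lemma carrier_pruefer: "z \<in> carrier (pruefer p) \<longleftrightarrow> (\<exists>n. z ^ (p ^ n) = 1)"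
  and mult_pruefer [simp]: "monoid.mult (pruefer p) = (*)"
  and one_pruefer [simp]: "one (pruefer p) = 1"
  by (simp_all add: pruefer_def)

lemma power_eq_1_mono:
  assumes "z ^ (p ^ n) = (1 :: complex)" "n \<le> N"
  shows "z ^ (p ^ N) = 1"
proof -
  have "z ^ (p ^ N) = (z ^ (p ^ n)) ^ (p ^ (N - n))"
    using assms(2) by (simp flip: power_mult power_add)
  then show ?thesis
    using assms(1) by simp
qed

lemma pruefer_comm_group:
  assumes "p > 0"
  shows "comm_group (pruefer p)"
proof (rule comm_groupI)
  fix x y assume xy: "x \<in> carrier (pruefer p)" "y \<in> carrier (pruefer p)"
  then obtain m n where "x ^ (p ^ m) = 1" "y ^ (p ^ n) = 1"
    unfolding carrier_pruefer by blast
  then have "(x * y) ^ (p ^ max m n) = 1"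
    using power_eq_1_mono[of x p m "max m n"] power_eq_1_mono[of y p n "max m n"]
    by (simp add: power_mult_distrib)
  then show "x \<otimes>\<^bsub>pruefer p\<^esub> y \<in> carrier (pruefer p)"
    unfolding carrier_pruefer by auto
next
  fix x assume "x \<in> carrier (pruefer p)"
  then obtain n where n: "x ^ (p ^ n) = 1"
    unfolding carrier_pruefer by blast
  then have "x \<noteq> 0"
    using assms by (metis power_0_left zero_neq_one power_not_zero neq0_conv power_eq_0_iff)
  then have "inverse x * x = 1" "inverse x ^ (p ^ n) = 1"
    using n by (simp_all add: power_inverse)
  then show "\<exists>y\<in>carrier (pruefer p). y \<otimes>\<^bsub>pruefer p\<^esub> x = \<one>\<^bsub>pruefer p\<^esub>"
    by (intro bexI[of _ "inverse x"]) (auto simp: carrier_pruefer)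
qed (auto simp: carrier_pruefer mult_ac)

text \<open>The form "for all large \<open>N\<close>" lets two elements be written as powers of one
  common root.\<close>

lemma pruefer_eq_root_power:
  assumes "p > 0" "z \<in> carrier (pruefer p)"
  shows "\<exists>n. \<forall>N\<ge>n. \<exists>j. z = root_of_unity p N ^ j"
proof -
  obtain n where n: "z ^ (p ^ n) = 1"
    using assms(2) unfolding carrier_pruefer by blast
  have "\<exists>j. z = root_of_unity p N ^ j" if "n \<le> N" for N
  proof -
    have "z \<in> (\<lambda>j. root_of_unity p N ^ j) ` {..<p ^ N}"
      using power_eq_1_mono[OF n that] root_of_unity_bij[OF assms(1), of N]
      unfolding bij_betw_def by blast
    then show ?thesis by blast
  qed
  then show ?thesis by blast
qed

lemma pruefer_root:
  assumes "prime p" "z \<in> carrier (pruefer p)"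
  shows "\<exists>w\<in>carrier (pruefer p). w ^ p = z"
proof -
  have p: "p > 0"
    using assms(1) prime_gt_0_nat by blast
  obtain n j where "z = root_of_unity p n ^ j"
    using pruefer_eq_root_power[OF p assms(2)] by blast
  then have "(root_of_unity p (Suc n) ^ j) ^ p = z"
    using root_of_unity_Suc_power[OF p, of n] by (metis mult.commute power_mult)
  moreover have "(root_of_unity p (Suc n) ^ j) ^ (p ^ Suc n) = 1"
    using root_of_unity_power_eq_1[OF p, of "Suc n"] by (metis mult.commute power_mult power_one)
  ultimately show ?thesis
    by (intro bexI[of _ "root_of_unity p (Suc n) ^ j"]) (use carrier_pruefer in blast)+
qed

lemma (in group) root_chain_power:
  fixes p :: nat
  assumes "\<And>n. a n \<in> carrier G" "\<And>n. a (Suc n) [^] p = a n"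
  shows "a (n + d) [^] (p ^ d) = a n"
proof (induction d)
  case (Suc d)
  have "a (n + Suc d) [^] (p ^ Suc d) = (a (Suc (n + d)) [^] p) [^] (p ^ d)"
    using assms(1) by (simp add: nat_pow_pow)
  then show ?case
    using Suc assms(2) by simp
qed (use assms in simp)

lemma (in group) pow_mod_eq:
  assumes "a \<in> carrier G" "a [^] (m::nat) = \<one>" "j mod m = k mod m"
  shows "a [^] j = a [^] k"
proof -
  have "a [^] i = a [^] (i mod m)" for i
  proof -
    have "a [^] i = a [^] (m * (i div m) + i mod m)"
      by simp
    also have "\<dots> = (a [^] m) [^] (i div m) \<otimes> a [^] (i mod m)"
      using assms(1) by (simp only: nat_pow_mult nat_pow_pow nat_pow_closed)
    finally show ?thesis
      using assms by simp
  qed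
  then show ?thesis
    using assms(3) by metis
qed

text \<open>The universal property of the Pruefer group as the direct limit of the cyclic groups of
  order \<open>p^n\<close>.\<close>

lemma (in group) pruefer_hom_of_root_chain:
  fixes p :: nat
  assumes "p > 0" "\<And>n. a n \<in> carrier G" "\<And>n. a (Suc n) [^] p = a n" "a 0 = \<one>"
  shows "\<exists>f\<in>hom (pruefer p) G. \<forall>n j. f (root_of_unity p n ^ j) = a n [^] j"
proof -
  let ?r = "root_of_unity p"
  have up: "\<exists>J. ?r n ^ j = ?r N ^ J \<and> a n [^] j = a N [^] J" if le: "n \<le> N" for n N j
  proof -
    obtain d where N: "N = n + d"
      using le_Suc_ex[OF le] by blast
    have r: "?r (n + d) ^ (p ^ d) = ?r n"
      by (induction d) (use root_of_unity_Suc_power[OF assms(1)] in \<open>auto simp: power_mult\<close>)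
    have "?r n ^ j = ?r N ^ (p ^ d * j)"
      unfolding power_mult N r ..
    moreover have "a n [^] j = a N [^] (p ^ d * j)"
      using root_chain_power[of a p n d] assms(2,3) N by (simp flip: nat_pow_pow)
    ultimately show ?thesis by blast
  qed
  have tor: "a n [^] (p ^ n) = \<one>" for n
    using root_chain_power[of a p 0 n] assms by simp
  \<comment> \<open>Both representations are lifted to level \<open>max n m\<close>. There equality
    of the root powers is a congruence of exponents modulo \<open>p ^ max n m\<close>, and
    \<open>a (max n m)\<close> has order dividing that number.\<close>
  have wd: "a n [^] j = a m [^] k" if eq: "?r n ^ j = ?r m ^ k" for n m j k
  proof -
    obtain J K where "?r n ^ j = ?r (max n m) ^ J" "a n [^] j = a (max n m) [^] J"
      "?r m ^ k = ?r (max n m) ^ K" "a m [^] k = a (max n m) [^] K"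
      using up[of n "max n m" j] up[of m "max n m" k] by auto
    moreover from this eq have "J mod p ^ max n m = K mod p ^ max n m"
      using root_of_unity_inj[OF assms(1)] by metis
    ultimately show ?thesis
      using pow_mod_eq[OF assms(2) tor] by metis
  qed
  define f where "f z = (SOME w. \<exists>n j. z = ?r n ^ j \<and> w = a n [^] j)" for z
  have f: "f (?r n ^ j) = a n [^] j" for n j
    unfolding f_def by (rule some_equality) (blast, use wd in metis)
  have "f \<in> hom (pruefer p) G"
  proof (rule homI)
    fix x assume "x \<in> carrier (pruefer p)"
    then obtain n j where "x = ?r n ^ j"
      using pruefer_eq_root_power[OF assms(1)] by blast
    then show "f x \<in> carrier G"
      using f assms(2) by simp
  next
    fix x y assume "x \<in> carrier (pruefer p)" "y \<in> carrier (pruefer p)"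
    then obtain n m where nm: "\<forall>N\<ge>n. \<exists>j. x = ?r N ^ j" "\<forall>N\<ge>m. \<exists>j. y = ?r N ^ j"
      using pruefer_eq_root_power[OF assms(1)] by meson
    obtain j where j: "x = ?r (max n m) ^ j"
      using nm(1) max.cobounded1[of n m] by blast
    obtain k where k: "y = ?r (max n m) ^ k"
      using nm(2) max.cobounded2[of m n] by blast
    show "f (x \<otimes>\<^bsub>pruefer p\<^esub> y) = f x \<otimes> f y"
      unfolding mult_pruefer j k power_add[symmetric] f using assms(2) by (simp add: nat_pow_mult)
  qed
  then show ?thesis
    using f by blast
qed

abbreviation pruefer_power :: "nat \<Rightarrow> nat \<Rightarrow> (nat \<Rightarrow> complex) monoid" where
  "pruefer_power p k \<equiv> product_group {..<k} (\<lambda>_. pruefer p)"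

lemma pruefer_group: "p > 0 \<Longrightarrow> group (pruefer p)"
  using pruefer_comm_group comm_group.axioms(2) by blast

lemma pruefer_power_group: "p > 0 \<Longrightarrow> group (pruefer_power p k)"
  by (simp add: pruefer_group)

lemma pow_pruefer_power:
  assumes "x \<in> carrier (pruefer_power p k)"
  shows "x [^]\<^bsub>pruefer_power p k\<^esub> (n::nat) = (\<lambda>i\<in>{..<k}. x i ^ n)"
proof (induction n)
  case (Suc n)
  then show ?case
    by (auto simp: restrict_def fun_eq_iff mult_ac)
qed (auto simp: restrict_def)

text \<open>An intrinsic description of discrete \<open>p\<close>-tori, without rank or isomorphism;
  for prime \<open>p\<close> the two notions are shown to agree. The finiteness clause is what
  bounds the rank.\<close>

definition divisible_p_group :: "nat \<Rightarrow> ('a, 'b) monoid_scheme \<Rightarrow> bool" where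
  "divisible_p_group p U \<longleftrightarrow> comm_group U \<and>
     (\<forall>x\<in>carrier U. \<exists>n::nat. x [^]\<^bsub>U\<^esub> (p ^ n) = \<one>\<^bsub>U\<^esub>) \<and>
     (\<forall>x\<in>carrier U. \<exists>y\<in>carrier U. y [^]\<^bsub>U\<^esub> p = x) \<and>
     (\<forall>n::nat. finite {x \<in> carrier U. x [^]\<^bsub>U\<^esub> (p ^ n) = \<one>\<^bsub>U\<^esub>})"

lemma divisible_p_group_pruefer_power:
  assumes "prime p"
  shows "divisible_p_group p (pruefer_power p k)"
proof -
  let ?P = "pruefer_power p k"
  have p: "p > 0"
    using assms prime_gt_0_nat by blast
  have comm: "comm_group ?P"
    by (intro group.group_comm_groupI pruefer_power_group[OF p]) (auto simp: fun_eq_iff mult_ac)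
  have tor: "\<exists>n. x [^]\<^bsub>?P\<^esub> (p ^ n) = \<one>\<^bsub>?P\<^esub>" if x: "x \<in> carrier ?P" for x
  proof -
    have "\<forall>i\<in>{..<k}. \<exists>n. x i ^ (p ^ n) = 1"
      using x by (auto simp: PiE_iff carrier_pruefer)
    then obtain n where n: "\<And>i. i \<in> {..<k} \<Longrightarrow> x i ^ (p ^ n i) = 1"
      by metis
    \<comment> \<open>For \<open>k = 0\<close> the maximum of the empty set is unspecified, but then
      there is no coordinate to test.\<close>
    have "x i ^ (p ^ Max (n ` {..<k})) = 1" if "i < k" for i
      using power_eq_1_mono[OF n] that by simp
    then have "x [^]\<^bsub>?P\<^esub> (p ^ Max (n ` {..<k})) = \<one>\<^bsub>?P\<^esub>"
      unfolding pow_pruefer_power[OF x] by (auto simp: restrict_def)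
    then show ?thesis ..
  qed
  have root: "\<exists>y\<in>carrier ?P. y [^]\<^bsub>?P\<^esub> p = x" if x: "x \<in> carrier ?P" for x
  proof -
    have "\<forall>i\<in>{..<k}. \<exists>w\<in>carrier (pruefer p). w ^ p = x i"
      using x pruefer_root[OF assms] by (auto simp: PiE_iff)
    then obtain w where w: "\<And>i. i \<in> {..<k} \<Longrightarrow> w i \<in> carrier (pruefer p) \<and> w i ^ p = x i"
      by metis
    have y: "restrict w {..<k} \<in> carrier ?P"
      using w by auto
    have "restrict w {..<k} [^]\<^bsub>?P\<^esub> p = x"
    proof
      fix i show "(restrict w {..<k} [^]\<^bsub>?P\<^esub> p) i = x i"
        unfolding pow_pruefer_power[OF y] using w[of i] x PiE_arb[of x "{..<k}" _ i]
        by (cases "i < k") auto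
    qed
    then show ?thesis
      using y by blast
  qed
  have fin: "finite {x \<in> carrier ?P. x [^]\<^bsub>?P\<^esub> (p ^ n) = \<one>\<^bsub>?P\<^esub>}" for n
  proof (rule finite_subset)
    show "{x \<in> carrier ?P. x [^]\<^bsub>?P\<^esub> (p ^ n) = \<one>\<^bsub>?P\<^esub>} \<subseteq> {..<k} \<rightarrow>\<^sub>E {z. z ^ (p ^ n) = 1}"
    proof
      fix x assume x: "x \<in> {x \<in> carrier ?P. x [^]\<^bsub>?P\<^esub> (p ^ n) = \<one>\<^bsub>?P\<^esub>}"
      then have "(\<lambda>i\<in>{..<k}. x i ^ (p ^ n)) = (\<lambda>i\<in>{..<k}. 1)"
        using pow_pruefer_power[of x k p "p ^ n"] by simp
      then have "x i ^ (p ^ n) = 1" if "i < k" for i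
        using that by (metis lessThan_iff restrict_apply')
      then show "x \<in> {..<k} \<rightarrow>\<^sub>E {z. z ^ (p ^ n) = 1}"
        using x by (auto simp: PiE_iff)
    qed
    show "finite ({..<k} \<rightarrow>\<^sub>E {z::complex. z ^ (p ^ n) = 1})"
      using p by (intro finite_PiE) (auto intro!: finite_roots_unity)
  qed
  show ?thesis
    unfolding divisible_p_group_def using comm tor root fin by blast
qed

lemma divisible_p_group_of_torus:
  assumes "prime p" "discrete_p_torus p U"
  shows "divisible_p_group p U"
proof -
  obtain k h where U: "group U" and h: "h \<in> iso U (pruefer_power p k)"
    using assms(2) unfolding discrete_p_torus_def torus_of_rank_def is_iso_def by blast
  let ?P = "pruefer_power p k"
  have P: "group ?P"
    using assms(1) pruefer_power_group prime_gt_0_nat by blast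
  interpret h: group_hom U ?P h
    using U P h by (intro group_hom.intro group_hom_axioms.intro) (auto simp: iso_def)
  have bij: "bij_betw h (carrier U) (carrier ?P)"
    using h by (simp add: iso_def)
  then have inj: "inj_on h (carrier U)" and surj: "h ` carrier U = carrier ?P"
    by (auto simp: bij_betw_def)
  have divP: "divisible_p_group p ?P"
    by (rule divisible_p_group_pruefer_power[OF assms(1)])
  have comm: "comm_group U"
  proof (rule group.group_comm_groupI[OF U])
    fix x y assume xy: "x \<in> carrier U" "y \<in> carrier U"
    have "h (x \<otimes>\<^bsub>U\<^esub> y) = h x \<otimes>\<^bsub>?P\<^esub> h y" "h (y \<otimes>\<^bsub>U\<^esub> x) = h y \<otimes>\<^bsub>?P\<^esub> h x"
      using xy by simp_all
    moreover have "h x \<otimes>\<^bsub>?P\<^esub> h y = h y \<otimes>\<^bsub>?P\<^esub> h x"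
      using comm_groupE(4)[OF _ h.hom_closed[OF xy(1)] h.hom_closed[OF xy(2)]] divP
      unfolding divisible_p_group_def by blast
    ultimately show "x \<otimes>\<^bsub>U\<^esub> y = y \<otimes>\<^bsub>U\<^esub> x"
      using inj xy by (metis h.G.m_closed inj_onD)
  qed
  have pow_iff: "h x [^]\<^bsub>?P\<^esub> (n::nat) = \<one>\<^bsub>?P\<^esub> \<longleftrightarrow> x [^]\<^bsub>U\<^esub> n = \<one>\<^bsub>U\<^esub>" if "x \<in> carrier U" for x n
  proof -
    have "h x [^]\<^bsub>?P\<^esub> n = h (x [^]\<^bsub>U\<^esub> n)" "\<one>\<^bsub>?P\<^esub> = h \<one>\<^bsub>U\<^esub>"
      using that h.hom_nat_pow h.hom_one by metis+
    then show ?thesis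
      using inj that by (metis h.G.nat_pow_closed h.G.one_closed inj_onD)
  qed
  have "\<exists>n. x [^]\<^bsub>U\<^esub> (p ^ n) = \<one>\<^bsub>U\<^esub>" if "x \<in> carrier U" for x
    using divP pow_iff[OF that] h.hom_closed[OF that] unfolding divisible_p_group_def by blast
  moreover have "\<exists>y\<in>carrier U. y [^]\<^bsub>U\<^esub> p = x" if x: "x \<in> carrier U" for x
  proof -
    obtain z where "z \<in> carrier ?P" "z [^]\<^bsub>?P\<^esub> p = h x"
      using divP h.hom_closed[OF x] unfolding divisible_p_group_def by blast
    moreover from this surj obtain y where "y \<in> carrier U" "h y = z"
      by (metis imageE)
    ultimately show ?thesis
      using h.hom_nat_pow inj x by (metis h.G.nat_pow_closed inj_onD)
  qed
  moreover have "finite {x \<in> carrier U. x [^]\<^bsub>U\<^esub> (p ^ n) = \<one>\<^bsub>U\<^esub>}" for n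
  proof (rule inj_on_finite)
    show "inj_on h {x \<in> carrier U. x [^]\<^bsub>U\<^esub> (p ^ n) = \<one>\<^bsub>U\<^esub>}"
      using inj by (rule inj_on_subset) auto
    show "h ` {x \<in> carrier U. x [^]\<^bsub>U\<^esub> (p ^ n) = \<one>\<^bsub>U\<^esub>} \<subseteq> {x \<in> carrier ?P. x [^]\<^bsub>?P\<^esub> (p ^ n) = \<one>\<^bsub>?P\<^esub>}"
      using pow_iff h.hom_closed by auto
    show "finite {x \<in> carrier ?P. x [^]\<^bsub>?P\<^esub> (p ^ n) = \<one>\<^bsub>?P\<^esub>}"
      using divP unfolding divisible_p_group_def by blast
  qed
  ultimately show ?thesis
    unfolding divisible_p_group_def using comm by blast
qed

text \<open>Since \<open>m\<close> is invertible modulo \<open>p ^ n\<close>, the element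
  \<open>x\<close> is itself a power of \<open>x [^] m\<close>.\<close>

lemma (in group) coprime_pow_in_subgroup:
  fixes p m n :: nat
  assumes "subgroup H G" "x \<in> carrier G" "x [^] (p ^ n) = \<one>" "coprime m p" "x [^] m \<in> H"
  shows "x \<in> H"
proof -
  have "\<exists>k. (m * k) mod p ^ n = 1 mod p ^ n"
  proof (cases "m = 0")
    \<comment> \<open>\<open>coprime 0 p\<close> forces \<open>p = 1\<close>, so the congruence is
      modulo 1.\<close>
    case True
    then show ?thesis
      using assms(4) by simp
  next
    case False
    obtain d k l where d: "d dvd m" "d dvd p ^ n" "m * k = p ^ n * l + d"
      using bezout_add_strong_nat[OF False] by blast
    have "coprime m (p ^ n)"
      using assms(4) by simp
    then have "d = 1"
      using d(1,2) by (metis coprime_common_divisor_nat)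
    then show ?thesis
      using d(3) by (metis mod_mult_self4)
  qed
  then obtain k where k: "(m * k) mod p ^ n = 1 mod p ^ n" ..
  have "x = x [^] (1::nat)"
    using assms(2) by simp
  also have "\<dots> = x [^] (m * k)"
    using pow_mod_eq[OF assms(2,3) k] by simp
  also have "\<dots> = (x [^] m) [^] k"
    using assms(2) by (simp add: nat_pow_pow)
  also have "\<dots> \<in> H"
    using subgroup.one_closed[OF assms(1)] subgroup.m_closed[OF assms(1) _ assms(5)] by (induction k) auto
  finally show ?thesis .
qed

text \<open>Embed a Pruefer power of maximal rank. If its image missed an element of order
  \<open>p\<close>, a chain of roots above that element would supply one more Pruefer factor. So the
  image contains all elements of order \<open>p\<close>, and as it is divisible it then contains
  everything.\<close>

lemma torus_of_divisible_p_group: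
  fixes U (structure)
  assumes "prime p" "divisible_p_group p U"
  shows "discrete_p_torus p U"
proof -
  interpret comm_group U
    using assms(2) unfolding divisible_p_group_def by blast
  have tor: "\<exists>n. x [^] (p ^ n) = \<one>" if "x \<in> carrier U" for x
    using assms(2) that unfolding divisible_p_group_def by blast
  have root: "\<exists>y\<in>carrier U. y [^] p = x" if "x \<in> carrier U" for x
    using assms(2) that unfolding divisible_p_group_def by blast
  have "finite {x \<in> carrier U. x [^] (p ^ 1) = \<one>}"
    using assms(2) unfolding divisible_p_group_def by blast
  then have fin: "finite {x \<in> carrier U. x [^] p = \<one>}"
    by simp
  have p: "p > 0"
    using assms(1) prime_gt_0_nat by blast
  define emb where "emb k \<longleftrightarrow> (\<exists>f\<in>hom (pruefer_power p k) U. inj_on f (carrier (pruefer_power p k)))" for k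
  have emb0: "emb 0"
  proof -
    have "(\<lambda>_. \<one>) \<in> hom (pruefer_power p 0) U" "inj_on (\<lambda>_. \<one>) (carrier (pruefer_power p 0))"
      by (auto simp: hom_def inj_on_def)
    then show ?thesis
      unfolding emb_def by blast
  qed
  let ?z = "root_of_unity p 1"
  have z: "?z ^ p = 1" "?z \<noteq> 1" "?z \<in> carrier (pruefer p)"
  proof -
    show "?z ^ p = 1"
      using root_of_unity_Suc_power[OF p, of 0] by simp
    then show "?z \<in> carrier (pruefer p)"
      unfolding carrier_pruefer by (metis power_one_right)
    show "?z \<noteq> 1"
      using root_of_unity_inj[OF p, of 1 1 0] assms(1) by (auto simp: prime_nat_iff)
  qed
  have bound: "k \<le> card {x \<in> carrier U. x [^] p = \<one>}" if emb: "emb k" for k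
  proof -
    obtain f where f: "f \<in> hom (pruefer_power p k) U" "inj_on f (carrier (pruefer_power p k))"
      using emb unfolding emb_def by blast
    interpret f: group_hom "pruefer_power p k" U f
      using f(1) pruefer_power_group[OF p] by (intro group_hom.intro group_hom_axioms.intro) auto
    \<comment> \<open>The coordinate vectors built from a primitive \<open>p\<close>-th root of
      unity are \<open>k\<close> distinct elements killed by \<open>p\<close>; their images bound
      \<open>k\<close> by the finite \<open>p\<close>-torsion of \<open>U\<close>.\<close>
    define e where "e i = (\<lambda>j\<in>{..<k}. if j = i then ?z else 1)" for i :: nat
    have e: "e i \<in> carrier (pruefer_power p k)" for i
      using z(3) by (auto simp: e_def carrier_pruefer)
    have "inj_on (f \<circ> e) {..<k}"
    proof (rule inj_onI)
      fix i j assume ij: "i \<in> {..<k}" "j \<in> {..<k}" "(f \<circ> e) i = (f \<circ> e) j"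
      then have "e i i = e j i"
        using f(2) e by (metis comp_apply inj_onD)
      moreover have "e i i = ?z" "i \<noteq> j \<Longrightarrow> e j i = 1"
        using ij(1) by (simp_all add: e_def)
      ultimately show "i = j"
        using z(2) by metis
    qed
    moreover have "(f \<circ> e) ` {..<k} \<subseteq> {x \<in> carrier U. x [^] p = \<one>}"
    proof -
      have "f (e i) [^] p = \<one>" for i
      proof -
        have "e i [^]\<^bsub>pruefer_power p k\<^esub> p = \<one>\<^bsub>pruefer_power p k\<^esub>"
          unfolding pow_pruefer_power[OF e] using z(1) by (auto simp: e_def restrict_def)
        then show ?thesis
          using f.hom_nat_pow[OF e, of i p] f.hom_one by metis
      qed
      then show ?thesis
        using f.hom_closed[OF e] by auto
    qed
    ultimately show ?thesis
      using card_inj_on_le[OF _ _ fin] by fastforce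
  qed
  obtain k where k: "emb k" "\<And>l. emb l \<Longrightarrow> l \<le> k"
    using Nat.ex_has_greatest_nat[of emb 0] emb0 bound by (metis le_imp_less_Suc)
  obtain f where f: "f \<in> hom (pruefer_power p k) U" "inj_on f (carrier (pruefer_power p k))"
    using k(1) unfolding emb_def by blast
  let ?P = "pruefer_power p k"
  interpret f: group_hom ?P U f
    using f(1) pruefer_power_group[OF p] by (intro group_hom.intro group_hom_axioms.intro) auto
  let ?I = "f ` carrier ?P"
  have I: "subgroup ?I U"
    by (rule f.img_is_subgroup)
  have tor_I: "a \<in> ?I" if a: "a \<in> carrier U" "a [^] p = \<one>" for a
  proof (rule ccontr)
    assume aI: "a \<notin> ?I"
    have "\<exists>c. \<forall>n. (c n \<in> carrier U \<and> (n = 0 \<longrightarrow> c n = a)) \<and> c (Suc n) [^] p = c n"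
      by (rule dependent_nat_choice) (use a root in auto)
    then obtain c where c: "\<And>n. c n \<in> carrier U" "c 0 = a" "\<And>n. c (Suc n) [^] p = c n"
      by blast
    \<comment> \<open>The chain is shifted by one: \<open>b 1 = a\<close> has order \<open>p\<close>
      and so corresponds to the root of unity at level 1.\<close>
    define b where "b n = (case n of 0 \<Rightarrow> \<one> | Suc m \<Rightarrow> c m)" for n
    have b: "b n \<in> carrier U" "b (Suc n) [^] p = b n" "b 0 = \<one>" for n
      using c a by (auto simp: b_def split: nat.split)
    obtain g where g: "g \<in> hom (pruefer p) U" "\<And>n j. g (root_of_unity p n ^ j) = b n [^] j"
      using pruefer_hom_of_root_chain[OF p b] by blast
    let ?Q = "pruefer_power p (Suc k)"
    define h where "h x = f (restrict x {..<k}) \<otimes> g (x k)" for x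
    have res: "restrict x {..<k} \<in> carrier ?P" "x k \<in> carrier (pruefer p)" if "x \<in> carrier ?Q" for x
      using that by (auto simp: PiE_iff)
    have g_closed: "g z \<in> carrier U" if "z \<in> carrier (pruefer p)" for z
      using g(1) that by (auto simp: hom_def)
    have h_hom: "h \<in> hom ?Q U"
    proof (rule homI)
      show "h x \<in> carrier U" if "x \<in> carrier ?Q" for x
        using res[OF that] g_closed unfolding h_def by auto
      fix x y assume xy: "x \<in> carrier ?Q" "y \<in> carrier ?Q"
      have "restrict (x \<otimes>\<^bsub>?Q\<^esub> y) {..<k} = restrict x {..<k} \<otimes>\<^bsub>?P\<^esub> restrict y {..<k}"
        by (auto simp: restrict_def)
      then have "f (restrict (x \<otimes>\<^bsub>?Q\<^esub> y) {..<k}) = f (restrict x {..<k}) \<otimes> f (restrict y {..<k})"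
        using f.hom_mult[OF res(1)[OF xy(1)] res(1)[OF xy(2)]] by metis
      moreover have "g ((x \<otimes>\<^bsub>?Q\<^esub> y) k) = g (x k) \<otimes> g (y k)"
        using hom_mult[OF g(1) res(2)[OF xy(1)] res(2)[OF xy(2)]] by simp
      ultimately show "h (x \<otimes>\<^bsub>?Q\<^esub> y) = h x \<otimes> h y"
        unfolding h_def using f.hom_closed[OF res(1)] g_closed[OF res(2)] xy by (simp add: m_ac)
    qed
    interpret h: group_hom ?Q U h
      using h_hom pruefer_power_group[OF p] by (intro group_hom.intro group_hom_axioms.intro) auto
    text \<open>A nontrivial kernel would contain an element of order \<open>p\<close>.\<close>
    have ker_p: "x = \<one>\<^bsub>?Q\<^esub>" if x: "x \<in> carrier ?Q" "h x = \<one>" "x [^]\<^bsub>?Q\<^esub> p = \<one>\<^bsub>?Q\<^esub>" for x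
    proof -
      have "(\<lambda>i\<in>{..<Suc k}. x i ^ p) k = (\<lambda>i\<in>{..<Suc k}. 1) k"
        using x(3) unfolding pow_pruefer_power[OF x(1)] by simp
      then have "x k ^ (p ^ 1) = 1"
        by simp
      then obtain j where j: "j < p" "x k = ?z ^ j"
        using root_of_unity_bij[OF p, of 1] unfolding bij_betw_def by auto
      have "g (x k) = inv (f (restrict x {..<k}))"
        using x(2) res[OF x(1)] g_closed f.hom_closed unfolding h_def
        by (metis inv_equality m_comm)
      then have "g (x k) \<in> ?I"
        using subgroup.m_inv_closed[OF I] res(1)[OF x(1)] by simp
      moreover have "g (x k) = a [^] j"
        unfolding j(2) g(2) by (simp add: b_def c)
      ultimately have "a [^] j \<in> ?I"
        by simp
      \<comment> \<open>An exponent \<open>j\<close> prime to \<open>p\<close> would put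
        \<open>a\<close> itself into the image.\<close>
      moreover have "coprime j p" if "j \<noteq> 0"
        using assms(1) j(1) that by (metis coprime_commute nat_dvd_not_less neq0_conv prime_imp_coprime)
      ultimately have "j = 0"
        using coprime_pow_in_subgroup[OF I a(1), of p 1 j] a(2) aI by auto
      then have xk: "x k = 1"
        using j(2) by simp
      then have "g (x k) = \<one>"
        using g(2)[of 0 0] by simp
      then have "f (restrict x {..<k}) = \<one>"
        using x(2) f.hom_closed[OF res(1)[OF x(1)]] unfolding h_def by simp
      then have "restrict x {..<k} = \<one>\<^bsub>?P\<^esub>"
        using f(2) res(1)[OF x(1)] f.hom_one f.G.one_closed by (metis inj_onD)
      then have "x i = 1" if "i < Suc k" for i
        using xk that by (metis less_Suc_eq lessThan_iff one_product_group one_pruefer restrict_apply')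
      then show ?thesis
        using x(1) by (auto simp: PiE_iff extensional_def restrict_def fun_eq_iff)
    qed
    \<comment> \<open>If \<open>x\<close> is killed by \<open>p ^ Suc n\<close>, its
      \<open>p\<close>-th power is a kernel element killed by \<open>p ^ n\<close>, hence trivial by
      induction; this leaves the case of order dividing \<open>p\<close>.\<close>
    have ker: "x = \<one>\<^bsub>?Q\<^esub>" if x: "x \<in> carrier ?Q" "h x = \<one>" for x
    proof -
      have "x = \<one>\<^bsub>?Q\<^esub>" if "x \<in> carrier ?Q" "h x = \<one>" "x [^]\<^bsub>?Q\<^esub> (p ^ n) = \<one>\<^bsub>?Q\<^esub>" for n
        using that
      proof (induction n arbitrary: x)
        case 0
        then show ?case
          using h.G.nat_pow_0 h.G.nat_pow_Suc[of x 0] h.G.l_one[of x] by (metis One_nat_def power_0)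
      next
        case (Suc n)
        have "x [^]\<^bsub>?Q\<^esub> p = \<one>\<^bsub>?Q\<^esub>"
        proof (rule Suc.IH)
          show "x [^]\<^bsub>?Q\<^esub> p \<in> carrier ?Q"
            using Suc.prems(1) h.G.nat_pow_closed by blast
          show "h (x [^]\<^bsub>?Q\<^esub> p) = \<one>"
            using h.hom_nat_pow[OF Suc.prems(1)] Suc.prems(2) by simp
          show "(x [^]\<^bsub>?Q\<^esub> p) [^]\<^bsub>?Q\<^esub> p ^ n = \<one>\<^bsub>?Q\<^esub>"
            using h.G.nat_pow_pow[OF Suc.prems(1)] Suc.prems(3) by (metis power_Suc)
        qed
        then show ?case
          using ker_p Suc.prems by blast
      qed
      moreover obtain n where "x [^]\<^bsub>?Q\<^esub> (p ^ n) = \<one>\<^bsub>?Q\<^esub>"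
        using divisible_p_group_pruefer_power[OF assms(1), of "Suc k"] x(1)
        unfolding divisible_p_group_def by blast
      ultimately show ?thesis
        using x by blast
    qed
    then have "inj_on h (carrier ?Q)"
      by (intro h.inj_on_one_iff[THEN iffD2]) auto
    then have "emb (Suc k)"
      unfolding emb_def using h_hom by blast
    then show False
      using k(2) by fastforce
  qed
  have all_I: "x \<in> ?I" if "x \<in> carrier U" "x [^] (p ^ n) = \<one>" for x n
    using that
  proof (induction n arbitrary: x)
    case 0
    then show ?case
      using subgroup.one_closed[OF I] by simp
  next
    case (Suc n)
    have "x [^] p \<in> ?I"
      using Suc.IH[of "x [^] p"] Suc.prems by (simp add: nat_pow_pow)
    then obtain y where y: "y \<in> carrier ?P" "x [^] p = f y"
      by blast
    \<comment> \<open>Dividing \<open>x\<close> by the image of this root leaves an element killed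
      by \<open>p\<close>, already known to lie in the image.\<close>
    obtain z where z: "z \<in> carrier ?P" "z [^]\<^bsub>?P\<^esub> p = y"
      using divisible_p_group_pruefer_power[OF assms(1), of k] y(1)
      unfolding divisible_p_group_def by blast
    have fz: "f z \<in> carrier U" "f z [^] p = x [^] p"
      using z y f.hom_closed f.hom_nat_pow by metis+
    have "(x \<otimes> inv (f z)) [^] p = x [^] p \<otimes> inv (f z [^] p)"
      using Suc.prems(1) fz(1) by (simp add: nat_pow_distrib nat_pow_inv)
    also have "\<dots> = \<one>"
      using Suc.prems(1) fz by simp
    finally have "x \<otimes> inv (f z) \<in> ?I"
      using tor_I Suc.prems(1) fz(1) by simp
    moreover have "x = x \<otimes> inv (f z) \<otimes> f z"
      using Suc.prems(1) fz(1) by (simp add: m_assoc)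
    ultimately show ?case
      using subgroup.m_closed[OF I] z(1) by (metis imageI)
  qed
  have "?I = carrier U"
    using all_I tor f.hom_closed by blast
  then have "f \<in> iso ?P U"
    using f by (simp add: iso_def bij_betw_def)
  then have "?P \<cong> U"
    unfolding is_iso_def by blast
  then have "U \<cong> ?P"
    by (rule group.iso_sym[OF pruefer_power_group[OF p]])
  then show ?thesis
    unfolding discrete_p_torus_def torus_of_rank_def using group_axioms by blast
qed

section \<open>Discrete \<open>p\<close>-toral groups\<close>

text \<open>The group of this locale plays the role of the discrete \<open>p\<close>-toral group
  \<open>S\<close>, not of the ambient group. The conditions on elements of \<open>T\<close> unpack
  \<open>divisible_p_group\<close>; \<open>power_in_T\<close> and \<open>finite_rcosets_T\<close>
  come from the finite \<open>p\<close>-power index, and \<open>finite_generate\<close> from local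
  finiteness of the ambient group.\<close>

locale toral_group = group G for G :: "('a, 'b) monoid_scheme" (structure) + fixes p :: nat and T :: "'a set"
  assumes prime_p: "prime p"
    and T_normal: "T \<lhd> G"
    and T_comm: "\<lbrakk>x \<in> T; y \<in> T\<rbrakk> \<Longrightarrow> x \<otimes> y = y \<otimes> x"
    and T_torsion: "x \<in> T \<Longrightarrow> \<exists>n::nat. x [^] (p ^ n) = \<one>"
    and T_root: "x \<in> T \<Longrightarrow> \<exists>y\<in>T. y [^] p = x"
    and T_finite: "finite {x \<in> T. x [^] (p ^ n :: nat) = \<one>}"
    and power_in_T: "\<exists>n::nat. \<forall>x\<in>carrier G. x [^] (p ^ n) \<in> T"
    and finite_rcosets_T: "finite (rcosets T)"
    and finite_generate: "\<lbrakk>finite A; A \<subseteq> carrier G\<rbrakk> \<Longrightarrow> finite (generate G A)"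
begin

lemma T_subgroup: "subgroup T G"
  using T_normal normal_imp_subgroup by blast

lemma T_carrier: "x \<in> T \<Longrightarrow> x \<in> carrier G"
  using subgroup.mem_carrier[OF T_subgroup] .

lemma T_conj: "g \<in> carrier G \<Longrightarrow> x \<in> T \<Longrightarrow> conj_by G g x \<in> T"
  unfolding conj_by_def using normal.inv_op_closed2[OF T_normal] .

lemma T_pow_mult: "\<lbrakk>x \<in> T; y \<in> T\<rbrakk> \<Longrightarrow> (x \<otimes> y) [^] (n::nat) = x [^] n \<otimes> y [^] n"
  by (intro pow_mult_distrib T_comm T_carrier)

lemma pow_closed_subgroup: "\<lbrakk>subgroup H G; x \<in> H\<rbrakk> \<Longrightarrow> x [^] (n::nat) \<in> H"
  by (induction n) (simp_all add: subgroup.one_closed subgroup.m_closed)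

lemma torsion: "x \<in> carrier G \<Longrightarrow> \<exists>n::nat. x [^] (p ^ n) = \<one>"
proof -
  assume x: "x \<in> carrier G"
  obtain m where "x [^] (p ^ m) \<in> T"
    using power_in_T x by blast
  then obtain n where "(x [^] (p ^ m)) [^] (p ^ n) = \<one>"
    using T_torsion by blast
  then have "x [^] (p ^ (m + n)) = \<one>"
    using x by (simp add: nat_pow_pow power_add)
  then show ?thesis ..
qed

definition divisible :: "'a set \<Rightarrow> bool" where
  "divisible D \<longleftrightarrow> (\<forall>x\<in>D. \<exists>y\<in>D. y [^] p = x)"

lemma divisible_T: "divisible T"
  using T_root unfolding divisible_def by blast

lemma divisible_root:
  assumes "divisible D" "D \<subseteq> carrier G" "x \<in> D"
  shows "\<exists>y\<in>D. y [^] (p ^ n) = x"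
proof (induction n)
  case 0
  then show ?case
    using assms by (metis nat_pow_eone power_0 subsetD)
next
  case (Suc n)
  then obtain y where y: "y \<in> D" "y [^] (p ^ n) = x"
    by blast
  then obtain z where z: "z \<in> D" "z [^] p = y"
    using assms(1) unfolding divisible_def by blast
  then have "z [^] (p ^ Suc n) = x"
    using y assms(2) by (metis nat_pow_pow power_Suc subsetD)
  then show ?case
    using z by blast
qed

text \<open>Every element of \<open>D\<close> is a \<open>p^n\<close>-th power, and for suitable
  \<open>n\<close> all \<open>p^n\<close>-th powers lie in \<open>T\<close>.\<close>

lemma divisible_subset_T:
  assumes "divisible D" "D \<subseteq> carrier G"
  shows "D \<subseteq> T"
proof
  fix x assume x: "x \<in> D"
  obtain n where n: "\<forall>x\<in>carrier G. x [^] (p ^ n) \<in> T"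
    using power_in_T by blast
  obtain y where y: "y \<in> D" "y [^] (p ^ n) = x"
    using divisible_root[OF assms x] by blast
  then show "x \<in> T"
    using n assms(2) by blast
qed

text \<open>A divisible \<open>p\<close>-group has no proper subgroup of finite index. In a chain
  \<open>e\<close> of roots of \<open>x\<close>, two cosets of \<open>H\<close> coincide, say at
  \<open>i\<close> and \<open>k = i + d\<close>. As \<open>e i\<close> is the \<open>p^d\<close>-th
  power of \<open>e k\<close>, their quotient is \<open>e k\<close> to the power
  \<open>p^d - 1\<close>. This exponent is prime to \<open>p\<close>, so \<open>e k\<close> lies in
  \<open>H\<close>, and so does its power \<open>x\<close>.\<close>

lemma divisible_finite_index:
  assumes "divisible D" "D \<subseteq> carrier G" "subgroup H G" "finite ((\<lambda>d. H #> d) ` D)"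
  shows "D \<subseteq> H"
proof
  fix x assume x: "x \<in> D"
  have "\<exists>e. \<forall>n. (e n \<in> D \<and> (n = 0 \<longrightarrow> e n = x)) \<and> e (Suc n) [^] p = e n"
    by (rule dependent_nat_choice) (use assms(1) x in \<open>auto simp: divisible_def\<close>)
  then obtain e where e: "\<And>n. e n \<in> D" "e 0 = x" "\<And>n. e (Suc n) [^] p = e n"
    by blast
  have eG: "e n \<in> carrier G" for n
    using e(1) assms(2) by blast
  have "\<not> inj (\<lambda>n. H #> e n)"
    using assms(4) e(1) finite_subset[of "range (\<lambda>n. H #> e n)" "(\<lambda>d. H #> d) ` D"]
      range_inj_infinite by blast
  then obtain i k where ik: "i < k" "H #> e i = H #> e k"
    by (metis injI linorder_neqE_nat)
  obtain d where d: "k = i + d" "d > 0"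
    using ik(1) less_imp_add_positive by metis
  have up: "e (i + d) [^] (p ^ d) = e i" "e (0 + (i + d)) [^] (p ^ (i + d)) = e 0"
    using root_chain_power[of e p, OF eG e(3)] by blast+
  have "e i \<otimes> inv (e k) \<in> H"
    using ik(2) repr_independenceD[OF assms(3) eG, of "e i" k]
      subgroup.rcos_module_imp[OF assms(3) group_axioms eG, of "e i" k] rcos_self[OF eG assms(3)]
    by metis
  moreover have "e i \<otimes> inv (e k) = e k [^] (p ^ d - 1)"
  proof -
    have "p ^ d = Suc (p ^ d - 1)"
      using prime_p by (simp add: prime_gt_0_nat)
    then have "e k [^] (p ^ d) = e k [^] (p ^ d - 1) \<otimes> e k"
      by (metis nat_pow_Suc)
    then show ?thesis
      using up(1) d(1) eG by (simp add: m_assoc)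
  qed
  ultimately have "e k [^] (p ^ d - 1) \<in> H"
    by simp
  moreover have "coprime (p ^ d - 1) p"
  proof -
    have "coprime (p ^ d - 1) (p ^ d)"
      using prime_p by (metis coprime_diff_one_left_nat prime_gt_0_nat zero_less_power)
    then show ?thesis
      using d(2) by simp
  qed
  moreover obtain n :: nat where "e k [^] (p ^ n) = \<one>"
    using torsion eG by blast
  ultimately have "e k \<in> H"
    using coprime_pow_in_subgroup[OF assms(3) eG] by blast
  then have "e k [^] (p ^ k) \<in> H"
    by (rule pow_closed_subgroup[OF assms(3)])
  then show "x \<in> H"
    using up(2) d(1) e(2) by simp
qed

text \<open>For a subgroup \<open>A\<close> of \<open>T\<close> this is its largest divisible subgroup.\<close>

definition divpart :: "'a set \<Rightarrow> 'a set" where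
  "divpart A = {x. \<exists>e. e 0 = x \<and> (\<forall>n. e n \<in> A \<and> e (Suc n) [^] p = e n)}"

lemma divpart_subset: "divpart A \<subseteq> A"
  unfolding divpart_def by blast

lemma divpart_divisible: "divisible (divpart A)"
  unfolding divisible_def
proof
  fix x assume "x \<in> divpart A"
  then obtain e where e: "e 0 = x" "\<And>n. e n \<in> A" "\<And>n. e (Suc n) [^] p = e n"
    unfolding divpart_def by blast
  have "e (Suc 0) \<in> divpart A"
    unfolding divpart_def mem_Collect_eq by (rule exI[of _ "\<lambda>n. e (Suc n)"]) (use e in auto)
  then show "\<exists>y\<in>divpart A. y [^] p = x"
    using e by blast
qed

lemma divpart_greatest:
  assumes "divisible D" "D \<subseteq> A"
  shows "D \<subseteq> divpart A"
proof
  fix x assume x: "x \<in> D"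
  have "\<exists>e. \<forall>n. (e n \<in> D \<and> (n = 0 \<longrightarrow> e n = x)) \<and> e (Suc n) [^] p = e n"
    by (rule dependent_nat_choice) (use assms(1) x in \<open>auto simp: divisible_def\<close>)
  then obtain e where "\<And>n. e n \<in> D" "e 0 = x" "\<And>n. e (Suc n) [^] p = e n"
    by blast
  then show "x \<in> divpart A"
    unfolding divpart_def mem_Collect_eq using assms(2) by (intro exI[of _ e]) auto
qed

lemma divpart_subgroup:
  assumes "subgroup A G" "A \<subseteq> T"
  shows "subgroup (divpart A) G"
proof (rule subgroupI)
  show "divpart A \<subseteq> carrier G"
    using divpart_subset subgroup.subset[OF assms(1)] by blast
  have "\<one> \<in> divpart A"
    unfolding divpart_def mem_Collect_eq using subgroup.one_closed[OF assms(1)]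
    by (intro exI[of _ "\<lambda>_. \<one>"]) auto
  then show "divpart A \<noteq> {}"
    by blast
next
  fix x assume "x \<in> divpart A"
  then obtain e where e: "e 0 = x" "\<And>n. e n \<in> A" "\<And>n. e (Suc n) [^] p = e n"
    unfolding divpart_def by blast
  have "e n \<in> carrier G" for n
    using e(2) subgroup.mem_carrier[OF assms(1)] by blast
  then show "inv x \<in> divpart A"
    unfolding divpart_def mem_Collect_eq using e subgroup.m_inv_closed[OF assms(1)]
    by (intro exI[of _ "\<lambda>n. inv (e n)"]) (auto simp: nat_pow_inv)
next
  fix x y assume "x \<in> divpart A" "y \<in> divpart A"
  then obtain e f where e: "e 0 = x" "\<And>n. e n \<in> A" "\<And>n. e (Suc n) [^] p = e n"
    and f: "f 0 = y" "\<And>n. f n \<in> A" "\<And>n. f (Suc n) [^] p = f n"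
    unfolding divpart_def by blast
  have "(e (Suc n) \<otimes> f (Suc n)) [^] p = e n \<otimes> f n" for n
    using T_pow_mult e(2,3) f(2,3) assms(2) by (metis subsetD)
  then show "x \<otimes> y \<in> divpart A"
    unfolding divpart_def mem_Collect_eq using e f subgroup.m_closed[OF assms(1)]
    by (intro exI[of _ "\<lambda>n. e n \<otimes> f n"]) auto
qed

lemma pow_image_subgroup:
  assumes "subgroup A G" "A \<subseteq> T"
  shows "subgroup ((\<lambda>x. x [^] (n::nat)) ` A) G"
proof (rule subgroupI)
  show "(\<lambda>x. x [^] n) ` A \<subseteq> carrier G" "(\<lambda>x. x [^] n) ` A \<noteq> {}"
    using subgroup.mem_carrier[OF assms(1)] subgroup.one_closed[OF assms(1)] by auto
next
  fix y assume "y \<in> (\<lambda>x. x [^] n) ` A"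
  then obtain x where x: "x \<in> A" "y = x [^] n" by blast
  then have "inv y = (inv x) [^] n"
    using subgroup.mem_carrier[OF assms(1)] by (simp add: nat_pow_inv)
  then show "inv y \<in> (\<lambda>x. x [^] n) ` A"
    using x(1) subgroup.m_inv_closed[OF assms(1)] by blast
next
  fix y z assume "y \<in> (\<lambda>x. x [^] n) ` A" "z \<in> (\<lambda>x. x [^] n) ` A"
  then obtain u v where "u \<in> A" "y = u [^] n" "v \<in> A" "z = v [^] n" by blast
  moreover from this have "y \<otimes> z = (u \<otimes> v) [^] n"
    using T_pow_mult assms(2) by (metis subsetD)
  ultimately show "y \<otimes> z \<in> (\<lambda>x. x [^] n) ` A"
    using subgroup.m_closed[OF assms(1)] by blast
qed

text \<open>The \<open>p\<close>-torsion of the decreasing sequence \<open>A\<^sup>p\<^sup>n\<close> stabilises because it is finite, and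
  from that point on the sequence itself is constant.\<close>

lemma power_divisible:
  assumes A: "subgroup A G" "A \<subseteq> T"
  shows "\<exists>n. divisible ((\<lambda>x. x [^] (p ^ n)) ` A)"
proof -
  define P where "P n = (\<lambda>x. x [^] (p ^ n)) ` A" for n :: nat
  define Om where "Om n = {x \<in> P n. x [^] p = \<one>}" for n
  have AG: "x \<in> carrier G" if "x \<in> A" for x
    using subgroup.mem_carrier[OF A(1) that] .
  have Psub: "subgroup (P n) G" for n
    unfolding P_def by (rule pow_image_subgroup[OF A])
  have PA: "P n \<subseteq> A" for n
    unfolding P_def using pow_closed_subgroup[OF A(1)] by blast
  have P_add: "P (n + d) = (\<lambda>x. x [^] (p ^ d)) ` P n" for n d
  proof -
    have "x [^] (p ^ (n + d)) = (x [^] (p ^ n)) [^] (p ^ d)" if "x \<in> A" for x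
      using AG[OF that] by (simp add: nat_pow_pow power_add)
    then show ?thesis
      unfolding P_def image_image by (intro image_cong) auto
  qed
  have P_Suc: "P (Suc n) \<subseteq> P n" for n
    using P_add[of n 1] pow_closed_subgroup[OF Psub] by auto
  have P_mono: "P n \<subseteq> P m" if "m \<le> n" for m n
    using lift_Suc_antimono_le[of P, OF P_Suc that] .
  have finOm: "finite (Om n)" for n
  proof (rule finite_subset)
    show "Om n \<subseteq> {x \<in> T. x [^] (p ^ 1) = \<one>}"
      unfolding Om_def using PA[of n] A(2) by auto
    show "finite {x \<in> T. x [^] (p ^ 1) = \<one>}"
      using T_finite[of 1] by simp
  qed
  have "\<exists>n0. \<forall>n\<ge>n0. Om n = Om n0"
  proof -
    obtain n0 where n0: "\<And>n. card (Om n0) \<le> card (Om n)"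
      using ex_has_least_nat[of "\<lambda>_. True" 0 "\<lambda>n. card (Om n)"] by auto
    have "Om n = Om n0" if "n \<ge> n0" for n
      using card_seteq[OF finOm[of n0], of "Om n"] P_mono[OF that] n0[of n] unfolding Om_def by blast
    then show ?thesis by blast
  qed
  then obtain n0 where n0: "\<And>n. n \<ge> n0 \<Longrightarrow> Om n = Om n0"
    by blast
  \<comment> \<open>Induction on the order of \<open>x\<close>. The power
    \<open>x [^] (p ^ k)\<close> is killed by \<open>p\<close>, so by stabilisation it equals
    \<open>y [^] (p ^ Suc k)\<close> for some \<open>y\<close> in \<open>P n0\<close>; dividing
    \<open>x\<close> by \<open>y [^] p\<close> lowers its order.\<close>
  have up: "x \<in> P (Suc n0)" if "x \<in> P n0" "x [^] (p ^ k) = \<one>" for x k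
    using that
  proof (induction k arbitrary: x)
    case 0
    then show ?case
      using subgroup.one_closed[OF Psub] subgroup.mem_carrier[OF Psub, of x] by auto
  next
    case (Suc k)
    have xG: "x \<in> carrier G"
      using Suc.prems(1) subgroup.mem_carrier[OF Psub] by blast
    have "(x [^] (p ^ k)) [^] p = \<one>"
      using Suc.prems(2) xG by (simp add: nat_pow_pow mult.commute)
    then have "x [^] (p ^ k) \<in> Om n0"
      using pow_closed_subgroup[OF Psub Suc.prems(1)] unfolding Om_def by blast
    then have "x [^] (p ^ k) \<in> P (n0 + Suc k)"
      using n0[of "n0 + Suc k"] unfolding Om_def by auto
    then obtain y where y: "y \<in> P n0" "x [^] (p ^ k) = y [^] (p ^ Suc k)"
      unfolding P_add by blast
    have yG: "y \<in> carrier G"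
      using y(1) subgroup.mem_carrier[OF Psub] by blast
    have yp: "y [^] p \<in> P (Suc n0)"
      using y(1) P_add[of n0 1] by auto
    have xy: "x \<otimes> inv (y [^] p) \<in> P n0"
      using Suc.prems(1) yp P_Suc subgroup.m_inv_closed[OF Psub] subgroup.m_closed[OF Psub] by blast
    have "(x \<otimes> inv (y [^] p)) [^] (p ^ k) = x [^] (p ^ k) \<otimes> inv (y [^] p) [^] (p ^ k)"
    proof (rule T_pow_mult)
      show "x \<in> T" "inv (y [^] p) \<in> T"
        using Suc.prems(1) yp PA A(2) subgroup.m_inv_closed[OF T_subgroup] by blast+
    qed
    also have "inv (y [^] p) [^] (p ^ k) = inv (y [^] (p ^ Suc k))"
      using yG by (simp add: nat_pow_inv nat_pow_pow)
    also have "x [^] (p ^ k) \<otimes> inv (y [^] (p ^ Suc k)) = \<one>"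
      using y(2) yG by simp
    finally have "x \<otimes> inv (y [^] p) \<in> P (Suc n0)"
      using Suc.IH[OF xy] by blast
    then have "x \<otimes> inv (y [^] p) \<otimes> y [^] p \<in> P (Suc n0)"
      using subgroup.m_closed[OF Psub] yp by blast
    then show ?case
      using xG yG by (simp add: m_assoc)
  qed
  have "divisible (P n0)"
    unfolding divisible_def
  proof
    fix x assume x: "x \<in> P n0"
    then obtain k where "x [^] (p ^ k) = \<one>"
      using torsion subgroup.mem_carrier[OF Psub] by blast
    then have "x \<in> P (n0 + 1)"
      using up[OF x] by simp
    then show "\<exists>y\<in>P n0. y [^] p = x"
      unfolding P_add[of n0 1] by auto
  qed
  then show ?thesis
    unfolding P_def by blast
qed

text \<open>For large \<open>n\<close> the \<open>p^n\<close>-th powers of \<open>A\<close> lie in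
  \<open>divpart A\<close>. Dividing \<open>a\<close> by a root in \<open>divpart A\<close> of its
  \<open>p^n\<close>-th power leaves an element killed by \<open>p^n\<close>, and there are only
  finitely many of these.\<close>

lemma divpart_cofinite:
  assumes A: "subgroup A G" "A \<subseteq> T"
  shows "\<exists>E. finite E \<and> E \<subseteq> A \<and> (\<forall>a\<in>A. \<exists>u\<in>divpart A. \<exists>e\<in>E. a = u \<otimes> e)"
proof -
  obtain n where div: "divisible ((\<lambda>x. x [^] (p ^ n)) ` A)"
    using power_divisible[OF A] by blast
  let ?E = "{x \<in> A. x [^] (p ^ n) = \<one>}"
  have AG: "x \<in> carrier G" if "x \<in> A" for x
    using subgroup.mem_carrier[OF A(1) that] .
  have P: "(\<lambda>x. x [^] (p ^ n)) ` A \<subseteq> divpart A"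
    by (rule divpart_greatest[OF div]) (use pow_closed_subgroup[OF A(1)] in blast)
  have "\<exists>u\<in>divpart A. \<exists>e\<in>?E. a = u \<otimes> e" if a: "a \<in> A" for a
  proof -
    have "a [^] (p ^ n) \<in> divpart A"
      using P a by blast
    then obtain u where u: "u \<in> divpart A" "u [^] (p ^ n) = a [^] (p ^ n)"
      using divisible_root[OF divpart_divisible] divpart_subset AG by (metis subsetD subsetI)
    have uA: "u \<in> A" "inv u \<in> A"
      using u(1) divpart_subset subgroup.m_inv_closed[OF A(1)] by blast+
    have "(inv u \<otimes> a) [^] (p ^ n) = inv u [^] (p ^ n) \<otimes> a [^] (p ^ n)"
      using uA(2) a A(2) by (intro T_pow_mult) auto
    also have "\<dots> = \<one>"
      using AG[OF uA(1)] AG[OF a] u(2) by (simp add: nat_pow_inv)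
    finally have "inv u \<otimes> a \<in> ?E"
      using uA(2) a subgroup.m_closed[OF A(1)] by blast
    moreover have "a = u \<otimes> (inv u \<otimes> a)"
      using AG[OF uA(1)] AG[OF a] by (simp flip: m_assoc)
    ultimately show ?thesis
      using u(1) by blast
  qed
  moreover have "finite ?E"
    using T_finite[of n] by (rule rev_finite_subset) (use A(2) in auto)
  ultimately show ?thesis
    by (intro exI[of _ ?E]) blast
qed

section \<open>Tori, identity components and orders of subgroups\<close>

text \<open>A divisible subgroup lies in \<open>T\<close> and inherits from it commutativity,
  torsion and the finiteness condition.\<close>

lemma torus_iff_divisible:
  assumes "subgroup D G"
  shows "discrete_p_torus p (G\<lparr>carrier := D\<rparr>) \<longleftrightarrow> divisible D"
proof
  assume "discrete_p_torus p (G\<lparr>carrier := D\<rparr>)"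
  then have "divisible_p_group p (G\<lparr>carrier := D\<rparr>)"
    by (rule divisible_p_group_of_torus[OF prime_p])
  then show "divisible D"
    unfolding divisible_p_group_def divisible_def by (simp flip: nat_pow_consistent)
next
  assume div: "divisible D"
  then have DT: "D \<subseteq> T"
    using divisible_subset_T subgroup.subset[OF assms] by blast
  have "comm_group (G\<lparr>carrier := D\<rparr>)"
    by (rule group.group_comm_groupI[OF subgroup_imp_group[OF assms]]) (use DT T_comm in auto)
  moreover have "finite {x \<in> D. x [^] (p ^ n :: nat) = \<one>}" for n
    using T_finite[of n] by (rule rev_finite_subset) (use DT in auto)
  moreover have "\<exists>n::nat. x [^] (p ^ n) = \<one>" if "x \<in> D" for x
    using T_torsion DT that by blast
  ultimately have "divisible_p_group p (G\<lparr>carrier := D\<rparr>)"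
    using div unfolding divisible_p_group_def divisible_def by (simp flip: nat_pow_consistent)
  then show "discrete_p_torus p (G\<lparr>carrier := D\<rparr>)"
    by (rule torus_of_divisible_p_group[OF prime_p])
qed

text \<open>The representatives are chosen inside \<open>C\<close>, one for each coset of
  \<open>T\<close> that \<open>C\<close> meets, so their number is bounded uniformly in
  \<open>C\<close>.\<close>

lemma coset_representatives:
  assumes "subgroup C G"
  shows "\<exists>R. finite R \<and> R \<subseteq> C \<and> card R \<le> card (rcosets T) \<and>
    (\<forall>c\<in>C. \<exists>d\<in>C \<inter> T. \<exists>r\<in>R. c = d \<otimes> r)"
proof -
  define r where "r X = (SOME c. c \<in> C \<and> T #> c = X)" for X
  let ?K = "(\<lambda>c. T #> c) ` C"
  have CG: "c \<in> carrier G" if "c \<in> C" for c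
    using subgroup.mem_carrier[OF assms that] .
  have sub: "?K \<subseteq> rcosets T"
    using CG unfolding RCOSETS_def by blast
  have r: "r (T #> c) \<in> C" "T #> r (T #> c) = T #> c" if "c \<in> C" for c
    using someI[of "\<lambda>x. x \<in> C \<and> T #> x = T #> c" c] that unfolding r_def by auto
  have "\<exists>d\<in>C \<inter> T. \<exists>x\<in>r ` ?K. c = d \<otimes> x" if c: "c \<in> C" for c
  proof -
    let ?x = "r (T #> c)"
    have xG: "?x \<in> carrier G"
      using CG[OF r(1)[OF c]] .
    have "c \<in> T #> ?x"
      using r(2)[OF c] rcos_self[OF CG[OF c] T_subgroup] by simp
    then have "c \<otimes> inv ?x \<in> T"
      by (rule subgroup.rcos_module_imp[OF T_subgroup group_axioms xG])
    moreover have "c \<otimes> inv ?x \<in> C"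
      using c r(1)[OF c] subgroup.m_closed[OF assms] subgroup.m_inv_closed[OF assms] by blast
    moreover have "c = c \<otimes> inv ?x \<otimes> ?x"
      using CG[OF c] xG by (simp add: m_assoc)
    ultimately show ?thesis
      using c by blast
  qed
  moreover have fin: "finite ?K"
    by (rule finite_subset[OF sub finite_rcosets_T])
  moreover have "card (r ` ?K) \<le> card (rcosets T)"
    using card_image_le[OF fin, of r] card_mono[OF finite_rcosets_T sub] by (rule order_trans)
  ultimately show ?thesis
    using r(1) by (intro exI[of _ "r ` ?K"]) blast
qed

text \<open>Any competing torus is divisible and so lies in \<open>divpart (C \<inter> T)\<close>;
  conversely, a divisible group lies in every subgroup of finite index in \<open>C\<close>. The
  index bound is stated for an arbitrary \<open>E\<close>, so that \<open>E\<close> can later be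
  chosen from \<open>C \<inter> T\<close> alone.\<close>

lemma identity_component_eq:
  assumes C: "subgroup C G"
  shows "identity_component p (G\<lparr>carrier := C\<rparr>) = divpart (C \<inter> T)"
    and "\<exists>E. finite E \<and> E \<subseteq> C \<inter> T \<and> (\<forall>a\<in>C \<inter> T. \<exists>u\<in>divpart (C \<inter> T). \<exists>e\<in>E. a = u \<otimes> e)"
    and "\<And>E. \<lbrakk>finite E; E \<subseteq> C \<inter> T; \<forall>a\<in>C \<inter> T. \<exists>u\<in>divpart (C \<inter> T). \<exists>e\<in>E. a = u \<otimes> e\<rbrakk> \<Longrightarrow>
      finite (rcosets\<^bsub>G\<lparr>carrier := C\<rparr>\<^esub> (divpart (C \<inter> T))) \<and>
      card (rcosets\<^bsub>G\<lparr>carrier := C\<rparr>\<^esub> (divpart (C \<inter> T))) \<le> card E * card (rcosets T)"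
proof -
  let ?D = "C \<inter> T" and ?C = "G\<lparr>carrier := C\<rparr>"
  let ?U = "divpart ?D"
  have D: "subgroup ?D G" "?D \<subseteq> T"
    using subgroups_Inter_pair[OF C T_subgroup] by auto
  have U: "subgroup ?U G" "?U \<subseteq> ?D"
    using divpart_subgroup[OF D] divpart_subset by auto
  have CG: "c \<in> carrier G" if "c \<in> C" for c
    using subgroup.mem_carrier[OF C that] .
  have rc: "rcosets\<^bsub>?C\<^esub> H = (\<lambda>c. H #> c) ` C" for H
    unfolding RCOSETS_def r_coset_def by auto
  show ex: "\<exists>E. finite E \<and> E \<subseteq> ?D \<and> (\<forall>a\<in>?D. \<exists>u\<in>?U. \<exists>e\<in>E. a = u \<otimes> e)"
    by (rule divpart_cofinite[OF D])
  show bound: "finite (rcosets\<^bsub>?C\<^esub> ?U) \<and> card (rcosets\<^bsub>?C\<^esub> ?U) \<le> card E * card (rcosets T)"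
    if E: "finite E" "E \<subseteq> ?D" "\<forall>a\<in>?D. \<exists>u\<in>?U. \<exists>e\<in>E. a = u \<otimes> e" for E
  proof -
    obtain R where R: "finite R" "R \<subseteq> C" "card R \<le> card (rcosets T)"
      "\<forall>c\<in>C. \<exists>d\<in>?D. \<exists>r\<in>R. c = d \<otimes> r"
      using coset_representatives[OF C] by blast
    have sub: "rcosets\<^bsub>?C\<^esub> ?U \<subseteq> (\<lambda>(e, r). ?U #> (e \<otimes> r)) ` (E \<times> R)"
    proof
      fix X assume "X \<in> rcosets\<^bsub>?C\<^esub> ?U"
      then obtain c where c: "c \<in> C" "X = ?U #> c"
        unfolding rc by blast
      obtain d r where dr: "d \<in> ?D" "r \<in> R" "c = d \<otimes> r"
        using R(4) c(1) by blast
      obtain u e where ue: "u \<in> ?U" "e \<in> E" "d = u \<otimes> e"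
        using E(3) dr(1) by blast
      have carr: "u \<in> carrier G" "e \<in> carrier G" "r \<in> carrier G"
        using ue(1,2) dr(2) U(2) E(2) R(2) CG by blast+
      have "?U #> u = ?U"
        using coset_join2[OF carr(1) U(1) ue(1)] .
      then have "X = ?U #> (e \<otimes> r)"
        using c(2) dr(3) ue(3) carr coset_mult_assoc[OF subgroup.subset[OF U(1)], of u "e \<otimes> r"]
        by (simp add: m_assoc)
      then show "X \<in> (\<lambda>(e, r). ?U #> (e \<otimes> r)) ` (E \<times> R)"
        using ue(2) dr(2) by blast
    qed
    have fin: "finite (E \<times> R)"
      using E(1) R(1) by blast
    have "card (rcosets\<^bsub>?C\<^esub> ?U) \<le> card (E \<times> R)"
      using card_mono[OF finite_imageI[OF fin] sub] card_image_le[OF fin] by (rule order_trans)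
    also have "\<dots> \<le> card E * card (rcosets T)"
      using R(3) by (simp add: card_cartesian_product)
    finally show ?thesis
      using finite_subset[OF sub finite_imageI[OF fin]] by blast
  qed
  show "identity_component p ?C = ?U"
    unfolding identity_component_def
  proof (rule the_equality)
    have "discrete_p_torus p (?C\<lparr>carrier := ?U\<rparr>)"
      using torus_iff_divisible[OF U(1)] divpart_divisible by simp
    moreover have "subgroup ?U ?C"
      using U C by (intro subgroup_incl) auto
    moreover have "finite (rcosets\<^bsub>?C\<^esub> ?U)"
      using ex bound by blast
    ultimately show "subgroup ?U ?C \<and> discrete_p_torus p (?C\<lparr>carrier := ?U\<rparr>) \<and> finite (rcosets\<^bsub>?C\<^esub> ?U)"
      by blast
  next
    fix V assume V: "subgroup V ?C \<and> discrete_p_torus p (?C\<lparr>carrier := V\<rparr>) \<and> finite (rcosets\<^bsub>?C\<^esub> V)"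
    then have VG: "subgroup V G" "V \<subseteq> C"
      using incl_subgroup[OF C] subgroup.subset[of V ?C] by auto
    have divV: "divisible V"
      using V torus_iff_divisible[OF VG(1)] by simp
    have "V \<subseteq> ?U"
      using divpart_greatest[OF divV] divisible_subset_T[OF divV subgroup.subset[OF VG(1)]] VG(2) by blast
    moreover have "?U \<subseteq> V"
    proof (rule divisible_finite_index[OF divpart_divisible _ VG(1)])
      show "?U \<subseteq> carrier G"
        using subgroup.subset[OF U(1)] .
      show "finite ((\<lambda>d. V #> d) ` ?U)"
        using V unfolding rc by (rule_tac finite_subset[of _ "(\<lambda>c. V #> c) ` C"]) (use U(2) in auto)
    qed
    ultimately show "V = ?U" by blast
  qed
qed

text \<open>The rank depends only on \<open>C \<inter> T\<close>, and so does the bound on the index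
  once \<open>E\<close> is chosen as a function of that intersection. Infinitely many
  \<open>C\<close> thus produce only finitely many orders.\<close>

lemma finite_toral_orders:
  assumes "finite \<D>" "\<And>C. C \<in> \<C> \<Longrightarrow> subgroup C G \<and> C \<inter> T \<in> \<D>"
  shows "finite ((\<lambda>C. toral_order p (G\<lparr>carrier := C\<rparr>)) ` \<C>)"
proof -
  define E where "E D = (SOME E. finite E \<and> E \<subseteq> D \<and> (\<forall>a\<in>D. \<exists>u\<in>divpart D. \<exists>e\<in>E. a = u \<otimes> e))" for D
  have "toral_order p (G\<lparr>carrier := C\<rparr>) \<in>
      (\<Union>D\<in>\<D>. {torus_rank p (G\<lparr>carrier := divpart D\<rparr>)} \<times> {..card (E D) * card (rcosets T)})"
    if C: "C \<in> \<C>" for C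
  proof -
    have C': "subgroup C G" "C \<inter> T \<in> \<D>"
      using assms(2)[OF C] by auto
    note ic = identity_component_eq[OF C'(1)]
    have E: "finite (E (C \<inter> T)) \<and> E (C \<inter> T) \<subseteq> C \<inter> T \<and>
        (\<forall>a\<in>C \<inter> T. \<exists>u\<in>divpart (C \<inter> T). \<exists>e\<in>E (C \<inter> T). a = u \<otimes> e)"
      unfolding E_def by (rule someI_ex) (rule ic(2))
    then have "card (rcosets\<^bsub>G\<lparr>carrier := C\<rparr>\<^esub> (divpart (C \<inter> T))) \<le> card (E (C \<inter> T)) * card (rcosets T)"
      using ic(3) by blast
    then show ?thesis
      unfolding toral_order_def Let_def ic(1) using C'(2) by (auto simp: order_def FactGroup_def)
  qed
  then have "(\<lambda>C. toral_order p (G\<lparr>carrier := C\<rparr>)) ` \<C> \<subseteq>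
      (\<Union>D\<in>\<D>. {torus_rank p (G\<lparr>carrier := divpart D\<rparr>)} \<times> {..card (E D) * card (rcosets T)})"
    by blast
  then show ?thesis
    by (rule finite_subset) (use assms(1) in auto)
qed

end

section \<open>Saturated fusion systems\<close>

lemma lex_le_total: "lex_le a b \<or> lex_le b a"
  unfolding lex_le_def by linarith

lemma lex_le_trans: "lex_le a b \<Longrightarrow> lex_le b c \<Longrightarrow> lex_le a c"
  unfolding lex_le_def by linarith

lemma lex_le_has_max: "finite A \<Longrightarrow> A \<noteq> {} \<Longrightarrow> \<exists>m\<in>A. \<forall>a\<in>A. lex_le a m"
proof (induction A rule: finite_ne_induct)
  case (singleton x)
  then show ?case
    using lex_le_total by blast
next
  case (insert x A)
  then obtain m where "m \<in> A" "\<forall>a\<in>A. lex_le a m"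
    by blast
  then show ?case
    using lex_le_total[of x m] lex_le_total[of x x] lex_le_trans by blast
qed

locale saturated_fusion = toral_group +
  fixes F :: "'a fusion"
  assumes saturated: "saturated p G F"
begin

lemma fusion: "fusion_system G F"
  using saturated unfolding saturated_def by blast

section \<open>Calculus of morphisms in a fusion system\<close>

lemma F_D:
  assumes "\<phi> \<in> F P Q"
  shows "subgroup P G" "subgroup Q G" "\<phi> \<in> extensional P" "inj_on \<phi> P"
    and "\<And>x. x \<in> P \<Longrightarrow> \<phi> x \<in> Q"
    and "\<And>x y. \<lbrakk>x \<in> P; y \<in> P\<rbrakk> \<Longrightarrow> \<phi> (x \<otimes> y) = \<phi> x \<otimes> \<phi> y"
proof -
  have "\<phi> \<in> inj_homs G P Q"
    using fusion assms unfolding fusion_system_def by blast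
  then show "subgroup P G" "subgroup Q G" "\<phi> \<in> extensional P" "inj_on \<phi> P"
    and "\<And>x. x \<in> P \<Longrightarrow> \<phi> x \<in> Q"
    and "\<And>x y. \<lbrakk>x \<in> P; y \<in> P\<rbrakk> \<Longrightarrow> \<phi> (x \<otimes> y) = \<phi> x \<otimes> \<phi> y"
    unfolding inj_homs_def homs_def by (auto simp: hom_def)
qed

lemma F_carrier:
  assumes "\<phi> \<in> F P Q" "x \<in> P"
  shows "x \<in> carrier G" "\<phi> x \<in> carrier G"
  using subgroup.mem_carrier[OF F_D(1)[OF assms(1)] assms(2)]
    subgroup.mem_carrier[OF F_D(2)[OF assms(1)] F_D(5)[OF assms]] by auto

lemma F_group_hom:
  assumes "\<phi> \<in> F P Q"
  shows "group_hom (G\<lparr>carrier := P\<rparr>) G \<phi>"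
  using F_D[OF assms] F_carrier[OF assms] subgroup_imp_group[OF F_D(1)[OF assms]]
  by (intro group_hom.intro group_hom_axioms.intro group_axioms homI) auto

lemma F_one: "\<phi> \<in> F P Q \<Longrightarrow> \<phi> \<one> = \<one>"
  using group_hom.hom_one[OF F_group_hom] by auto

lemma F_inv: "\<phi> \<in> F P Q \<Longrightarrow> x \<in> P \<Longrightarrow> \<phi> (inv x) = inv (\<phi> x)"
  using group_hom.hom_inv[OF F_group_hom, of \<phi> P Q x] m_inv_consistent[OF F_D(1), of \<phi> P Q x] by simp

lemma F_pow: "\<phi> \<in> F P Q \<Longrightarrow> x \<in> P \<Longrightarrow> \<phi> (x [^] (n::nat)) = \<phi> x [^] n"
  using group_hom.hom_nat_pow[OF F_group_hom, of \<phi> P Q x n] by (simp flip: nat_pow_consistent)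

lemma F_conj_by:
  assumes "\<phi> \<in> F P Q" "x \<in> P" "y \<in> P"
  shows "conj_by G x y \<in> P" "\<phi> (conj_by G x y) = conj_by G (\<phi> x) (\<phi> y)"
proof -
  note P = F_D(1)[OF assms(1)]
  have inv: "inv x \<in> P"
    using subgroup.m_inv_closed[OF P assms(2)] .
  then show "conj_by G x y \<in> P"
    unfolding conj_by_def using subgroup.m_closed[OF P] assms by blast
  show "\<phi> (conj_by G x y) = conj_by G (\<phi> x) (\<phi> y)"
    unfolding conj_by_def using F_D(6)[OF assms(1)] F_inv[OF assms(1,2)] inv assms
      subgroup.m_closed[OF P] by metis
qed

lemma F_image_subgroup:
  assumes "\<phi> \<in> F P Q" "subgroup R G" "R \<subseteq> P"
  shows "subgroup (\<phi> ` R) G"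
proof -
  have "subgroup R (G\<lparr>carrier := P\<rparr>)"
    using subgroup_incl[OF assms(2) F_D(1)[OF assms(1)] assms(3)] .
  then show ?thesis
    using group_hom.subgroup_img_is_subgroup[OF F_group_hom[OF assms(1)]] by blast
qed

lemma F_comp: "\<phi> \<in> F P Q \<Longrightarrow> \<psi> \<in> F Q R \<Longrightarrow> compose P \<psi> \<phi> \<in> F P R"
  using fusion unfolding fusion_system_def by blast

lemma F_inverse: "\<phi> \<in> F P Q \<Longrightarrow> restrict (inv_into P \<phi>) (\<phi> ` P) \<in> F (\<phi> ` P) P"
  using fusion unfolding fusion_system_def by blast

lemma F_conj:
  assumes "g \<in> carrier G" "subgroup P G" "subgroup Q G" "conj_by G g ` P \<subseteq> Q"
  shows "restrict (conj_by G g) P \<in> F P Q"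
proof -
  have "restrict (conj_by G g) P \<in> Hom_S G P Q"
    unfolding group_fusion_def using assms subgroup.subset by blast
  then show ?thesis
    using fusion unfolding fusion_system_def by blast
qed

lemma F_incl:
  assumes "subgroup P G" "subgroup Q G" "P \<subseteq> Q"
  shows "(\<lambda>x\<in>P. x) \<in> F P Q"
proof -
  have id: "conj_by G \<one> x = x" if "x \<in> P" for x
    using subgroup.mem_carrier[OF assms(1) that] by simp
  then have "restrict (conj_by G \<one>) P \<in> F P Q"
    using assms by (intro F_conj) auto
  moreover have "restrict (conj_by G \<one>) P = (\<lambda>x\<in>P. x)"
    using id by (auto simp: restrict_def)
  ultimately show ?thesis by simp
qed

lemma F_restrict:
  assumes "\<phi> \<in> F P Q" "subgroup R G" "R \<subseteq> P"
  shows "restrict \<phi> R \<in> F R Q"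
proof -
  have "compose R \<phi> (\<lambda>x\<in>R. x) \<in> F R Q"
    using F_comp[OF F_incl[OF assms(2) F_D(1)[OF assms(1)] assms(3)] assms(1)] .
  moreover have "compose R \<phi> (\<lambda>x\<in>R. x) = restrict \<phi> R"
    by (auto simp: compose_def restrict_def)
  ultimately show ?thesis by simp
qed

lemma F_weaken:
  assumes "\<phi> \<in> F P Q" "subgroup R G" "Q \<subseteq> R"
  shows "\<phi> \<in> F P R"
proof -
  have "compose P (\<lambda>x\<in>Q. x) \<phi> \<in> F P R"
    using F_comp[OF assms(1) F_incl[OF F_D(2)[OF assms(1)] assms(2,3)]] .
  moreover have "compose P (\<lambda>x\<in>Q. x) \<phi> = \<phi>"
  proof
    fix x show "compose P (\<lambda>x\<in>Q. x) \<phi> x = \<phi> x"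
      using F_D(3,5)[OF assms(1)] by (cases "x \<in> P") (auto simp: compose_def extensional_def)
  qed
  ultimately show ?thesis by simp
qed

text \<open>Shrinking the codomain to the image is not among the axioms; it results from inverting
  \<phi> twice.\<close>

lemma F_image:
  assumes "\<phi> \<in> F P Q"
  shows "\<phi> \<in> F P (\<phi> ` P)"
proof -
  let ?\<psi> = "restrict (inv_into P \<phi>) (\<phi> ` P)"
  have inj: "inj_on \<phi> P"
    using F_D(4)[OF assms] .
  have \<psi>: "?\<psi> (\<phi> x) = x" if "x \<in> P" for x
    using that inj by simp
  have im: "?\<psi> ` \<phi> ` P = P"
    using \<psi> by (force simp: image_image)
  have "restrict (inv_into (\<phi> ` P) ?\<psi>) P \<in> F P (\<phi> ` P)"
    using F_inverse[OF F_inverse[OF assms]] unfolding im .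
  moreover have "restrict (inv_into (\<phi> ` P) ?\<psi>) P = \<phi>"
  proof
    fix x show "restrict (inv_into (\<phi> ` P) ?\<psi>) P x = \<phi> x"
    proof (cases "x \<in> P")
      case True
      have "inj_on ?\<psi> (\<phi> ` P)"
        using \<psi> by (auto intro!: inj_onI)
      then have "inv_into (\<phi> ` P) ?\<psi> (?\<psi> (\<phi> x)) = \<phi> x"
        using True by (intro inv_into_f_f) auto
      then show ?thesis
        using True \<psi> by simp
    next
      case False
      then show ?thesis
        using F_D(3)[OF assms] by (simp add: extensional_def)
    qed
  qed
  ultimately show ?thesis by simp
qed

lemma F_codomain:
  assumes "\<phi> \<in> F P Q" "subgroup R G" "\<phi> ` P \<subseteq> R"
  shows "\<phi> \<in> F P R"
  using F_weaken[OF F_image[OF assms(1)] assms(2,3)] .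

lemma F_compose:
  assumes "\<phi> \<in> F P Q" "\<psi> \<in> F Q' R" "\<phi> ` P \<subseteq> Q'"
  shows "compose P \<psi> \<phi> \<in> F P R"
  using F_comp[OF F_codomain[OF assms(1) F_D(1)[OF assms(2)] assms(3)] assms(2)] .

abbreviation mor :: "'a set \<Rightarrow> ('a \<Rightarrow> 'a) set" where
  "mor P \<equiv> F P (carrier G)"

lemma mor_of_F: "\<phi> \<in> F P Q \<Longrightarrow> \<phi> \<in> mor P"
  using F_weaken[OF _ subgroup_self subgroup.subset[OF F_D(2)]] by blast

lemma F_inverse_apply:
  assumes "\<phi> \<in> F P Q"
  obtains \<psi> where "\<psi> \<in> F (\<phi> ` P) P" "\<And>x. x \<in> P \<Longrightarrow> \<psi> (\<phi> x) = x"
  using F_inverse[OF assms] F_D(4)[OF assms] by (auto intro: that)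

text \<open>The morphism \<psi>^-1 \<phi>, on the largest subgroup where it is defined. It combines
  two morphisms with a common target.\<close>

lemma mor_pullback:
  assumes "\<phi> \<in> mor P" "\<psi> \<in> mor Q"
  shows "\<exists>\<theta>\<in>mor {x \<in> P. \<phi> x \<in> \<psi> ` Q}. \<forall>x\<in>P. \<phi> x \<in> \<psi> ` Q \<longrightarrow> \<theta> x \<in> Q \<and> \<psi> (\<theta> x) = \<phi> x"
proof -
  define X where "X = {x \<in> P. \<phi> x \<in> \<psi> ` Q}"
  note P = F_D(1)[OF assms(1)]
  have im: "subgroup (\<psi> ` Q) G"
    by (rule F_image_subgroup[OF assms(2) F_D(1)[OF assms(2)] order_refl])
  have X: "subgroup X G"
  proof (rule subgroupI)
    show "X \<subseteq> carrier G"
      unfolding X_def using subgroup.subset[OF P] by blast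
    show "X \<noteq> {}"
      unfolding X_def using subgroup.one_closed[OF P] F_one[OF assms(1)] subgroup.one_closed[OF im] by auto
    show "inv x \<in> X" if "x \<in> X" for x
      using that subgroup.m_inv_closed[OF P] F_inv[OF assms(1)] subgroup.m_inv_closed[OF im]
      unfolding X_def by simp
    show "x \<otimes> y \<in> X" if "x \<in> X" "y \<in> X" for x y
      using that subgroup.m_closed[OF P] F_D(6)[OF assms(1)] subgroup.m_closed[OF im]
      unfolding X_def by simp
  qed
  obtain \<chi> where \<chi>: "\<chi> \<in> F (\<psi> ` Q) Q" "\<And>x. x \<in> Q \<Longrightarrow> \<chi> (\<psi> x) = x"
    using F_inverse_apply[OF assms(2)] by blast
  have "X \<subseteq> P"
    unfolding X_def by blast
  have "compose X \<chi> (restrict \<phi> X) \<in> mor X"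
    by (rule F_compose[OF F_restrict[OF assms(1) X \<open>X \<subseteq> P\<close>] mor_of_F[OF \<chi>(1)]]) (auto simp: X_def)
  moreover have "compose X \<chi> (restrict \<phi> X) x \<in> Q \<and> \<psi> (compose X \<chi> (restrict \<phi> X) x) = \<phi> x"
    if x: "x \<in> X" for x
  proof -
    obtain y where "y \<in> Q" "\<phi> x = \<psi> y"
      using x unfolding X_def by blast
    then show ?thesis
      using x \<chi>(2) by (simp add: compose_def)
  qed
  ultimately show ?thesis
    unfolding X_def by blast
qed

lemma image_divisible:
  assumes "\<phi> \<in> F P Q" "D \<subseteq> P" "divisible D"
  shows "divisible (\<phi> ` D)"
  unfolding divisible_def
proof
  fix y assume "y \<in> \<phi> ` D"
  then obtain x where x: "x \<in> D" "y = \<phi> x"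
    by blast
  then obtain z where z: "z \<in> D" "z [^] p = x"
    using assms(3) unfolding divisible_def by blast
  then have "\<phi> z [^] p = y"
    using F_pow[OF assms(1)] x assms(2) by (metis subsetD)
  then show "\<exists>y'\<in>\<phi> ` D. y' [^] p = y"
    using z by blast
qed

lemma image_divisible_T:
  assumes "\<phi> \<in> F P Q" "D \<subseteq> P" "divisible D"
  shows "\<phi> ` D \<subseteq> T"
proof (rule divisible_subset_T[OF image_divisible[OF assms]])
  show "\<phi> ` D \<subseteq> carrier G"
    using F_carrier(2)[OF assms(1)] assms(2) by blast
qed

text \<open>The image of \<open>T\<close> is divisible, hence inside \<open>T\<close>. It is all of
  \<open>T\<close> because each finite layer of \<open>p^n\<close>-torsion is mapped injectively
  into itself.\<close>

lemma mor_T: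
  assumes "\<phi> \<in> mor T"
  shows "\<phi> ` T = T" "\<phi> \<in> F T T"
proof -
  have sub: "\<phi> ` T \<subseteq> T"
    using image_divisible_T[OF assms _ divisible_T] by blast
  then show "\<phi> \<in> F T T"
    by (rule F_codomain[OF assms T_subgroup])
  have "T \<subseteq> \<phi> ` T"
  proof
    fix x assume x: "x \<in> T"
    then obtain n :: nat where n: "x [^] (p ^ n) = \<one>"
      using T_torsion by blast
    let ?X = "{x \<in> T. x [^] (p ^ n) = \<one>}"
    have "\<phi> ` ?X \<subseteq> ?X"
    proof
      fix z assume "z \<in> \<phi> ` ?X"
      then obtain y where y: "y \<in> T" "y [^] (p ^ n) = \<one>" "z = \<phi> y"
        by blast
      then have "z [^] (p ^ n) = \<one>"
        using F_pow[OF assms y(1), of "p ^ n"] F_one[OF assms] by simp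
      then show "z \<in> ?X"
        using y sub by blast
    qed
    moreover have "inj_on \<phi> ?X"
      using F_D(4)[OF assms] by (rule inj_on_subset) blast
    ultimately have "\<phi> ` ?X = ?X"
      using T_finite by (rule_tac endo_inj_surj)
    then show "x \<in> \<phi> ` T"
      using x n by blast
  qed
  with sub show "\<phi> ` T = T"
    by blast
qed

section \<open>The finite automizer of the torus\<close>

abbreviation W :: "('a \<Rightarrow> 'a) set" where
  "W \<equiv> F T T"

lemma W_D:
  assumes "w \<in> W"
  shows "w \<in> mor T" "w ` T = T" "\<And>x. x \<in> T \<Longrightarrow> w x \<in> T"
  using mor_of_F[OF assms] mor_T(1)[OF mor_of_F[OF assms]] F_D(5)[OF assms] by auto

lemma W_conj: "g \<in> carrier G \<Longrightarrow> restrict (conj_by G g) T \<in> W"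
  using T_conj by (intro F_conj T_subgroup) auto

lemma W_comp: "u \<in> W \<Longrightarrow> v \<in> W \<Longrightarrow> compose T u v \<in> W"
  using F_comp by blast

lemma W_inverse:
  assumes "w \<in> W"
  obtains v where "v \<in> W" "\<And>x. x \<in> T \<Longrightarrow> v (w x) = x" "\<And>x. x \<in> T \<Longrightarrow> w (v x) = x"
proof -
  obtain v where v: "v \<in> F (w ` T) T" "\<And>x. x \<in> T \<Longrightarrow> v (w x) = x"
    using F_inverse_apply[OF assms] by blast
  then have "v \<in> W"
    using W_D(2)[OF assms] by simp
  moreover have "w (v x) = x" if "x \<in> T" for x
    using that v(2) W_D(2)[OF assms] by (metis imageE)
  ultimately show thesis
    using that v(2) by blast
qed

text \<open>\<open>T\<close> is its only conjugate, hence fully normalized, and the Sylow axiom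
  makes its outer automorphism group finite. Since \<open>T\<close> is abelian, \<open>Inn\<close>
  is trivial and the cosets in \<open>Out\<close> are singletons.\<close>

lemma finite_W: "finite W"
proof -
  have "fclass G F T = {T}"
    using mor_T(1) mor_of_F[OF F_incl[OF T_subgroup T_subgroup order_refl]]
    unfolding fclass_def by blast
  then have "fully_normalized p G F T"
    unfolding fully_normalized_def by (simp add: lex_le_def)
  then have "fully_automized p G F T"
    using saturated T_subgroup unfolding saturated_def by blast
  then have fin: "finite (carrier (Out G F T))"
    unfolding fully_automized_def by blast
  have Inn: "Inn G T = {\<lambda>x\<in>T. x}"
  proof -
    have "restrict (conj_by G g) T = (\<lambda>x\<in>T. x)" if g: "g \<in> T" for g
    proof -
      have "conj_by G g x = x" if "x \<in> T" for x
        using T_comm[OF g that] T_carrier[OF g] T_carrier[OF that] by (simp add: conj_by_def m_assoc)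
      then show ?thesis
        by (auto simp: restrict_def)
    qed
    then show ?thesis
      unfolding Inn_def using subgroup.one_closed[OF T_subgroup] by auto
  qed
  have "carrier (Out G F T) = (\<lambda>w. {w}) ` W"
  proof -
    have "Inn G T #>\<^bsub>aut_group T W\<^esub> w = {w}" if "w \<in> W" for w
    proof -
      have "compose T (\<lambda>x\<in>T. x) w = w"
      proof
        fix x show "compose T (\<lambda>x\<in>T. x) w x = w x"
          using F_D(3,5)[OF that] by (cases "x \<in> T") (auto simp: compose_def extensional_def)
      qed
      then show ?thesis
        unfolding Inn r_coset_def by (simp add: aut_group_def)
    qed
    then show ?thesis
      unfolding Out_def FactGroup_def RCOSETS_def by (auto simp: aut_group_def)
  qed
  then show ?thesis
    using fin by (simp add: finite_image_iff)
qed

section \<open>Fully centralized subgroups and the extension axiom\<close>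

lemma centralizer_subgroup:
  assumes "P \<subseteq> carrier G"
  shows "subgroup (centralizer G P) G"
proof (rule subgroupI)
  show "centralizer G P \<subseteq> carrier G" "centralizer G P \<noteq> {}"
    using assms unfolding centralizer_def by (auto intro!: exI[of _ \<one>])
next
  fix g assume g: "g \<in> centralizer G P"
  have "inv g \<otimes> x = x \<otimes> inv g" if x: "x \<in> P" for x
  proof -
    have "g \<in> carrier G" "x \<in> carrier G" "g \<otimes> x = x \<otimes> g"
      using g x assms unfolding centralizer_def by auto
    then show ?thesis
      by (metis inv_solve_left inv_solve_right m_assoc m_closed inv_closed)
  qed
  then show "inv g \<in> centralizer G P"
    using g unfolding centralizer_def by simp
next
  fix g h assume gh: "g \<in> centralizer G P" "h \<in> centralizer G P"
  have "g \<otimes> h \<otimes> x = x \<otimes> (g \<otimes> h)" if x: "x \<in> P" for x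
  proof -
    have "g \<in> carrier G" "h \<in> carrier G" "x \<in> carrier G" "g \<otimes> x = x \<otimes> g" "h \<otimes> x = x \<otimes> h"
      using gh x assms unfolding centralizer_def by auto
    then show ?thesis
      by (metis m_assoc)
  qed
  then show "g \<otimes> h \<in> centralizer G P"
    using gh unfolding centralizer_def by simp
qed

lemma conj_by_eq_iff_commute:
  assumes "g \<in> carrier G" "x \<in> carrier G"
  shows "conj_by G g x = x \<longleftrightarrow> g \<otimes> x = x \<otimes> g"
proof -
  have "conj_by G g x = x \<longleftrightarrow> g \<otimes> x \<otimes> inv g \<otimes> g = x \<otimes> g"
    unfolding conj_by_def using assms by (metis inv_closed m_closed right_cancel)
  then show ?thesis
    using assms by (simp add: m_assoc)
qed

text \<open>Centralizers meet \<open>T\<close> in the fixed points of subsets of the finite group \<open>W\<close>, so only finitely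
  many orders occur.\<close>

lemma fully_centralized_exists:
  assumes "subgroup P G"
  shows "\<exists>\<chi>\<in>mor P. fully_centralized p G F (\<chi> ` P)"
proof -
  let ?cent = "centralizer G ` fclass G F P"
  have sub: "P' \<subseteq> carrier G" if "P' \<in> fclass G F P" for P'
    using that F_carrier(2) unfolding fclass_def by blast
  have "finite ((\<lambda>C. toral_order p (G\<lparr>carrier := C\<rparr>)) ` ?cent)"
  proof (rule finite_toral_orders)
    show "finite ((\<lambda>V. {t \<in> T. \<forall>f\<in>V. f t = t}) ` Pow W)"
      using finite_W by simp
    fix C assume "C \<in> ?cent"
    then obtain P' where P': "P' \<in> fclass G F P" "C = centralizer G P'"
      by blast
    let ?V = "(\<lambda>g. restrict (conj_by G g) T) ` P'"
    have "?V \<in> Pow W"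
      using W_conj sub[OF P'(1)] by blast
    moreover have "C \<inter> T = {t \<in> T. \<forall>f\<in>?V. f t = t}"
    proof -
      have "conj_by G g t = t \<longleftrightarrow> t \<otimes> g = g \<otimes> t" if "g \<in> P'" "t \<in> T" for g t
        using conj_by_eq_iff_commute[of g t] T_carrier[OF that(2)] that(1) sub[OF P'(1)] by auto
      then show ?thesis
        unfolding P'(2) centralizer_def using T_carrier by auto
    qed
    ultimately show "subgroup C G \<and> C \<inter> T \<in> (\<lambda>V. {t \<in> T. \<forall>f\<in>V. f t = t}) ` Pow W"
      using centralizer_subgroup[OF sub[OF P'(1)]] P'(2) by blast
  qed
  moreover have "P \<in> fclass G F P"
  proof -
    have "(\<lambda>x\<in>P. x) \<in> mor P"
      using F_incl[OF assms subgroup_self] subgroup.subset[OF assms] by blast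
    moreover have "(\<lambda>x\<in>P. x) ` P = P"
      by auto
    ultimately show ?thesis
      unfolding fclass_def by (metis (mono_tags, lifting) mem_Collect_eq)
  qed
  ultimately obtain P1 where P1: "P1 \<in> fclass G F P" "\<And>P'. P' \<in> fclass G F P \<Longrightarrow>
      lex_le (toral_order p (G\<lparr>carrier := centralizer G P'\<rparr>)) (toral_order p (G\<lparr>carrier := centralizer G P1\<rparr>))"
    using lex_le_has_max[of "(\<lambda>C. toral_order p (G\<lparr>carrier := C\<rparr>)) ` ?cent"] by auto
  then obtain \<chi> where \<chi>: "\<chi> \<in> mor P" "P1 = \<chi> ` P"
    unfolding fclass_def by blast
  \<comment> \<open>Maximality was obtained over the conjugates of \<open>P\<close>; full
    centralization concerns those of \<open>P1\<close>.\<close>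
  have "P' \<in> fclass G F P" if "P' \<in> fclass G F P1" for P'
  proof -
    obtain \<psi> where "\<psi> \<in> mor P1" "P' = \<psi> ` P1"
      using \<open>P' \<in> fclass G F P1\<close> unfolding fclass_def by blast
    then have "compose P \<psi> \<chi> \<in> mor P" "P' = compose P \<psi> \<chi> ` P"
      using F_compose[OF \<chi>(1)] \<chi>(2) by (auto simp: compose_def)
    then show ?thesis
      unfolding fclass_def by blast
  qed
  then have "fully_centralized p G F P1"
    unfolding fully_centralized_def using P1(2) by blast
  then show ?thesis
    using \<chi> by blast
qed

lemma mem_normalizer_iff:
  assumes "Q \<subseteq> carrier G" "g \<in> carrier G"
  shows "g \<in> normalizer G Q \<longleftrightarrow> conj_by G g ` Q = Q"
proof -
  have "g <# Q #> inv g = conj_by G g ` Q"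
    unfolding l_coset_def r_coset_def conj_by_def by blast
  then show ?thesis
    unfolding normalizer_def stabilizer_def using assms by simp
qed

lemma mem_N_phi:
  assumes "\<chi> \<in> mor Q" "g \<in> carrier G" "conj_by G g ` Q = Q" "h \<in> carrier G"
    and "\<And>x. x \<in> Q \<Longrightarrow> \<chi> (conj_by G g x) = conj_by G h (\<chi> x)"
  shows "g \<in> N_phi G Q (\<chi> ` Q) \<chi>"
proof -
  note Q = F_D(1)[OF assms(1)]
  have im: "subgroup (\<chi> ` Q) G"
    by (rule F_image_subgroup[OF assms(1) Q order_refl])
  have "(\<lambda>x\<in>\<chi> ` Q. \<chi> (conj_by G g (inv_into Q \<chi> x))) = restrict (conj_by G h) (\<chi> ` Q)"
    using F_D(4)[OF assms(1)] assms(5) by (auto simp: restrict_def fun_eq_iff)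
  moreover have "conj_by G h ` \<chi> ` Q \<subseteq> \<chi> ` Q"
  proof
    fix y assume "y \<in> conj_by G h ` \<chi> ` Q"
    then obtain x where "x \<in> Q" "y = conj_by G h (\<chi> x)"
      by blast
    then have "y = \<chi> (conj_by G g x)" "conj_by G g x \<in> Q"
      using assms(3,5) by auto
    then show "y \<in> \<chi> ` Q" by blast
  qed
  ultimately have "(\<lambda>x\<in>\<chi> ` Q. \<chi> (conj_by G g (inv_into Q \<chi> x))) \<in> Hom_S G (\<chi> ` Q) (\<chi> ` Q)"
    unfolding group_fusion_def using im subgroup.subset[OF im] assms(4) by blast
  then show ?thesis
    unfolding N_phi_def using mem_normalizer_iff[OF subgroup.subset[OF Q] assms(2)] assms(3) by blast
qed

lemma subset_N_phi:
  assumes "\<chi> \<in> mor Q"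
  shows "Q \<subseteq> N_phi G Q (\<chi> ` Q) \<chi>"
proof
  fix g assume g: "g \<in> Q"
  show "g \<in> N_phi G Q (\<chi> ` Q) \<chi>"
    by (rule mem_N_phi[OF assms F_carrier(1)[OF assms g] conj_by_subgroup_eq[OF F_D(1)[OF assms] g]
          F_carrier(2)[OF assms g] F_conj_by(2)[OF assms g]])
qed

text \<open>Conjugation by such an element is trivial on \<open>Q\<close>, so it corresponds to
  conjugation by \<one> on the image.\<close>

lemma centralizer_subset_N_phi:
  assumes "\<chi> \<in> mor Q"
  shows "centralizer G Q \<subseteq> N_phi G Q (\<chi> ` Q) \<chi>"
proof
  fix g assume g: "g \<in> centralizer G Q"
  then have gG: "g \<in> carrier G"
    unfolding centralizer_def by blast
  have id: "conj_by G g x = x" if "x \<in> Q" for x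
    using g that conj_by_eq_iff_commute[OF gG F_carrier(1)[OF assms that]]
    unfolding centralizer_def by blast
  show "g \<in> N_phi G Q (\<chi> ` Q) \<chi>"
    using id F_carrier(2)[OF assms] by (intro mem_N_phi[OF assms gG _ one_closed]) auto
qed

text \<open>The working form of receptivity, starting from the source of \<chi>: the inverse of
  \<chi> shows that \<open>Q\<close> belongs to the class of its image.\<close>

lemma N_phi_extension:
  assumes "\<chi> \<in> mor Q" "fully_centralized p G F (\<chi> ` Q)"
  shows "\<exists>\<psi>\<in>mor (N_phi G Q (\<chi> ` Q) \<chi>). \<forall>x\<in>Q. \<psi> x = \<chi> x"
proof -
  note Q = F_D(1)[OF assms(1)]
  have im: "subgroup (\<chi> ` Q) G"
    by (rule F_image_subgroup[OF assms(1) Q order_refl])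
  have "receptive G F (\<chi> ` Q)"
    using saturated im assms(2) unfolding saturated_def by blast
  moreover have "Q \<in> fclass G F (\<chi> ` Q)"
  proof -
    obtain \<theta> where \<theta>: "\<theta> \<in> F (\<chi> ` Q) Q" "\<And>x. x \<in> Q \<Longrightarrow> \<theta> (\<chi> x) = x"
      using F_inverse_apply[OF assms(1)] by blast
    have "\<theta> ` \<chi> ` Q = Q"
      using \<theta>(2) by (force simp: image_image)
    then show ?thesis
      unfolding fclass_def using mor_of_F[OF \<theta>(1)] by blast
  qed
  moreover have "\<chi> \<in> F Q (\<chi> ` Q)"
    by (rule F_image[OF assms(1)])
  ultimately obtain \<psi> where \<psi>: "\<psi> \<in> mor (N_phi G Q (\<chi> ` Q) \<chi>)" "restrict \<psi> Q = \<chi>"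
    unfolding receptive_def by blast
  then have "\<forall>x\<in>Q. \<psi> x = \<chi> x"
    by (metis restrict_apply')
  then show ?thesis
    using \<psi>(1) by blast
qed

lemma T_subset_centralizer: "P \<subseteq> T \<Longrightarrow> T \<subseteq> centralizer G P"
  unfolding centralizer_def using T_comm T_carrier by blast

text \<open>\<open>T\<close> is abelian, so it centralizes \<open>P\<close> and lies in the domain
  of the extension, which must map \<open>T\<close> onto itself.\<close>

lemma fully_centralized_extends_to_T:
  assumes "\<chi> \<in> mor P" "fully_centralized p G F (\<chi> ` P)" "P \<subseteq> T"
  shows "\<exists>w\<in>W. \<forall>x\<in>P. \<chi> x = w x"
proof -
  let ?N = "N_phi G P (\<chi> ` P) \<chi>"
  obtain \<psi> where \<psi>: "\<psi> \<in> mor ?N" "\<forall>x\<in>P. \<psi> x = \<chi> x"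
    using N_phi_extension[OF assms(1,2)] by blast
  have "T \<subseteq> ?N"
    using T_subset_centralizer[OF assms(3)] centralizer_subset_N_phi[OF assms(1)] by blast
  then have "restrict \<psi> T \<in> W"
    by (rule mor_T(2)[OF F_restrict[OF \<psi>(1) T_subgroup]])
  then show ?thesis
    using \<psi>(2) assms(3) by (intro bexI[of _ "restrict \<psi> T"]) auto
qed

text \<open>The image of \<phi> may fail to be fully centralized. But a morphism \<chi> onto a fully
  centralized conjugate and \<chi> \<phi>^-1 both come from elements \<open>u\<close> and
  \<open>v\<close> of \<open>W\<close>, so that \<phi> is \<open>v\<close>^-1
  \<open>u\<close>.\<close>

lemma W_extension:
  assumes "\<phi> \<in> mor P" "P \<subseteq> T" "\<phi> ` P \<subseteq> T"
  shows "\<exists>w\<in>W. \<forall>x\<in>P. \<phi> x = w x"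
proof -
  note P = F_D(1)[OF assms(1)]
  obtain \<chi> where \<chi>: "\<chi> \<in> mor P" "fully_centralized p G F (\<chi> ` P)"
    using fully_centralized_exists[OF P] by blast
  obtain \<theta> where \<theta>: "\<theta> \<in> F (\<phi> ` P) P" "\<And>x. x \<in> P \<Longrightarrow> \<theta> (\<phi> x) = x"
    using F_inverse_apply[OF assms(1)] by blast
  let ?\<chi>' = "compose (\<phi> ` P) \<chi> \<theta>"
  have \<chi>': "?\<chi>' \<in> mor (\<phi> ` P)" "?\<chi>' ` \<phi> ` P = \<chi> ` P"
    using F_comp[OF \<theta>(1) \<chi>(1)] \<theta>(2) by (auto simp: compose_def image_image)
  obtain u where u: "u \<in> W" "\<forall>x\<in>P. \<chi> x = u x"
    using fully_centralized_extends_to_T[OF \<chi> assms(2)] by blast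
  obtain v where v: "v \<in> W" "\<forall>x\<in>\<phi> ` P. ?\<chi>' x = v x"
    using fully_centralized_extends_to_T[OF \<chi>'(1) _ assms(3)] \<chi>(2) \<chi>'(2) by auto
  obtain v' where v': "v' \<in> W" "\<And>x. x \<in> T \<Longrightarrow> v' (v x) = x"
    using W_inverse[OF v(1)] by blast
  have "\<phi> x = compose T v' u x" if x: "x \<in> P" for x
  proof -
    have "v (\<phi> x) = u x"
      using u(2) v(2) x \<theta>(2) by (simp add: compose_def)
    then show ?thesis
      using v'(2)[of "\<phi> x"] x assms(2,3) by (auto simp: compose_def)
  qed
  then show ?thesis
    using W_comp[OF v'(1) u(1)] by blast
qed

end

section \<open>Extending morphisms\<close>

context saturated_fusion
begin

definition determines :: "'a set \<Rightarrow> 'a set \<Rightarrow> bool" where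
  "determines B J \<longleftrightarrow> (\<forall>u\<in>W. \<forall>v\<in>W. (\<forall>b\<in>B. u b = v b) \<longrightarrow> (\<forall>j\<in>J. u j = v j))"

text \<open>The intended example is a divisible \<open>B \<le> T\<close> and the identity component \<open>J\<close> of the
  subgroup of \<open>T\<close> fixed by the centralizer of \<open>B\<close> in \<open>W\<close>.\<close>

definition determining_pair :: "'a set \<Rightarrow> 'a set \<Rightarrow> bool" where
  "determining_pair B J \<longleftrightarrow> B \<subseteq> J \<and> J \<subseteq> T \<and> subgroup J G \<and> divisible J \<and> determines B J"

lemma determines_D:
  assumes "determines B J" "u \<in> W" "v \<in> W" "\<And>b. b \<in> B \<Longrightarrow> u b = v b" "j \<in> J"
  shows "u j = v j"
  using assms unfolding determines_def by blast

lemma determining_pair_D: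
  assumes "determining_pair B J"
  shows "B \<subseteq> J" "J \<subseteq> T" "B \<subseteq> T" "subgroup J G" "divisible J" "determines B J"
  using assms unfolding determining_pair_def by auto

lemma determining_pair_image:
  assumes pair: "determining_pair B J" and w: "w \<in> W"
  shows "determining_pair (w ` B) (w ` J)"
  unfolding determining_pair_def
proof (intro conjI)
  note pair = determining_pair_D[OF pair]
  show "w ` B \<subseteq> w ` J" "w ` J \<subseteq> T"
    using pair W_D(3)[OF w] by blast+
  show "subgroup (w ` J) G"
    by (rule F_image_subgroup[OF w pair(4,2)])
  show "divisible (w ` J)"
    by (rule image_divisible[OF w pair(2,5)])
  show "determines (w ` B) (w ` J)"
    unfolding determines_def
  proof (intro ballI impI)
    fix u v x assume uv: "u \<in> W" "v \<in> W" "\<forall>b\<in>w ` B. u b = v b" "x \<in> w ` J"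
    then obtain j where j: "j \<in> J" "x = w j"
      by blast
    have "compose T u w j = compose T v w j"
      by (rule determines_D[OF pair(6) W_comp[OF uv(1) w] W_comp[OF uv(2) w] _ j(1)])
        (use uv(3) pair(3) in \<open>auto simp: compose_def\<close>)
    then show "u x = v x"
      using j pair(2) by (auto simp: compose_def)
  qed
qed

text \<open>For \<open>a \<in> A\<close>, conjugation by \<open>\<phi> a\<close> fixes \<open>w ` B\<close> and hence \<open>w ` J\<close>, so that a morphism from
  \<open>\<phi> ` A\<close> to a fully centralized conjugate extends over \<open>w ` J\<close>; there it must agree with an element
  of \<open>W\<close>, and injectivity gives \<open>\<phi> a = w a\<close>.\<close>

lemma agree_on_intermediate:
  assumes pair: "determining_pair B J"
    and \<phi>: "\<phi> \<in> mor A" and A: "B \<subseteq> A" "A \<subseteq> J"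
    and w: "w \<in> W" "\<And>b. b \<in> B \<Longrightarrow> \<phi> b = w b"
    and a: "a \<in> A"
  shows "\<phi> a = w a"
proof -
  note pair' = determining_pair_D[OF pair]
  have AT: "A \<subseteq> T"
    using A pair' by blast
  have Asub: "subgroup A G"
    by (rule F_D(1)[OF \<phi>])
  obtain \<chi> where \<chi>: "\<chi> \<in> mor A" "fully_centralized p G F (\<chi> ` A)"
    using fully_centralized_exists[OF Asub] by blast
  obtain v where v: "v \<in> W" "\<And>x. x \<in> A \<Longrightarrow> \<chi> x = v x"
    using fully_centralized_extends_to_T[OF \<chi> AT] by blast
  obtain \<theta> where \<theta>: "\<theta> \<in> F (\<phi> ` A) A" "\<And>x. x \<in> A \<Longrightarrow> \<theta> (\<phi> x) = x"
    using F_inverse_apply[OF \<phi>] by blast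
  define \<chi>' where "\<chi>' = compose (\<phi> ` A) \<chi> \<theta>"
  have \<chi>': "\<chi>' \<in> mor (\<phi> ` A)" "\<And>x. x \<in> A \<Longrightarrow> \<chi>' (\<phi> x) = \<chi> x"
    unfolding \<chi>'_def using F_comp[OF \<theta>(1) \<chi>(1)] \<theta>(2) by (auto simp: compose_def)
  have im: "\<chi>' ` \<phi> ` A = \<chi> ` A"
    using \<chi>'(2) by (simp add: image_image)
  let ?N = "N_phi G (\<phi> ` A) (\<chi>' ` \<phi> ` A) \<chi>'"
  obtain \<psi> where \<psi>: "\<psi> \<in> mor ?N" "\<And>x. x \<in> \<phi> ` A \<Longrightarrow> \<psi> x = \<chi>' x"
    using N_phi_extension[OF \<chi>'(1)] \<chi>(2) im by metis
  have wJ: "w ` J \<subseteq> ?N"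
  proof -
    have "w j \<in> centralizer G (\<phi> ` A)" if j: "j \<in> J" for j
    proof -
      have wjT: "w j \<in> T"
        using W_D(3)[OF w(1)] j pair'(2) by blast
      have "w j \<otimes> \<phi> x = \<phi> x \<otimes> w j" if x: "x \<in> A" for x
      proof -
        have xG: "\<phi> x \<in> carrier G"
          by (rule F_carrier(2)[OF \<phi> x])
        have "compose T (restrict (conj_by G (\<phi> x)) T) w j = w j"
        proof (rule determines_D[OF pair'(6) W_comp[OF W_conj[OF xG] w(1)] w(1) _ j])
          fix b assume b: "b \<in> B"
          have bA: "b \<in> A" and bT: "b \<in> T" and xT: "x \<in> T"
            using b x A(1) AT by auto
          have "conj_by G x b = b"
            using conj_by_eq_iff_commute[OF T_carrier[OF xT] T_carrier[OF bT]] T_comm[OF xT bT] by blast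
          then have "conj_by G (\<phi> x) (\<phi> b) = \<phi> b"
            using F_conj_by(2)[OF \<phi> x bA] by simp
          then show "compose T (restrict (conj_by G (\<phi> x)) T) w b = w b"
            using w(2)[OF b] W_D(3)[OF w(1) bT] bT by (simp add: compose_def)
        qed
        then have "conj_by G (\<phi> x) (w j) = w j"
          using wjT j pair'(2) by (auto simp: compose_def)
        then show ?thesis
          using conj_by_eq_iff_commute[OF xG T_carrier[OF wjT]] by simp
      qed
      then show ?thesis
        using T_carrier[OF wjT] unfolding centralizer_def by blast
    qed
    then show ?thesis
      using centralizer_subset_N_phi[OF \<chi>'(1)] by blast
  qed
  have wJ_sub: "subgroup (w ` J) G"
    by (rule F_image_subgroup[OF w(1) pair'(4,2)])
  have "\<exists>v'\<in>W. \<forall>x\<in>w ` J. restrict \<psi> (w ` J) x = v' x"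
  proof (rule W_extension)
    show mor: "restrict \<psi> (w ` J) \<in> mor (w ` J)"
      by (rule F_restrict[OF \<psi>(1) wJ_sub wJ])
    show "w ` J \<subseteq> T"
      using W_D(3)[OF w(1)] pair'(2) by blast
    show "restrict \<psi> (w ` J) ` w ` J \<subseteq> T"
      by (rule image_divisible_T[OF mor order_refl image_divisible[OF w(1) pair'(2,5)]])
  qed
  then obtain v' where v': "v' \<in> W" "\<And>j. j \<in> J \<Longrightarrow> \<psi> (w j) = v' (w j)"
    by auto
  have aT: "a \<in> T" "a \<in> J"
    using a AT A(2) by auto
  \<comment> \<open>Both sides are elements of \<open>W\<close> that agree on \<open>B\<close>,
    hence also at the point \<open>a\<close> of \<open>J\<close>.\<close>
  have "compose T v' w a = v a"
  proof (rule determines_D[OF pair'(6) W_comp[OF v'(1) w(1)] v(1) _ aT(2)])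
    fix b assume b: "b \<in> B"
    then have "b \<in> A" "b \<in> J" "b \<in> T"
      using A pair' by auto
    then have "v' (w b) = v b"
      using v'(2)[of b] w(2)[OF b] \<psi>(2)[of "\<phi> b"] \<chi>'(2)[of b] v(2)[of b]
        imageI[of b A \<phi>] by simp
    then show "compose T v' w b = v b"
      using \<open>b \<in> T\<close> by (simp add: compose_def)
  qed
  then have "\<psi> (w a) = v a"
    using v'(2)[OF aT(2)] aT(1) by (simp add: compose_def)
  also have "\<dots> = \<psi> (\<phi> a)"
    using \<psi>(2)[of "\<phi> a"] \<chi>'(2)[OF a] v(2)[OF a] a by simp
  finally have "\<psi> (\<phi> a) = \<psi> (w a)" ..
  moreover have "\<phi> a \<in> ?N" "w a \<in> ?N"
    using subset_N_phi[OF \<chi>'(1)] a wJ aT(2) by auto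
  ultimately show ?thesis
    using F_D(4)[OF \<psi>(1)] by (auto dest: inj_onD)
qed

text \<open>Rigidity for domains not contained in \<open>T\<close>, by restriction to
  \<open>Q \<inter> J\<close>: wherever a morphism is defined on \<open>J\<close>, its values are
  forced by those on \<open>B\<close>.\<close>

lemma agree_on_intersection:
  assumes pair: "determining_pair B J"
    and \<phi>: "\<phi> \<in> mor Q" "B \<subseteq> Q"
    and w: "w \<in> W" "\<And>b. b \<in> B \<Longrightarrow> \<phi> b = w b"
    and x: "x \<in> Q" "x \<in> J"
  shows "\<phi> x = w x"
proof -
  note pair' = determining_pair_D[OF pair]
  have "subgroup (Q \<inter> J) G"
    by (rule subgroups_Inter_pair[OF F_D(1)[OF \<phi>(1)] pair'(4)])
  then have "restrict \<phi> (Q \<inter> J) \<in> mor (Q \<inter> J)"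
    by (intro F_restrict[OF \<phi>(1)]) auto
  then have "restrict \<phi> (Q \<inter> J) x = w x"
    by (rule agree_on_intermediate[OF pair]) (use \<phi>(2) pair'(1) w x in auto)
  then show ?thesis
    using x by simp
qed

text \<open>As \<open>x\<close> normalizes \<open>B\<close>, the elements \<open>w c_x\<close> and
  \<open>c_(\<phi> x) w\<close> of \<open>W\<close> agree on \<open>B\<close>; hence they agree on
  \<open>J\<close>.\<close>

lemma W_equivariant:
  assumes pair: "determining_pair B J"
    and \<phi>: "\<phi> \<in> mor Q" "B \<subseteq> Q"
    and w: "w \<in> W" "\<And>b. b \<in> B \<Longrightarrow> \<phi> b = w b"
    and x: "x \<in> Q" "\<And>b. b \<in> B \<Longrightarrow> conj_by G x b \<in> B"
    and j: "j \<in> J"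
  shows "w (conj_by G x j) = conj_by G (\<phi> x) (w j)"
proof -
  note pair' = determining_pair_D[OF pair]
  have jT: "j \<in> T"
    using j pair'(2) by blast
  have xG: "x \<in> carrier G" "\<phi> x \<in> carrier G"
    using F_carrier[OF \<phi>(1) x(1)] by auto
  have "compose T w (restrict (conj_by G x) T) j = compose T (restrict (conj_by G (\<phi> x)) T) w j"
  proof (rule determines_D[OF pair'(6) W_comp[OF w(1) W_conj[OF xG(1)]] W_comp[OF W_conj[OF xG(2)] w(1)] _ j])
    fix b assume b: "b \<in> B"
    have bT: "b \<in> T" and bQ: "b \<in> Q"
      using b pair'(3) \<phi>(2) by auto
    have "w (conj_by G x b) = conj_by G (\<phi> x) (w b)"
      using w(2)[OF b] w(2)[OF x(2)[OF b]] F_conj_by(2)[OF \<phi>(1) x(1) bQ] by simp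
    then show "compose T w (restrict (conj_by G x) T) b = compose T (restrict (conj_by G (\<phi> x)) T) w b"
      using bT W_D(3)[OF w(1) bT] by (simp add: compose_def)
  qed
  then show ?thesis
    using jT W_D(3)[OF w(1) jT] by (simp add: compose_def)
qed

text \<open>\<phi> need not be defined at \<open>t\<close>; the element \<open>w t\<close> stands in
  for its value. The commutator \<open>t x t^-1 x^-1\<close> lies in \<open>Q \<inter> J\<close>,
  where \<phi> equals \<open>w\<close>, and \<open>W_equivariant\<close> evaluates it.\<close>

lemma normalizing_equivariant:
  assumes pair: "determining_pair B J"
    and \<phi>: "\<phi> \<in> mor Q" "B \<subseteq> Q"
    and w: "w \<in> W" "\<And>b. b \<in> B \<Longrightarrow> \<phi> b = w b"
    and norm: "\<And>x b. x \<in> Q \<Longrightarrow> b \<in> B \<Longrightarrow> conj_by G x b \<in> B"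
      "\<And>x j. x \<in> Q \<Longrightarrow> j \<in> J \<Longrightarrow> conj_by G x j \<in> J"
    and t: "t \<in> J" and x: "x \<in> Q" "conj_by G t x \<in> Q"
  shows "\<phi> (conj_by G t x) = conj_by G (w t) (\<phi> x)"
proof -
  note pair' = determining_pair_D[OF pair]
  have tT: "t \<in> T" "inv t \<in> J" "inv t \<in> T"
    using t pair'(2) subgroup.m_inv_closed[OF pair'(4) t] by auto
  have G: "t \<in> carrier G" "x \<in> carrier G" "\<phi> x \<in> carrier G" "w t \<in> carrier G"
    using T_carrier[OF tT(1)] F_carrier[OF \<phi>(1) x(1)] T_carrier[OF W_D(3)[OF w(1) tT(1)]] by auto
  define y where "y = conj_by G x (inv t)"
  have y: "y \<in> J" "y \<in> T"
    unfolding y_def using norm(2)[OF x(1) tT(2)] pair'(2) by auto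
  have ty: "t \<otimes> y \<in> J"
    using subgroup.m_closed[OF pair'(4) t y(1)] .
  have eq: "conj_by G t x = t \<otimes> y \<otimes> x"
    unfolding y_def conj_by_def using G by (simp add: m_assoc)
  have "t \<otimes> y = conj_by G t x \<otimes> inv x"
    unfolding eq using G T_carrier[OF y(2)] by (simp add: m_assoc)
  then have tyQ: "t \<otimes> y \<in> Q"
    using x subgroup.m_closed[OF F_D(1)[OF \<phi>(1)]] subgroup.m_inv_closed[OF F_D(1)[OF \<phi>(1)]] by metis
  have "\<phi> (conj_by G t x) = \<phi> (t \<otimes> y) \<otimes> \<phi> x"
    unfolding eq by (rule F_D(6)[OF \<phi>(1) tyQ x(1)])
  also have "\<phi> (t \<otimes> y) = w (t \<otimes> y)"
    by (rule agree_on_intersection[OF pair \<phi> w tyQ ty])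
  also have "\<dots> = w t \<otimes> w y"
    by (rule F_D(6)[OF w(1) tT(1) y(2)])
  also have "w y = conj_by G (\<phi> x) (w (inv t))"
    unfolding y_def by (rule W_equivariant[OF pair \<phi> w x(1) norm(1)[OF x(1)] tT(2)])
  also have "w (inv t) = inv (w t)"
    by (rule F_inv[OF w(1) tT(1)])
  also have "w t \<otimes> conj_by G (\<phi> x) (inv (w t)) \<otimes> \<phi> x = conj_by G (w t) (\<phi> x)"
    unfolding conj_by_def using G by (simp add: m_assoc)
  finally show ?thesis .
qed

text \<open>Both \<open>\<chi> : Q \<rightarrow> Q\<^sup>*\<close> and \<open>\<chi> \<phi>\<^sup>-\<^sup>1 : \<phi> ` Q \<rightarrow> Q\<^sup>*\<close>, with \<open>Q\<^sup>*\<close> fully centralized, extend to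
  \<open>t\<close> and \<open>w t\<close> respectively, and the extensions take the same value there.\<close>

lemma extension_step:
  assumes pair: "determining_pair B J" and B: "divisible B" "subgroup B G"
    and \<phi>: "\<phi> \<in> mor Q" "B \<subseteq> Q"
    and w: "w \<in> W" "\<And>b. b \<in> B \<Longrightarrow> \<phi> b = w b"
    and norm: "\<And>x b. x \<in> Q \<Longrightarrow> b \<in> B \<Longrightarrow> conj_by G x b \<in> B"
      "\<And>x j. x \<in> Q \<Longrightarrow> j \<in> J \<Longrightarrow> conj_by G x j \<in> J"
    and t: "t \<in> J" "conj_by G t ` Q = Q"
  shows "\<exists>X \<theta>. \<theta> \<in> mor X \<and> Q \<subseteq> X \<and> t \<in> X \<and> (\<forall>x\<in>Q. \<theta> x = \<phi> x)"
proof -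
  note pair' = determining_pair_D[OF pair]
  have Q: "subgroup Q G"
    by (rule F_D(1)[OF \<phi>(1)])
  have tT: "t \<in> T" "t \<in> carrier G"
    using t(1) pair'(2) T_carrier by auto
  have wtT: "w t \<in> T" "w t \<in> carrier G"
    using W_D(3)[OF w(1) tT(1)] T_carrier by auto
  obtain \<chi> where \<chi>: "\<chi> \<in> mor Q" "fully_centralized p G F (\<chi> ` Q)"
    using fully_centralized_exists[OF Q] by blast
  \<comment> \<open>The element \<open>v\<close> predicts the value that an extension of \<chi> must
    take at \<open>t\<close>.\<close>
  have "\<exists>v\<in>W. \<forall>x\<in>B. restrict \<chi> B x = v x"
  proof (rule W_extension)
    show mor: "restrict \<chi> B \<in> mor B"
      by (rule F_restrict[OF \<chi>(1) B(2) \<phi>(2)])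
    show "restrict \<chi> B ` B \<subseteq> T"
      by (rule image_divisible_T[OF mor order_refl B(1)])
  qed (rule pair'(3))
  then obtain v where v: "v \<in> W" "\<And>b. b \<in> B \<Longrightarrow> \<chi> b = v b"
    by auto
  have vt: "v t \<in> carrier G"
    by (rule T_carrier[OF W_D(3)[OF v(1) tT(1)]])
  have tx: "conj_by G t x \<in> Q" if "x \<in> Q" for x
    using t(2) that by blast
  have \<chi>t: "\<chi> (conj_by G t x) = conj_by G (v t) (\<chi> x)" if "x \<in> Q" for x
    by (rule normalizing_equivariant[OF pair \<chi>(1) \<phi>(2) v norm t(1) that tx[OF that]])
  have \<phi>t: "\<phi> (conj_by G t x) = conj_by G (w t) (\<phi> x)" if "x \<in> Q" for x
    by (rule normalizing_equivariant[OF pair \<phi> w norm t(1) that tx[OF that]])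
  let ?N = "N_phi G Q (\<chi> ` Q) \<chi>"
  have tN: "t \<in> ?N"
    by (rule mem_N_phi[OF \<chi>(1) tT(2) t(2) vt \<chi>t])
  have QN: "Q \<subseteq> ?N"
    by (rule subset_N_phi[OF \<chi>(1)])
  obtain \<psi> where \<psi>: "\<psi> \<in> mor ?N" "\<And>x. x \<in> Q \<Longrightarrow> \<psi> x = \<chi> x"
    using N_phi_extension[OF \<chi>] by blast
  have \<psi>_t: "\<psi> t = v t"
    by (rule agree_on_intersection[OF pair \<psi>(1) _ v(1) _ tN t(1)]) (use \<psi>(2) v(2) \<phi>(2) QN in auto)
  obtain \<phi>i where \<phi>i: "\<phi>i \<in> F (\<phi> ` Q) Q" "\<And>x. x \<in> Q \<Longrightarrow> \<phi>i (\<phi> x) = x"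
    using F_inverse_apply[OF \<phi>(1)] by blast
  define \<chi>' where "\<chi>' = compose (\<phi> ` Q) \<chi> \<phi>i"
  have \<chi>': "\<chi>' \<in> mor (\<phi> ` Q)" "\<And>x. x \<in> Q \<Longrightarrow> \<chi>' (\<phi> x) = \<chi> x"
    unfolding \<chi>'_def using F_comp[OF \<phi>i(1) \<chi>(1)] \<phi>i(2) by (auto simp: compose_def)
  have im: "\<chi>' ` \<phi> ` Q = \<chi> ` Q"
    using \<chi>'(2) by (simp add: image_image)
  let ?N' = "N_phi G (\<phi> ` Q) (\<chi>' ` \<phi> ` Q) \<chi>'"
  have tN': "w t \<in> ?N'"
  proof (rule mem_N_phi[OF \<chi>'(1) wtT(2) _ vt])
    have "conj_by G (w t) ` \<phi> ` Q = \<phi> ` conj_by G t ` Q"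
      using \<phi>t by (simp add: image_image)
    then show "conj_by G (w t) ` \<phi> ` Q = \<phi> ` Q"
      using t(2) by simp
    fix y assume "y \<in> \<phi> ` Q"
    then obtain x where x: "x \<in> Q" "y = \<phi> x"
      by blast
    then show "\<chi>' (conj_by G (w t) y) = conj_by G (v t) (\<chi>' y)"
      using \<phi>t[OF x(1)] \<chi>'(2)[OF x(1)] \<chi>'(2)[OF tx[OF x(1)]] \<chi>t[OF x(1)] by simp
  qed
  have QN': "\<phi> ` Q \<subseteq> ?N'"
    by (rule subset_N_phi[OF \<chi>'(1)])
  obtain \<psi>' where \<psi>': "\<psi>' \<in> mor ?N'" "\<And>x. x \<in> \<phi> ` Q \<Longrightarrow> \<psi>' x = \<chi>' x"
    using N_phi_extension[OF \<chi>'(1)] \<chi>(2) im by metis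
  have \<psi>'_\<phi>: "\<psi>' (\<phi> x) = \<psi> x" if "x \<in> Q" for x
    using that \<psi>(2) \<psi>'(2) \<chi>'(2) by simp
  obtain wi where wi: "wi \<in> W" "\<And>x. x \<in> T \<Longrightarrow> wi (w x) = x"
    using W_inverse[OF w(1)] by blast
  have "\<psi>' (w t) = compose T v wi (w t)"
  proof (rule agree_on_intersection[OF determining_pair_image[OF pair w(1)] \<psi>'(1) _ W_comp[OF v(1) wi(1)] _ tN'])
    show "w ` B \<subseteq> ?N'"
      using w(2) \<phi>(2) QN' by force
    show "w t \<in> w ` J"
      using t(1) by blast
    fix y assume "y \<in> w ` B"
    then obtain b where b: "b \<in> B" "y = w b"
      by blast
    have bT: "b \<in> T" and bQ: "b \<in> Q"
      using b(1) pair'(3) \<phi>(2) by auto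
    have "\<psi>' y = v b"
      using \<psi>'_\<phi>[OF bQ] \<psi>(2)[OF bQ] v(2)[OF b(1)] w(2)[OF b(1)] b(2) by simp
    then show "\<psi>' y = compose T v wi y"
      using wi(2)[OF bT] W_D(3)[OF w(1) bT] b(2) by (simp add: compose_def)
  qed
  then have \<psi>'_t: "\<psi>' (w t) = \<psi> t"
    using \<psi>_t wi(2)[OF tT(1)] wtT(1) by (simp add: compose_def)
  \<comment> \<open>The desired extension is \<psi>'^-1 \<psi>. Its domain contains \<open>Q\<close>
    and \<open>t\<close> because \<psi> and \<psi>' have matching values there.\<close>
  define X where "X = {x \<in> ?N. \<psi> x \<in> \<psi>' ` ?N'}"
  obtain \<theta> where \<theta>: "\<theta> \<in> mor X" "\<And>x. x \<in> X \<Longrightarrow> \<theta> x \<in> ?N' \<and> \<psi>' (\<theta> x) = \<psi> x"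
    using mor_pullback[OF \<psi>(1) \<psi>'(1)] unfolding X_def by blast
  have QX: "Q \<subseteq> X"
  proof
    fix x assume x: "x \<in> Q"
    then have "\<psi> x = \<psi>' (\<phi> x)" "\<phi> x \<in> ?N'" "x \<in> ?N"
      using \<psi>'_\<phi>[OF x] QN QN' by auto
    then show "x \<in> X"
      unfolding X_def by blast
  qed
  have tX: "t \<in> X"
    unfolding X_def using tN tN' \<psi>'_t by (metis (mono_tags, lifting) imageI mem_Collect_eq)
  have "\<theta> x = \<phi> x" if x: "x \<in> Q" for x
  proof -
    have "\<psi>' (\<theta> x) = \<psi>' (\<phi> x)" "\<theta> x \<in> ?N'" "\<phi> x \<in> ?N'"
      using \<theta>(2)[of x] QX QN' x \<psi>'_\<phi>[OF x] by auto
    then show ?thesis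
      using F_D(4)[OF \<psi>'(1)] by (auto dest: inj_onD)
  qed
  then show ?thesis
    using \<theta>(1) QX tX by blast
qed

lemma product_subgroup:
  assumes "subgroup P G" "subgroup J G" "\<And>x j. x \<in> P \<Longrightarrow> j \<in> J \<Longrightarrow> conj_by G x j \<in> J"
  shows "subgroup (P <#> J) G"
proof (rule subgroupI)
  have PG: "x \<in> carrier G" if "x \<in> P" for x
    using subgroup.mem_carrier[OF assms(1) that] .
  have JG: "x \<in> carrier G" if "x \<in> J" for x
    using subgroup.mem_carrier[OF assms(2) that] .
  show "P <#> J \<subseteq> carrier G"
    unfolding set_mult_def using PG JG by auto
  show "P <#> J \<noteq> {}"
    unfolding set_mult_def using subgroup.one_closed[OF assms(1)] subgroup.one_closed[OF assms(2)] by blast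
  show "inv a \<in> P <#> J" if "a \<in> P <#> J" for a
  proof -
    obtain x j where xj: "x \<in> P" "j \<in> J" "a = x \<otimes> j"
      using \<open>a \<in> P <#> J\<close> unfolding set_mult_def by blast
    have "inv a = inv x \<otimes> conj_by G x (inv j)"
      unfolding xj(3) conj_by_def using PG[OF xj(1)] JG[OF xj(2)] by (simp add: inv_mult_group flip: m_assoc)
    moreover have "inv x \<in> P" "conj_by G x (inv j) \<in> J"
      using subgroup.m_inv_closed[OF assms(1) xj(1)] assms(3)[OF xj(1) subgroup.m_inv_closed[OF assms(2) xj(2)]] by auto
    ultimately show ?thesis
      unfolding set_mult_def by blast
  qed
  show "a \<otimes> b \<in> P <#> J" if "a \<in> P <#> J" "b \<in> P <#> J" for a b
  proof -
    obtain x j y k where xj: "x \<in> P" "j \<in> J" "a = x \<otimes> j" "y \<in> P" "k \<in> J" "b = y \<otimes> k"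
      using \<open>a \<in> P <#> J\<close> \<open>b \<in> P <#> J\<close> unfolding set_mult_def by blast
    have yi: "inv y \<in> P"
      by (rule subgroup.m_inv_closed[OF assms(1) xj(4)])
    have "y \<otimes> (inv y \<otimes> (j \<otimes> (y \<otimes> k))) = j \<otimes> (y \<otimes> k)"
      using PG[OF xj(4)] JG[OF xj(2)] JG[OF xj(5)] by (simp flip: m_assoc)
    then have "a \<otimes> b = (x \<otimes> y) \<otimes> (conj_by G (inv y) j \<otimes> k)"
      unfolding xj(3,6) conj_by_def using PG[OF xj(1)] PG[OF xj(4)] JG[OF xj(2)] JG[OF xj(5)]
      by (simp add: m_assoc)
    moreover have "x \<otimes> y \<in> P" "conj_by G (inv y) j \<otimes> k \<in> J"
      using subgroup.m_closed[OF assms(1) xj(1,4)] subgroup.m_closed[OF assms(2) assms(3)[OF yi xj(2)] xj(5)] by auto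
    ultimately show ?thesis
      unfolding set_mult_def by blast
  qed
qed

text \<open>Normalizers grow in finite \<open>p\<close>-groups, but \<open>Q\<close> may be
  infinite. So take the finite group \<open>K\<close> generated by \<open>R\<close> and an element
  of \<open>J\<close> outside \<open>Q\<close>: some \<open>g\<close> in \<open>K - Q\<close>
  normalizes \<open>K \<inter> Q\<close>. Writing \<open>g = r \<otimes> t\<close> with
  \<open>r\<close> in \<open>R\<close>, the factor \<open>t\<close> of \<open>J\<close> still
  normalizes \<open>K \<inter> Q\<close>, which contains \<open>R\<close>. As \<open>t\<close>
  centralizes \<open>J\<close> and every element of \<open>Q\<close> is a product from
  \<open>R\<close> and \<open>Q \<inter> J\<close>, it normalizes \<open>Q\<close>.\<close>

lemma normalizing_element:
  assumes J: "subgroup J G" "J \<subseteq> T"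
    and Q: "subgroup Q G" and R: "finite R" "subgroup R G" "R \<subseteq> Q"
    and M: "subgroup (R <#> J) G" "Q \<subseteq> R <#> J" "Q \<noteq> R <#> J"
  shows "\<exists>t\<in>J - Q. conj_by G t ` Q = Q"
proof -
  have QG: "x \<in> carrier G" if "x \<in> Q" for x
    using subgroup.mem_carrier[OF Q that] .
  have JG: "x \<in> carrier G" if "x \<in> J" for x
    using subgroup.mem_carrier[OF J(1) that] .
  have decomp: "\<exists>r\<in>R. \<exists>j\<in>J. x = r \<otimes> j \<and> (x \<in> Q \<longleftrightarrow> j \<in> Q)" if "x \<in> R <#> J" for x
  proof -
    obtain r j where rj: "r \<in> R" "j \<in> J" "x = r \<otimes> j"
      using \<open>x \<in> R <#> J\<close> unfolding set_mult_def by blast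
    have rQ: "r \<in> Q"
      using rj(1) R(3) by blast
    have "j = inv r \<otimes> x"
      unfolding rj(3) using QG[OF rQ] JG[OF rj(2)] by (simp flip: m_assoc)
    then have "x \<in> Q \<longleftrightarrow> j \<in> Q"
      using rj(3) subgroup.m_closed[OF Q] subgroup.m_inv_closed[OF Q rQ] rQ by metis
    then show ?thesis
      using rj by blast
  qed
  obtain t0 where t0: "t0 \<in> J" "t0 \<notin> Q"
    using M(2,3) decomp by blast
  let ?K = "generate G (insert t0 R)"
  let ?H = "?K \<inter> Q"
  have gen: "insert t0 R \<subseteq> carrier G"
    using JG[OF t0(1)] subgroup.subset[OF R(2)] by blast
  have K: "subgroup ?K G" "finite ?K"
    using generate_is_subgroup[OF gen] finite_generate[OF _ gen] R(1) by auto
  have KM: "?K \<subseteq> R <#> J"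
  proof (rule generate_subgroup_incl[OF _ M(1)])
    have "t0 = \<one> \<otimes> t0"
      using JG[OF t0(1)] by simp
    then have "t0 \<in> R <#> J"
      unfolding set_mult_def using t0(1) subgroup.one_closed[OF R(2)] by blast
    then show "insert t0 R \<subseteq> R <#> J"
      using R(3) M(2) by blast
  qed
  have H: "subgroup ?H (G\<lparr>carrier := ?K\<rparr>)" "?H \<noteq> ?K" "subgroup ?H G"
  proof -
    show "subgroup ?H G"
      by (rule subgroups_Inter_pair[OF K(1) Q])
    then show "subgroup ?H (G\<lparr>carrier := ?K\<rparr>)"
      by (rule subgroup_incl[OF _ K(1)]) blast
    show "?H \<noteq> ?K"
      using t0(2) generate.incl[of t0 "insert t0 R" G] by blast
  qed
  interpret K: group "G\<lparr>carrier := ?K\<rparr>"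
    by (rule subgroup_imp_group[OF K(1)])
  have "\<exists>n::nat. x [^]\<^bsub>G\<lparr>carrier := ?K\<rparr>\<^esub> (p ^ n) = \<one>" if "x \<in> ?K" for x
    using torsion[OF subgroup.mem_carrier[OF K(1) that]] by (simp flip: nat_pow_consistent)
  then obtain k where k: "order (G\<lparr>carrier := ?K\<rparr>) = p ^ k"
    using K.exponent_imp_p_power_card[OF prime_p] K(2) by auto
  then obtain g where g: "g \<in> ?K" "g \<notin> Q" "conj_by (G\<lparr>carrier := ?K\<rparr>) g ` ?H \<subseteq> ?H"
    using K.normalizer_grows[OF prime_p _ k H(1)] K(2) H(2) by auto
  have gH: "conj_by G g x \<in> ?H" if "x \<in> ?H" for x
    using g(3) that conj_by_subgroup_consistent[OF K(1) g(1)] by auto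
  obtain r t where rt: "r \<in> R" "t \<in> J" "g = r \<otimes> t" "t \<notin> Q"
    using decomp[of g] KM g(1,2) by blast
  have rG: "r \<in> carrier G" and tG: "t \<in> carrier G"
    using QG R(3) rt(1) JG[OF rt(2)] by auto
  have rH: "inv r \<in> ?H" and RH: "R \<subseteq> ?H"
  proof -
    show RH: "R \<subseteq> ?H"
      using R(3) by (auto intro: generate.incl)
    show "inv r \<in> ?H"
      using subgroup.m_inv_closed[OF H(3)] RH rt(1) by blast
  qed
  have HG: "x \<in> carrier G" if "x \<in> ?H" for x
    using QG that by blast
  have tH: "conj_by G t x \<in> ?H" if x: "x \<in> ?H" for x
  proof -
    have "t = inv r \<otimes> g"
      unfolding rt(3) using rG tG by (simp flip: m_assoc)
    then have "conj_by G t x = conj_by G (inv r) (conj_by G g x)"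
      using rG HG[OF x] subgroup.mem_carrier[OF K(1) g(1)] by (simp add: conj_by_conj_by)
    then show ?thesis
      using conj_by_subgroup_eq[OF H(3) rH] gH[OF x] by blast
  qed
  have tH_eq: "conj_by G t ` ?H = ?H"
  proof (rule endo_inj_surj)
    show "finite ?H"
      using K(2) by blast
    show "conj_by G t ` ?H \<subseteq> ?H"
      using tH by blast
    show "inj_on (conj_by G t) ?H"
      by (rule inj_on_subset[OF inj_on_conj_by[OF tG]]) (use HG in blast)
  qed
  have tj: "conj_by G t j = j" if "j \<in> J" for j
    using conj_by_eq_iff_commute[OF tG JG[OF that]] T_comm J(2) rt(2) that by blast
  have "conj_by G t ` Q = Q"
  proof
    show "conj_by G t ` Q \<subseteq> Q"
    proof
      fix y assume "y \<in> conj_by G t ` Q"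
      then obtain x where x: "x \<in> Q" "y = conj_by G t x" by blast
      then obtain s j where sj: "s \<in> R" "j \<in> J" "x = s \<otimes> j" "j \<in> Q"
        using decomp[of x] M(2) by blast
      have "y = conj_by G t s \<otimes> j"
        unfolding x(2) sj(3) using conj_by_mult[OF tG HG JG[OF sj(2)], of s] tj[OF sj(2)] RH sj(1) by auto
      moreover have "conj_by G t s \<in> Q"
        using tH[of s] RH sj(1) by blast
      ultimately show "y \<in> Q"
        using subgroup.m_closed[OF Q _ sj(4)] by simp
    qed
    show "Q \<subseteq> conj_by G t ` Q"
    proof
      fix x assume x: "x \<in> Q"
      then obtain s j where sj: "s \<in> R" "j \<in> J" "x = s \<otimes> j" "j \<in> Q"
        using decomp[of x] M(2) by blast
      obtain h where h: "h \<in> ?H" "s = conj_by G t h"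
        using tH_eq RH sj(1) by blast
      have "x = conj_by G t (h \<otimes> j)"
        unfolding sj(3) h(2) using conj_by_mult[OF tG HG[OF h(1)] JG[OF sj(2)]] tj[OF sj(2)] by simp
      moreover have "h \<otimes> j \<in> Q"
        using h(1) sj(4) subgroup.m_closed[OF Q] by blast
      ultimately show "x \<in> conj_by G t ` Q"
        by blast
    qed
  qed
  then show ?thesis
    using rt(2,4) by blast
qed

end

section \<open>Countable generation\<close>

context saturated_fusion
begin

lemma mor_continuity:
  assumes "subgroup P G" "\<And>x. x \<in> P \<Longrightarrow> \<phi> x \<in> carrier G"
    and "\<And>x y. \<lbrakk>x \<in> P; y \<in> P\<rbrakk> \<Longrightarrow> \<phi> (x \<otimes> y) = \<phi> x \<otimes> \<phi> y" "inj_on \<phi> P"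
    and "\<And>R. \<lbrakk>subgroup R G; R \<subseteq> P; finite R\<rbrakk> \<Longrightarrow> restrict \<phi> R \<in> mor R"
  shows "restrict \<phi> P \<in> mor P"
proof -
  have "x \<otimes> y \<in> P" if "x \<in> P" "y \<in> P" for x y
    using subgroup.m_closed[OF assms(1) that] .
  then have "restrict \<phi> P \<in> inj_homs G P (carrier G)"
    unfolding inj_homs_def homs_def using assms(1-4) subgroup_self by (auto simp: hom_def)
  moreover have "restrict (restrict \<phi> P) R \<in> mor R" if "subgroup R G" "R \<subseteq> P" "finite R" for R
  proof -
    have "restrict (restrict \<phi> P) R = restrict \<phi> R"
      using \<open>R \<subseteq> P\<close> by (auto simp: restrict_def fun_eq_iff)
    then show ?thesis
      using assms(5)[OF that] by simp
  qed
  ultimately show ?thesis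
    using saturated unfolding saturated_def by blast
qed

text \<open>Zorn's lemma, applied to the subgroups of \<open>R J\<close> on which the only candidate
  \<open>r j \<mapsto> \<phi> r \<cdot> w j\<close> is a morphism.\<close>

lemma extension_to_product:
  assumes pair: "determining_pair B J" and B: "divisible B" "subgroup B G"
    and \<phi>: "\<phi> \<in> mor P" "B \<subseteq> P"
    and norm: "\<And>x b. x \<in> P \<Longrightarrow> b \<in> B \<Longrightarrow> conj_by G x b \<in> B"
      "\<And>x j. x \<in> P \<Longrightarrow> j \<in> J \<Longrightarrow> conj_by G x j \<in> J"
    and R: "finite R" "subgroup R G" "R \<subseteq> P" "P \<subseteq> R <#> J"
  shows "\<exists>\<Phi>\<in>mor (R <#> J). \<forall>x\<in>P. \<Phi> x = \<phi> x"
proof -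
  note pair' = determining_pair_D[OF pair]
  let ?M = "R <#> J"
  have P: "subgroup P G"
    by (rule F_D(1)[OF \<phi>(1)])
  have PG: "x \<in> carrier G" if "x \<in> P" for x
    using subgroup.mem_carrier[OF P that] .
  have JG: "x \<in> carrier G" and JT: "x \<in> T" if "x \<in> J" for x
    using subgroup.mem_carrier[OF pair'(4) that] pair'(2) that by auto
  have M: "subgroup ?M G"
    by (rule product_subgroup[OF R(2) pair'(4)]) (use norm(2) R(3) in blast)
  have "\<exists>w\<in>W. \<forall>x\<in>B. restrict \<phi> B x = w x"
  proof (rule W_extension)
    show mor: "restrict \<phi> B \<in> mor B"
      by (rule F_restrict[OF \<phi>(1) B(2) \<phi>(2)])
    show "restrict \<phi> B ` B \<subseteq> T"
      by (rule image_divisible_T[OF mor order_refl B(1)])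
  qed (rule pair'(3))
  then obtain w where w: "w \<in> W" "\<And>b. b \<in> B \<Longrightarrow> \<phi> b = w b"
    by auto
  have wG: "w j \<in> carrier G" if "j \<in> J" for j
    using T_carrier[OF W_D(3)[OF w(1) JT[OF that]]] .
  define \<Phi> where "\<Phi> x = (SOME y. \<exists>r j. r \<in> P \<and> j \<in> J \<and> x = r \<otimes> j \<and> y = \<phi> r \<otimes> w j)" for x
  \<comment> \<open>Two decompositions of an element differ by some \<open>c\<close> in
    \<open>P \<inter> J\<close>, and there \<phi> and \<open>w\<close> coincide.\<close>
  have unique: "\<phi> r \<otimes> w j = \<phi> s \<otimes> w k"
    if "r \<in> P" "j \<in> J" "s \<in> P" "k \<in> J" "r \<otimes> j = s \<otimes> k" for r j s k
  proof -
    define c where "c = inv s \<otimes> r"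
    have G: "r \<in> carrier G" "s \<in> carrier G" "j \<in> carrier G" "k \<in> carrier G"
      using PG JG that by auto
    have si: "inv s \<in> P" and ji: "inv j \<in> J"
      using subgroup.m_inv_closed[OF P that(3)] subgroup.m_inv_closed[OF pair'(4) that(2)] by auto
    have cP: "c \<in> P"
      unfolding c_def by (rule subgroup.m_closed[OF P si that(1)])
    have "c \<otimes> j = k"
      unfolding c_def using that(5) G by (metis inv_closed inv_solve_left m_assoc m_closed)
    then have ck: "c = k \<otimes> inv j"
      using G PG[OF cP] by (metis inv_solve_right)
    have cJ: "c \<in> J"
      unfolding ck by (rule subgroup.m_closed[OF pair'(4) that(4) ji])
    have "s \<otimes> c = r"
      unfolding c_def using G by (simp flip: m_assoc)
    then have "\<phi> r = \<phi> s \<otimes> \<phi> c"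
      using F_D(6)[OF \<phi>(1) that(3) cP] by simp
    also have "\<phi> c = w c"
      by (rule agree_on_intersection[OF pair \<phi> w cP cJ])
    finally have "\<phi> r \<otimes> w j = \<phi> s \<otimes> (w c \<otimes> w j)"
      using F_carrier(2)[OF \<phi>(1) that(3)] wG[OF cJ] wG[OF that(2)] by (simp add: m_assoc)
    also have "w c \<otimes> w j = w k"
      using F_D(6)[OF w(1) JT[OF cJ] JT[OF that(2)]] \<open>c \<otimes> j = k\<close> by simp
    finally show ?thesis .
  qed
  have \<Phi>: "\<Phi> (r \<otimes> j) = \<phi> r \<otimes> w j" if "r \<in> P" "j \<in> J" for r j
    unfolding \<Phi>_def
  proof (rule some_equality)
    fix y assume "\<exists>r' j'. r' \<in> P \<and> j' \<in> J \<and> r \<otimes> j = r' \<otimes> j' \<and> y = \<phi> r' \<otimes> w j'"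
    then obtain r' j' where "r' \<in> P" "j' \<in> J" "r \<otimes> j = r' \<otimes> j'" "y = \<phi> r' \<otimes> w j'"
      by blast
    then show "y = \<phi> r \<otimes> w j"
      using unique[OF that, of r' j'] by simp
  qed (use that in blast)
  have \<Phi>_P: "\<Phi> x = \<phi> x" if "x \<in> P" for x
    using \<Phi>[OF that subgroup.one_closed[OF pair'(4)]] F_one[OF w(1)] PG[OF that] F_carrier(2)[OF \<phi>(1) that]
    by simp
  have \<Phi>_J: "\<Phi> j = w j" if "j \<in> J" for j
    using \<Phi>[OF subgroup.one_closed[OF P] that] F_one[OF \<phi>(1)] JG[OF that] wG[OF that] by simp
  define \<Q> where "\<Q> = {Q. subgroup Q G \<and> P \<subseteq> Q \<and> Q \<subseteq> ?M \<and> restrict \<Phi> Q \<in> mor Q}"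
  have "\<exists>Q\<in>\<Q>. \<forall>X\<in>\<Q>. Q \<subseteq> X \<longrightarrow> X = Q"
  proof (rule subset_Zorn_nonempty)
    have "restrict \<Phi> P = \<phi>"
      using \<Phi>_P F_D(3)[OF \<phi>(1)] by (auto simp: restrict_def extensional_def fun_eq_iff)
    then have "P \<in> \<Q>"
      unfolding \<Q>_def using P R(4) \<phi>(1) by simp
    then show "\<Q> \<noteq> {}" by blast
  next
    fix \<C> assume \<C>: "\<C> \<noteq> {}" "subset.chain \<Q> \<C>"
    have sub: "subgroup Q G" "P \<subseteq> Q" "Q \<subseteq> ?M" "restrict \<Phi> Q \<in> mor Q" if "Q \<in> \<C>" for Q
      using \<C>(2) that unfolding \<Q>_def subset_chain_def by auto
    have pair_in: "\<exists>Q\<in>\<C>. x \<in> Q \<and> y \<in> Q" if "x \<in> \<Union>\<C>" "y \<in> \<Union>\<C>" for x y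
      using that \<C>(2) unfolding subset_chain_def by blast
    have U: "subgroup (\<Union>\<C>) G"
    proof (rule subgroupI)
      show "\<Union>\<C> \<subseteq> carrier G"
        using subgroup.subset[OF sub(1)] by blast
      show "\<Union>\<C> \<noteq> {}"
        using \<C>(1) subgroup.one_closed[OF sub(1)] by blast
      show "inv x \<in> \<Union>\<C>" if "x \<in> \<Union>\<C>" for x
        using that subgroup.m_inv_closed[OF sub(1)] by blast
      show "x \<otimes> y \<in> \<Union>\<C>" if "x \<in> \<Union>\<C>" "y \<in> \<Union>\<C>" for x y
        using pair_in[OF that] subgroup.m_closed[OF sub(1)] by blast
    qed
    \<comment> \<open>A finite subgroup of the union lies in one member of the chain, so the
      continuity axiom applies.\<close>
    have "restrict \<Phi> (\<Union>\<C>) \<in> mor (\<Union>\<C>)"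
    proof (rule mor_continuity[OF U])
      show "\<Phi> x \<in> carrier G" if "x \<in> \<Union>\<C>" for x
      proof -
        obtain Q where Q: "Q \<in> \<C>" "x \<in> Q"
          using \<open>x \<in> \<Union>\<C>\<close> by blast
        then show ?thesis
          using F_carrier(2)[OF sub(4)[OF Q(1)] Q(2)] by simp
      qed
      show "\<Phi> (x \<otimes> y) = \<Phi> x \<otimes> \<Phi> y" if xy: "x \<in> \<Union>\<C>" "y \<in> \<Union>\<C>" for x y
      proof -
        obtain Q where Q: "Q \<in> \<C>" "x \<in> Q" "y \<in> Q"
          using pair_in[OF xy] by blast
        then show ?thesis
          using F_D(6)[OF sub(4)[OF Q(1)] Q(2,3)] subgroup.m_closed[OF sub(1)[OF Q(1)] Q(2,3)] by simp
      qed
      show "inj_on \<Phi> (\<Union>\<C>)"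
      proof (rule inj_onI)
        fix x y assume xy: "x \<in> \<Union>\<C>" "y \<in> \<Union>\<C>" "\<Phi> x = \<Phi> y"
        obtain Q where Q: "Q \<in> \<C>" "x \<in> Q" "y \<in> Q"
          using pair_in[OF xy(1,2)] by blast
        then show "x = y"
          using F_D(4)[OF sub(4)[OF Q(1)]] xy(3) by (auto dest: inj_onD)
      qed
      fix X assume X: "subgroup X G" "X \<subseteq> \<Union>\<C>" "finite X"
      obtain Q where Q: "Q \<in> \<C>" "X \<subseteq> Q"
        using finite_subset_Union_chain[OF X(3,2) \<C>] by blast
      have "restrict (restrict \<Phi> Q) X = restrict \<Phi> X"
        using Q(2) by (auto simp: restrict_def fun_eq_iff)
      then show "restrict \<Phi> X \<in> mor X"
        using F_restrict[OF sub(4)[OF Q(1)] X(1) Q(2)] by simp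
    qed
    then show "\<Union>\<C> \<in> \<Q>"
      unfolding \<Q>_def using U sub(2,3) \<C>(1) by blast
  qed
  then obtain Q where "Q \<in> \<Q>" and max: "\<And>X. X \<in> \<Q> \<Longrightarrow> Q \<subseteq> X \<Longrightarrow> X = Q"
    by blast
  then have Q: "subgroup Q G" "P \<subseteq> Q" "Q \<subseteq> ?M" "restrict \<Phi> Q \<in> mor Q"
    unfolding \<Q>_def by auto
  have "Q = ?M"
  proof (rule ccontr)
    assume "Q \<noteq> ?M"
    then obtain t where t: "t \<in> J" "t \<notin> Q" "conj_by G t ` Q = Q"
      using normalizing_element[OF pair'(4,2) Q(1) R(1,2) _ M Q(3)] R(3) Q(2) by blast
    have BQ: "B \<subseteq> Q"
      using \<phi>(2) Q(2) by blast
    have wB: "restrict \<Phi> Q b = w b" if "b \<in> B" for b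
      using \<Phi>_J[of b] pair'(1) that BQ by auto
    have conj: "conj_by G x y = conj_by G r (conj_by G j y)"
      if "r \<in> P" "j \<in> J" "x = r \<otimes> j" "y \<in> J" for x y r j
      using that PG JG by (simp add: conj_by_conj_by)
    have decomp: "\<exists>r\<in>P. \<exists>j\<in>J. x = r \<otimes> j" if "x \<in> ?M" for x
      using that R(3) unfolding set_mult_def by blast
    have fixJ: "conj_by G j y = y" if "j \<in> J" "y \<in> J" for j y
      using conj_by_eq_iff_commute[OF JG[OF that(1)] JG[OF that(2)]] T_comm[OF JT[OF that(1)] JT[OF that(2)]]
      by blast
    \<comment> \<open>The factor from \<open>J\<close> acts trivially on \<open>J\<close>, so
      \<open>Q\<close> acts on \<open>J\<close> through \<open>P\<close> and the normalization
      hypotheses carry over.\<close>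
    have normM: "\<exists>r\<in>P. \<forall>y\<in>J. conj_by G x y = conj_by G r y" if "x \<in> Q" for x
    proof -
      obtain r j where "r \<in> P" "j \<in> J" "x = r \<otimes> j"
        using decomp[of x] \<open>x \<in> Q\<close> Q(3) by blast
      then show ?thesis
        using conj[of r j x] fixJ[of j] by (intro bexI[of _ r]) auto
    qed
    have "\<exists>X \<theta>. \<theta> \<in> mor X \<and> Q \<subseteq> X \<and> t \<in> X \<and> (\<forall>x\<in>Q. \<theta> x = restrict \<Phi> Q x)"
    proof (rule extension_step[OF pair B Q(4) BQ w(1) wB _ _ t(1,3)])
      show "conj_by G x b \<in> B" if "x \<in> Q" "b \<in> B" for x b
        using normM[OF that(1)] norm(1) that(2) pair'(1) by (metis subsetD)
      show "conj_by G x j \<in> J" if "x \<in> Q" "j \<in> J" for x j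
        using normM[OF that(1)] norm(2) that(2) by metis
    qed
    then obtain X \<theta> where X: "\<theta> \<in> mor X" "Q \<subseteq> X" "t \<in> X" "\<And>x. x \<in> Q \<Longrightarrow> \<theta> x = \<Phi> x"
      by auto
    \<comment> \<open>The domain of \<theta> may leave \<open>R <#> J\<close>. On the intersection
      rigidity forces \<theta> to be the candidate \<Phi>, which contradicts maximality of
      \<open>Q\<close>.\<close>
    let ?X = "X \<inter> ?M"
    have subX: "subgroup ?X G"
      by (rule subgroups_Inter_pair[OF F_D(1)[OF X(1)] M])
    have "\<theta> x = \<Phi> x" if x: "x \<in> ?X" for x
    proof -
      obtain r j where rj: "r \<in> P" "j \<in> J" "x = r \<otimes> j"
        using decomp[of x] x by blast
      have rX: "r \<in> X"
        using rj(1) Q(2) X(2) by blast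
      have "j = inv r \<otimes> x"
        unfolding rj(3) using PG[OF rj(1)] JG[OF rj(2)] by (simp flip: m_assoc)
      then have jX: "j \<in> X"
        using subgroup.m_closed[OF F_D(1)[OF X(1)] subgroup.m_inv_closed[OF F_D(1)[OF X(1)] rX], of x] x by simp
      have "\<theta> b = w b" if "b \<in> B" for b
        using X(4)[of b] wB[OF that] BQ that by auto
      then have "\<theta> j = w j"
        using agree_on_intersection[OF pair X(1) _ w(1) _ jX rj(2)] BQ X(2) by blast
      moreover have "\<theta> r = \<phi> r"
        using X(4)[of r] \<Phi>_P[OF rj(1)] rj(1) Q(2) by auto
      ultimately show ?thesis
        using F_D(6)[OF X(1) rX jX] \<Phi>[OF rj(1,2)] rj(3) by simp
    qed
    then have "restrict \<Phi> ?X = restrict \<theta> ?X"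
      by (auto simp: restrict_def fun_eq_iff)
    then have "restrict \<Phi> ?X \<in> mor ?X"
      using F_restrict[OF X(1) subX] by simp
    then have "?X \<in> \<Q>"
      unfolding \<Q>_def using subX Q(2,3) X(2) by blast
    then have "?X = Q"
      using max Q(3) X(2) by blast
    moreover have "t \<in> ?M"
    proof -
      have "t = \<one> \<otimes> t"
        using JG[OF t(1)] by simp
      then show ?thesis
        unfolding set_mult_def using subgroup.one_closed[OF R(2)] t(1) by blast
    qed
    ultimately show False
      using X(3) t(2) by blast
  qed
  then have "restrict \<Phi> ?M \<in> mor ?M"
    using Q(4) by simp
  moreover have "\<forall>x\<in>P. restrict \<Phi> ?M x = \<phi> x"
    using \<Phi>_P R(4) by auto
  ultimately show ?thesis
    by blast
qed

section \<open>The finitely many groups \<open>J\<close>\<close>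

text \<open>With \<open>V\<close> the pointwise stabilizer of \<open>B\<close> in \<open>W\<close>
  this is the group \<open>J\<close>. Indexing by \<open>V\<close> instead of \<open>B\<close> makes
  it visible that only finitely many groups occur.\<close>

definition fixed_part :: "('a \<Rightarrow> 'a) set \<Rightarrow> 'a set" where
  "fixed_part V = divpart {t \<in> T. \<forall>f\<in>V. f t = t}"

lemma fixed_part_props:
  assumes "V \<subseteq> W"
  shows "subgroup (fixed_part V) G" "fixed_part V \<subseteq> T" "divisible (fixed_part V)"
    and "\<And>f t. \<lbrakk>f \<in> V; t \<in> fixed_part V\<rbrakk> \<Longrightarrow> f t = t"
proof -
  let ?A = "{t \<in> T. \<forall>f\<in>V. f t = t}"
  have "subgroup ?A G"
  proof (rule subgroupI)
    show "?A \<subseteq> carrier G"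
      using T_carrier by blast
    have "\<one> \<in> ?A"
      using F_one assms subgroup.one_closed[OF T_subgroup] by blast
    then show "?A \<noteq> {}"
      by blast
    show "inv x \<in> ?A" if "x \<in> ?A" for x
    proof -
      have "f (inv x) = inv x" if "f \<in> V" for f
        using F_inv[OF subsetD[OF assms that], of x] \<open>x \<in> ?A\<close> that by auto
      then show ?thesis
        using that subgroup.m_inv_closed[OF T_subgroup] by blast
    qed
    show "x \<otimes> y \<in> ?A" if "x \<in> ?A" "y \<in> ?A" for x y
    proof -
      have "f (x \<otimes> y) = x \<otimes> y" if "f \<in> V" for f
      proof -
        have "x \<in> T" "y \<in> T" "f x = x" "f y = y"
          using \<open>x \<in> ?A\<close> \<open>y \<in> ?A\<close> that by auto
        then show ?thesis
          using F_D(6)[OF subsetD[OF assms that], of x y] by simp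
      qed
      then show ?thesis
        using that subgroup.m_closed[OF T_subgroup] by blast
    qed
  qed
  then show "subgroup (fixed_part V) G"
    unfolding fixed_part_def by (rule divpart_subgroup) blast
  show "fixed_part V \<subseteq> T" "divisible (fixed_part V)"
    "\<And>f t. \<lbrakk>f \<in> V; t \<in> fixed_part V\<rbrakk> \<Longrightarrow> f t = t"
    unfolding fixed_part_def using divpart_subset divpart_divisible by blast+
qed

lemma divisible_conj:
  assumes "g \<in> carrier G" "subgroup D G" "divisible D"
  shows "divisible (conj_by G g ` D)"
proof -
  have "restrict (conj_by G g) D \<in> mor D"
    using assms subgroup.mem_carrier[OF assms(2)] by (intro F_conj subgroup_self) auto
  then have "divisible (restrict (conj_by G g) D ` D)"
    using image_divisible assms(3) by blast
  then show ?thesis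
    by simp
qed

text \<open>A conjugate of the divisible part is a divisible subgroup of
  \<open>P \<inter> T\<close>, hence inside the largest one.\<close>

lemma conj_divpart:
  assumes P: "subgroup P G" and x: "x \<in> P" and b: "b \<in> divpart (P \<inter> T)"
  shows "conj_by G x b \<in> divpart (P \<inter> T)"
proof -
  let ?B = "divpart (P \<inter> T)"
  have xG: "x \<in> carrier G"
    by (rule subgroup.mem_carrier[OF P x])
  have B: "subgroup ?B G"
    by (rule divpart_subgroup[OF subgroups_Inter_pair[OF P T_subgroup]]) blast
  have "conj_by G x ` ?B \<subseteq> P \<inter> T"
  proof
    fix y assume "y \<in> conj_by G x ` ?B"
    then obtain c where "c \<in> P" "c \<in> T" "y = conj_by G x c"
      using divpart_subset by blast
    then show "y \<in> P \<inter> T"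
      using conj_by_subgroup_eq[OF P x] T_conj[OF xG] by blast
  qed
  then have "conj_by G x ` ?B \<subseteq> ?B"
    by (rule divpart_greatest[OF divisible_conj[OF xG B divpart_divisible]])
  then show ?thesis
    using b by blast
qed

text \<open>If \<open>u\<close> and \<open>v\<close> agree on \<open>B\<close>, then
  \<open>u\<close>^-1 \<open>v\<close> stabilizes \<open>B\<close> pointwise and so fixes
  \<open>J\<close>. \<open>B\<close> lies in \<open>J\<close> because it is divisible and consists
  of fixed points.\<close>

lemma determining_pair_fixed_part:
  assumes "B \<subseteq> T" "subgroup B G" "divisible B"
  shows "determining_pair B (fixed_part {f \<in> W. \<forall>b\<in>B. f b = b})"
proof -
  let ?V = "{f \<in> W. \<forall>b\<in>B. f b = b}"
  note J = fixed_part_props[of ?V]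
  have "B \<subseteq> fixed_part ?V"
    unfolding fixed_part_def by (rule divpart_greatest[OF assms(3)]) (use assms(1) in blast)
  moreover have "determines B (fixed_part ?V)"
    unfolding determines_def
  proof (intro ballI impI)
    fix u v j assume uv: "u \<in> W" "v \<in> W" "\<forall>b\<in>B. u b = v b" and j: "j \<in> fixed_part ?V"
    obtain ui where ui: "ui \<in> W" "\<And>x. x \<in> T \<Longrightarrow> ui (u x) = x" "\<And>x. x \<in> T \<Longrightarrow> u (ui x) = x"
      using W_inverse[OF uv(1)] by blast
    have jT: "j \<in> T"
      using J(2) j by blast
    have "compose T ui v b = b" if "b \<in> B" for b
      using uv(3) that ui(2)[of b] assms(1) by (auto simp: compose_def)
    then have "compose T ui v \<in> ?V"
      using W_comp[OF ui(1) uv(2)] by blast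
    then have "compose T ui v j = j"
      using J(4)[OF _ _ j] by blast
    then show "u j = v j"
      using jT ui(3)[OF W_D(3)[OF uv(2) jT]] by (simp add: compose_def)
  qed
  ultimately show ?thesis
    unfolding determining_pair_def using J by blast
qed

text \<open>For \<open>f\<close> in the stabilizer, \<open>f c_x\<close> and \<open>c_x\<close>
  agree on \<open>B\<close>, hence on \<open>J\<close>. So the conjugate of \<open>J\<close> is
  again fixed by the stabilizer, and it is divisible.\<close>

lemma conj_fixed_part:
  assumes B: "B \<subseteq> T" "subgroup B G" "divisible B"
    and x: "x \<in> carrier G" "\<And>b. b \<in> B \<Longrightarrow> conj_by G x b \<in> B"
    and j: "j \<in> fixed_part {f \<in> W. \<forall>b\<in>B. f b = b}"
  shows "conj_by G x j \<in> fixed_part {f \<in> W. \<forall>b\<in>B. f b = b}"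
proof -
  let ?V = "{f \<in> W. \<forall>b\<in>B. f b = b}"
  let ?J = "fixed_part ?V"
  note pair = determining_pair_D[OF determining_pair_fixed_part[OF B]]
  let ?c = "restrict (conj_by G x) T"
  have c: "?c \<in> W"
    by (rule W_conj[OF x(1)])
  have "f (conj_by G x i) = conj_by G x i" if f: "f \<in> ?V" and i: "i \<in> ?J" for f i
  proof -
    have iT: "i \<in> T"
      using i pair(2) by blast
    have "compose T f ?c i = ?c i"
      by (rule determines_D[OF pair(6) W_comp[OF _ c] c _ i]) (use f x(2) B(1) in \<open>auto simp: compose_def\<close>)
    then show ?thesis
      using iT by (simp add: compose_def)
  qed
  then have "conj_by G x ` ?J \<subseteq> {t \<in> T. \<forall>f\<in>?V. f t = t}"
    using T_conj[OF x(1)] pair(2) by blast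
  then have "conj_by G x ` ?J \<subseteq> ?J"
    using divpart_greatest[OF divisible_conj[OF x(1) pair(4,5)]] unfolding fixed_part_def by blast
  then show ?thesis
    using j by blast
qed

text \<open>Representatives modulo \<open>P \<inter> T\<close> and modulo its divisible part form a
  finite set; the subgroup it generates is finite.\<close>

lemma cofinite_product:
  assumes P: "subgroup P G"
  shows "\<exists>R. finite R \<and> subgroup R G \<and> R \<subseteq> P \<and> P \<subseteq> R <#> divpart (P \<inter> T)"
proof -
  let ?B = "divpart (P \<inter> T)"
  have PG: "x \<in> carrier G" if "x \<in> P" for x
    using subgroup.mem_carrier[OF P that] .
  have A: "subgroup (P \<inter> T) G"
    by (rule subgroups_Inter_pair[OF P T_subgroup])
  have B: "subgroup ?B G" "?B \<subseteq> P \<inter> T"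
    using divpart_subgroup[OF A] divpart_subset by auto
  obtain R0 where R0: "finite R0" "R0 \<subseteq> P" "\<forall>c\<in>P. \<exists>d\<in>P \<inter> T. \<exists>r\<in>R0. c = d \<otimes> r"
    using coset_representatives[OF P] by blast
  obtain E where E: "finite E" "E \<subseteq> P \<inter> T" "\<forall>a\<in>P \<inter> T. \<exists>u\<in>?B. \<exists>e\<in>E. a = u \<otimes> e"
    using divpart_cofinite[OF A] by blast
  let ?R = "generate G (E \<union> R0)"
  have sub: "E \<union> R0 \<subseteq> P" "E \<union> R0 \<subseteq> carrier G"
    using E(2) R0(2) PG by blast+
  have R: "finite ?R" "subgroup ?R G" "?R \<subseteq> P"
    using finite_generate[OF _ sub(2)] E(1) R0(1) generate_is_subgroup[OF sub(2)]
      generate_subgroup_incl[OF sub(1) P] by auto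
  have "P \<subseteq> ?R <#> ?B"
  proof
    fix x assume x: "x \<in> P"
    obtain d r where dr: "d \<in> P \<inter> T" "r \<in> R0" "x = d \<otimes> r"
      using R0(3) x by blast
    obtain u e where ue: "u \<in> ?B" "e \<in> E" "d = u \<otimes> e"
      using E(3) dr(1) by blast
    define s where "s = e \<otimes> r"
    have "e \<in> ?R" "r \<in> ?R"
      using ue(2) dr(2) by (auto intro: generate.incl)
    then have s: "s \<in> ?R" "inv s \<in> ?R"
      unfolding s_def using subgroup.m_closed[OF R(2)] subgroup.m_inv_closed[OF R(2)] by blast+
    have G: "s \<in> carrier G" "u \<in> carrier G" "e \<in> carrier G" "r \<in> carrier G"
      using PG R(3) s(1) B(2) ue(1,2) E(2) dr(2) R0(2) by blast+
    \<comment> \<open>The factor in the divisible part, which is normalized by \<open>P\<close>, is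
      moved to the right.\<close>
    have "s \<otimes> conj_by G (inv s) u = u \<otimes> s"
      unfolding conj_by_def using G(1,2) by (simp flip: m_assoc)
    also have "\<dots> = x"
      unfolding s_def dr(3) ue(3) using G by (simp add: m_assoc)
    finally have "x = s \<otimes> conj_by G (inv s) u" ..
    moreover have "conj_by G (inv s) u \<in> ?B"
      using conj_divpart[OF P _ ue(1)] s(2) R(3) by blast
    ultimately show "x \<in> ?R <#> ?B"
      unfolding set_mult_def using s(1) by blast
  qed
  then show ?thesis
    using R by blast
qed

text \<open>The new domain depends on \<open>P\<close> only through the finite group
  \<open>R\<close> and the subset \<open>V\<close> of \<open>W\<close>; this is what makes the
  domains countable in number.\<close>

lemma mor_extends_to_fixed_part:
  assumes \<phi>: "\<phi> \<in> mor P"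
  shows "\<exists>R V \<Phi>. finite R \<and> subgroup R G \<and> V \<subseteq> W \<and> \<Phi> \<in> mor (R <#> fixed_part V) \<and>
    P \<subseteq> R <#> fixed_part V \<and> (\<forall>x\<in>P. \<Phi> x = \<phi> x)"
proof -
  let ?B = "divpart (P \<inter> T)"
  let ?V = "{f \<in> W. \<forall>b\<in>?B. f b = b}"
  let ?J = "fixed_part ?V"
  have P: "subgroup P G"
    by (rule F_D(1)[OF \<phi>])
  have B: "subgroup ?B G" "?B \<subseteq> P" "?B \<subseteq> T"
    using divpart_subgroup[OF subgroups_Inter_pair[OF P T_subgroup]] divpart_subset[of "P \<inter> T"] by auto
  note pair = determining_pair_fixed_part[OF B(3,1) divpart_divisible]
  note norm = conj_divpart[OF P]
  have normJ: "conj_by G x j \<in> ?J" if "x \<in> P" "j \<in> ?J" for x j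
    by (rule conj_fixed_part[OF B(3,1) divpart_divisible subgroup.mem_carrier[OF P that(1)] norm[OF that(1)] that(2)])
  obtain R where R: "finite R" "subgroup R G" "R \<subseteq> P" "P \<subseteq> R <#> ?B"
    using cofinite_product[OF P] by blast
  have "R <#> ?B \<subseteq> R <#> ?J"
    unfolding set_mult_def using determining_pair_D(1)[OF pair] by blast
  then have RJ: "P \<subseteq> R <#> ?J"
    using R(4) by blast
  obtain \<Phi> where "\<Phi> \<in> mor (R <#> ?J)" "\<forall>x\<in>P. \<Phi> x = \<phi> x"
    using extension_to_product[OF pair divpart_divisible B(1) \<phi> B(2) norm normJ R(1-3) RJ] by blast
  then show ?thesis
    by (intro exI[of _ R] exI[of _ ?V] exI[of _ \<Phi>]) (use R(1,2) RJ in blast)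
qed

section \<open>Counting the morphisms on the enlarged domains\<close>

lemma countable_carrier: "countable (carrier G)"
proof -
  have "T = (\<Union>n. {x \<in> T. x [^] (p ^ n :: nat) = \<one>})"
    using T_torsion by blast
  moreover have "countable (\<Union>n. {x \<in> T. x [^] (p ^ n :: nat) = \<one>})"
    by (rule countable_UN) (auto intro: countable_finite T_finite)
  ultimately have T: "countable T"
    by simp
  obtain R where R: "finite R" "\<forall>c\<in>carrier G. \<exists>d\<in>carrier G \<inter> T. \<exists>r\<in>R. c = d \<otimes> r"
    using coset_representatives[OF subgroup_self] by blast
  have "carrier G \<subseteq> (\<lambda>(d, r). d \<otimes> r) ` (T \<times> R)"
    using R(2) by fastforce
  then show ?thesis
    using T R(1) by (meson countable_SIGMA countable_finite countable_image countable_subset)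
qed

lemma countable_mor_product:
  assumes "finite R" "subgroup R G" "V \<subseteq> W"
  shows "countable (mor (R <#> fixed_part V))"
proof -
  let ?J = "fixed_part V"
  note J = fixed_part_props[OF assms(3)]
  have RG: "x \<in> carrier G" if "x \<in> R" for x
    using subgroup.mem_carrier[OF assms(2) that] .
  have JG: "x \<in> carrier G" if "x \<in> ?J" for x
    using subgroup.mem_carrier[OF J(1) that] .
  have "r \<otimes> \<one> \<in> R <#> ?J" "\<one> \<otimes> j \<in> R <#> ?J" if "r \<in> R" "j \<in> ?J" for r j
    unfolding set_mult_def using that subgroup.one_closed[OF J(1)] subgroup.one_closed[OF assms(2)] by blast+
  then have sub: "R \<subseteq> R <#> ?J" "?J \<subseteq> R <#> ?J"
    using RG JG subgroup.one_closed[OF J(1)] subgroup.one_closed[OF assms(2)] by auto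
  \<comment> \<open>\<open>w \<Phi>\<close> is an arbitrary choice; for injectivity of the code it
    is enough that equal choices imply equal restrictions to \<open>fixed_part V\<close>.\<close>
  define w where "w \<Phi> = (SOME w. w \<in> W \<and> (\<forall>j\<in>?J. \<Phi> j = w j))" for \<Phi>
  have w: "w \<Phi> \<in> W \<and> (\<forall>j\<in>?J. \<Phi> j = w \<Phi> j)" if \<Phi>: "\<Phi> \<in> mor (R <#> ?J)" for \<Phi>
  proof -
    have "\<exists>u\<in>W. \<forall>x\<in>?J. restrict \<Phi> ?J x = u x"
    proof (rule W_extension)
      show mor: "restrict \<Phi> ?J \<in> mor ?J"
        by (rule F_restrict[OF \<Phi> J(1) sub(2)])
      show "restrict \<Phi> ?J ` ?J \<subseteq> T"
        by (rule image_divisible_T[OF mor order_refl J(3)])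
    qed (rule J(2))
    then have "\<exists>u. u \<in> W \<and> (\<forall>j\<in>?J. \<Phi> j = u j)"
      by auto
    then show ?thesis
      unfolding w_def by (rule someI_ex)
  qed
  obtain rs where rs: "set rs = R"
    using finite_list[OF assms(1)] by blast
  let ?code = "\<lambda>\<Phi>. (map \<Phi> rs, w \<Phi>)"
  have "inj_on ?code (mor (R <#> ?J))"
  proof (rule inj_onI)
    fix \<Phi> \<Psi> assume \<Phi>: "\<Phi> \<in> mor (R <#> ?J)" and \<Psi>: "\<Psi> \<in> mor (R <#> ?J)" and eq: "?code \<Phi> = ?code \<Psi>"
    have R: "\<Phi> r = \<Psi> r" if "r \<in> R" for r
      using eq that rs by auto
    have J: "\<Phi> j = \<Psi> j" if "j \<in> ?J" for j
      using eq w[OF \<Phi>] w[OF \<Psi>] that by auto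
    show "\<Phi> = \<Psi>"
    proof (rule extensionalityI[OF F_D(3)[OF \<Phi>] F_D(3)[OF \<Psi>]])
      fix x assume "x \<in> R <#> ?J"
      then obtain r j where rj: "r \<in> R" "j \<in> ?J" "x = r \<otimes> j"
        unfolding set_mult_def by blast
      then have "r \<in> R <#> ?J" "j \<in> R <#> ?J"
        using sub by auto
      then show "\<Phi> x = \<Psi> x"
        unfolding rj(3) using F_D(6)[OF \<Phi>, of r j] F_D(6)[OF \<Psi>, of r j] R[OF rj(1)] J[OF rj(2)] by simp
    qed
  qed
  moreover have "?code ` mor (R <#> ?J) \<subseteq> lists (carrier G) \<times> W"
  proof -
    have "map \<Phi> rs \<in> lists (carrier G)" if "\<Phi> \<in> mor (R <#> ?J)" for \<Phi>
      using F_carrier(2)[OF that subsetD[OF sub(1)]] rs by auto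
    then show ?thesis
      using w by blast
  qed
  moreover have "countable (lists (carrier G) \<times> W)"
    using countable_carrier finite_W by (simp add: countable_finite)
  ultimately show ?thesis
    by (meson countable_image_inj_on countable_subset)
qed

lemma countable_generating_morphisms:
  "\<exists>\<M>. countable \<M> \<and> (\<forall>m\<in>\<M>. snd m \<in> mor (fst m)) \<and>
    (\<forall>P. \<forall>\<phi>\<in>mor P. \<exists>m\<in>\<M>. P \<subseteq> fst m \<and> (\<forall>x\<in>P. snd m x = \<phi> x))"
proof -
  let ?\<R> = "{R. finite R \<and> R \<subseteq> carrier G \<and> subgroup R G}"
  define \<M> where "\<M> = (\<Union>R\<in>?\<R>. \<Union>V\<in>Pow W. Pair (R <#> fixed_part V) ` mor (R <#> fixed_part V))"
  have "countable ?\<R>"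
    by (rule countable_subset[OF _ countable_Collect_finite_subset[OF countable_carrier]]) blast
  then have "countable \<M>"
    unfolding \<M>_def using finite_W countable_mor_product
    by (intro countable_UN countable_image) (auto intro: countable_finite)
  moreover have "\<forall>m\<in>\<M>. snd m \<in> mor (fst m)"
    unfolding \<M>_def by auto
  moreover have "\<exists>m\<in>\<M>. P \<subseteq> fst m \<and> (\<forall>x\<in>P. snd m x = \<phi> x)" if \<phi>: "\<phi> \<in> mor P" for P \<phi>
  proof -
    obtain R V \<Phi> where ext: "finite R" "subgroup R G" "V \<subseteq> W" "\<Phi> \<in> mor (R <#> fixed_part V)"
      "P \<subseteq> R <#> fixed_part V" "\<forall>x\<in>P. \<Phi> x = \<phi> x"
      using mor_extends_to_fixed_part[OF \<phi>] by blast
    then have "(R <#> fixed_part V, \<Phi>) \<in> \<M>"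
      unfolding \<M>_def using subgroup.subset[OF ext(2)] by blast
    then show ?thesis
      by (rule rev_bexI) (use ext(5,6) in simp)
  qed
  ultimately show ?thesis
    by (intro exI[of _ \<M>]) simp
qed

end

text \<open>From here on the ambient group is separate from \<open>S\<close>, which takes the place
  of the group of the locale.\<close>

lemma (in group) saturated_fusion_of_discrete_p_toral:
  assumes "prime p" "locally_finite G" "subgroup S G"
    and "discrete_p_toral p (G\<lparr>carrier := S\<rparr>)" "saturated p (G\<lparr>carrier := S\<rparr>) F"
  shows "\<exists>T. saturated_fusion (G\<lparr>carrier := S\<rparr>) p T F"
proof -
  let ?S = "G\<lparr>carrier := S\<rparr>"
  interpret S: group ?S
    by (rule subgroup_imp_group[OF assms(3)])
  obtain T n where T: "T \<lhd> ?S" "discrete_p_torus p (?S\<lparr>carrier := T\<rparr>)" "finite (carrier (?S Mod T))"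
    "order (?S Mod T) = p ^ n"
    using assms(4) unfolding discrete_p_toral_def by blast
  have div: "divisible_p_group p (G\<lparr>carrier := T\<rparr>)"
    using divisible_p_group_of_torus[OF assms(1) T(2)] by simp
  then have comm: "comm_group (G\<lparr>carrier := T\<rparr>)"
    unfolding divisible_p_group_def by blast
  interpret T: normal T ?S
    by (rule T(1))
  interpret Q: group "?S Mod T"
    by (rule T.factorgroup_is_group)
  have pow_coset: "(T #>\<^bsub>?S\<^esub> x) [^]\<^bsub>?S Mod T\<^esub> (k::nat) = T #>\<^bsub>?S\<^esub> (x [^]\<^bsub>?S\<^esub> k)" if "x \<in> S" for x k
  proof (induction k)
    case 0
    have "\<one>\<^bsub>?S Mod T\<^esub> = T"
      by (simp add: FactGroup_def)
    then show ?case
      unfolding Q.nat_pow_0 S.nat_pow_0 S.coset_mult_one[OF T.subset] .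
  next
    case (Suc k)
    have "A \<otimes>\<^bsub>?S Mod T\<^esub> B = A <#>\<^bsub>?S\<^esub> B" for A B
      by (simp add: FactGroup_def)
    then show ?case
      unfolding Q.nat_pow_Suc S.nat_pow_Suc Suc using that S.nat_pow_closed[of x k] by (subst T.rcos_sum[symmetric]) auto
  qed
  \<comment> \<open>The quotient has order \<open>p ^ n\<close>, so the \<open>p ^ n\<close>-th
    power of every coset is trivial.\<close>
  have power: "x [^]\<^bsub>?S\<^esub> (p ^ n) \<in> T" if "x \<in> S" for x
  proof -
    have "T #>\<^bsub>?S\<^esub> x \<in> carrier (?S Mod T)"
      using that unfolding FactGroup_def RCOSETS_def by auto
    then have "T #>\<^bsub>?S\<^esub> (x [^]\<^bsub>?S\<^esub> (p ^ n)) = T"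
      using Q.pow_order_eq_1[of "T #>\<^bsub>?S\<^esub> x"] pow_coset[OF that] T(4) by simp
    then show ?thesis
      using S.rcos_self[OF _ T.subgroup_axioms] S.nat_pow_closed that by auto
  qed
  have gen: "finite (generate ?S A)" if "finite A" "A \<subseteq> S" for A
  proof -
    have "finite (generate G A)"
      using assms(2) that subgroup.subset[OF assms(3)] unfolding locally_finite_def by blast
    then show ?thesis
      using generate_consistent[OF that(2) assms(3)] by simp
  qed
  have "toral_group ?S p T"
  proof
    show "prime p" by (rule assms(1))
    show "x \<otimes>\<^bsub>?S\<^esub> y = y \<otimes>\<^bsub>?S\<^esub> x" if "x \<in> T" "y \<in> T" for x y
      using comm_groupE(4)[OF comm, of x y] that by simp
    show "\<exists>n::nat. x [^]\<^bsub>?S\<^esub> (p ^ n) = \<one>\<^bsub>?S\<^esub>" "\<exists>y\<in>T. y [^]\<^bsub>?S\<^esub> p = x" if "x \<in> T" for x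
      using div that unfolding divisible_p_group_def by (simp_all flip: nat_pow_consistent)
    show "finite {x \<in> T. x [^]\<^bsub>?S\<^esub> (p ^ n) = \<one>\<^bsub>?S\<^esub>}" for n
      using div unfolding divisible_p_group_def by (simp flip: nat_pow_consistent)
    show "\<exists>n. \<forall>x\<in>carrier ?S. x [^]\<^bsub>?S\<^esub> (p ^ n) \<in> T"
      using power by auto
    show "finite (rcosets\<^bsub>?S\<^esub> T)"
      using T(3) unfolding FactGroup_def by simp
    show "finite (generate ?S A)" if "finite A" "A \<subseteq> carrier ?S" for A
      using gen that by simp
  qed
  then show ?thesis
    using assms(5) unfolding saturated_fusion_def saturated_fusion_axioms_def by blast
qed

text \<open>Each element already lies in the subgroup generated by finitely many members of
  \<open>A\<close>; these subgroups are finite and countably many.\<close>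

lemma (in group) countable_generate:
  assumes "countable A" "A \<subseteq> carrier G" "locally_finite G"
  shows "countable (generate G A)"
proof -
  let ?\<F> = "{E. finite E \<and> E \<subseteq> A}"
  have "x \<in> (\<Union>E\<in>?\<F>. generate G E)" if "x \<in> generate G A" for x
    using that
  proof (induction rule: generate.induct)
    case one
    then show ?case
      using generate.one[of G "{}"] by blast
  next
    case (incl h)
    then show ?case
      using generate.incl[of h "{h}" G] by blast
  next
    case (inv h)
    then show ?case
      using generate.inv[of h "{h}" G] by blast
  next
    case (eng x y)
    then obtain E1 E2 where E: "E1 \<in> ?\<F>" "x \<in> generate G E1" "E2 \<in> ?\<F>" "y \<in> generate G E2"
      by blast
    then have "x \<in> generate G (E1 \<union> E2)" "y \<in> generate G (E1 \<union> E2)"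
      using mono_generate[of E1 "E1 \<union> E2"] mono_generate[of E2 "E1 \<union> E2"] by auto
    then have "x \<otimes> y \<in> generate G (E1 \<union> E2)" "E1 \<union> E2 \<in> ?\<F>"
      using E by (auto intro: generate.eng)
    then show ?case by blast
  qed
  then have "generate G A \<subseteq> (\<Union>E\<in>?\<F>. generate G E)"
    by blast
  moreover have "countable (\<Union>E\<in>?\<F>. generate G E)"
    using assms countable_Collect_finite_subset[OF assms(1)] unfolding locally_finite_def
    by (intro countable_UN) (auto intro: countable_finite)
  ultimately show ?thesis
    by (rule countable_subset)
qed

lemma (in group) countable_subgroup_realizing:
  assumes "prime p" "locally_finite G" "subgroup S G"
    and "discrete_p_toral p (G\<lparr>carrier := S\<rparr>)" "saturated p (G\<lparr>carrier := S\<rparr>) (group_fusion G S)"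
  shows "\<exists>H. subgroup H G \<and> countable H \<and> S \<subseteq> H \<and> group_fusion G S = group_fusion (G\<lparr>carrier := H\<rparr>) S"
proof -
  let ?S = "G\<lparr>carrier := S\<rparr>" and ?F = "group_fusion G S"
  obtain T where "saturated_fusion ?S p T ?F"
    using saturated_fusion_of_discrete_p_toral[OF assms] by blast
  then interpret S: saturated_fusion ?S p T ?F .
  have carr: "carrier ?S = S"
    by simp
  obtain \<M> where "countable \<M> \<and> (\<forall>m\<in>\<M>. snd m \<in> ?F (fst m) S) \<and>
    (\<forall>P. \<forall>\<phi>\<in>?F P S. \<exists>m\<in>\<M>. P \<subseteq> fst m \<and> (\<forall>x\<in>P. snd m x = \<phi> x))"
    using S.countable_generating_morphisms unfolding carr by (rule exE)
  then have \<M>: "countable \<M>" "\<And>m. m \<in> \<M> \<Longrightarrow> snd m \<in> ?F (fst m) S"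
    "\<And>P \<phi>. \<phi> \<in> ?F P S \<Longrightarrow> \<exists>m\<in>\<M>. P \<subseteq> fst m \<and> (\<forall>x\<in>P. snd m x = \<phi> x)"
    by simp_all
  have "\<exists>g\<in>carrier G. \<forall>x\<in>fst m. snd m x = conj_by G g x" if m: "m \<in> \<M>" for m
  proof -
    obtain g where "snd m = restrict (conj_by G g) (fst m)" "g \<in> carrier G"
      using \<M>(2)[OF m] unfolding group_fusion_def by blast
    then show ?thesis
      by auto
  qed
  then obtain g where g: "\<And>m. m \<in> \<M> \<Longrightarrow> g m \<in> carrier G"
    "\<And>m x. m \<in> \<M> \<Longrightarrow> x \<in> fst m \<Longrightarrow> snd m x = conj_by G (g m) x"
    by metis
  have SG: "S \<subseteq> carrier G"
    by (rule subgroup.subset[OF assms(3)])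
  let ?A = "S \<union> g ` \<M>"
  have A: "?A \<subseteq> carrier G" "countable ?A"
    using SG g(1) S.countable_carrier \<M>(1) by auto
  let ?H = "generate G ?A"
  have H: "subgroup ?H G" "countable ?H" "S \<subseteq> ?H"
    using generate_is_subgroup[OF A(1)] countable_generate[OF A(2,1) assms(2)] generate.incl[of _ ?A G] by auto
  note conj_H = conj_by_subgroup_consistent[OF H(1)]
  have "\<phi> \<in> ?F P Q \<longleftrightarrow> \<phi> \<in> group_fusion (G\<lparr>carrier := ?H\<rparr>) S P Q" for P Q \<phi>
  proof
    assume \<phi>: "\<phi> \<in> ?F P Q"
    then obtain h where h: "\<phi> = restrict (conj_by G h) P" "h \<in> carrier G" "subgroup P G" "P \<subseteq> S"
      "subgroup Q G" "Q \<subseteq> S" "conj_by G h ` P \<subseteq> Q"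
      unfolding group_fusion_def by blast
    \<comment> \<open>The countable family covers morphisms into \<open>S\<close>. The codomain
      \<open>Q\<close> returns at the end, because \<open>g m\<close> and \<open>h\<close> induce
      the same map on \<open>P\<close>.\<close>
    have "\<phi> \<in> ?F P S"
      using S.mor_of_F[OF \<phi>] by simp
    then obtain m where m: "m \<in> \<M>" "P \<subseteq> fst m" "\<forall>x\<in>P. snd m x = \<phi> x"
      using \<M>(3) by blast
    have gm: "g m \<in> ?H"
      using m(1) by (auto intro: generate.incl)
    have eq: "conj_by G (g m) x = conj_by G h x" if "x \<in> P" for x
      using g(2)[OF m(1)] m(2,3) h(1) that by (metis restrict_apply' subsetD)
    have "\<phi> = restrict (conj_by (G\<lparr>carrier := ?H\<rparr>) (g m)) P"
      unfolding conj_H[OF gm] h(1) using eq by (auto simp: restrict_def)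
    moreover have "conj_by (G\<lparr>carrier := ?H\<rparr>) (g m) ` P \<subseteq> Q"
      unfolding conj_H[OF gm] using eq h(7) by auto
    ultimately show "\<phi> \<in> group_fusion (G\<lparr>carrier := ?H\<rparr>) S P Q"
      using gm h(3-6) H(3) unfolding group_fusion_def subgroup_restrict_iff[OF H(1)]
      by (auto intro!: exI[of _ "g m"])
  next
    assume "\<phi> \<in> group_fusion (G\<lparr>carrier := ?H\<rparr>) S P Q"
    then obtain h where h: "\<phi> = restrict (conj_by (G\<lparr>carrier := ?H\<rparr>) h) P" "h \<in> ?H" "subgroup P G" "P \<subseteq> S"
      "subgroup Q G" "Q \<subseteq> S" "conj_by (G\<lparr>carrier := ?H\<rparr>) h ` P \<subseteq> Q"
      unfolding group_fusion_def subgroup_restrict_iff[OF H(1)] by auto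
    then show "\<phi> \<in> ?F P Q"
      using conj_H[OF h(2)] subgroup.mem_carrier[OF H(1) h(2)] unfolding group_fusion_def by auto
  qed
  then have "?F = group_fusion (G\<lparr>carrier := ?H\<rparr>) S"
    by (intro ext Set.set_eqI)
  then show ?thesis
    using H by blast
qed

theorem proposition2p4:
  fixes p :: nat and G :: "('a, 'b) monoid_scheme" and S :: "'a set" and F :: "'a fusion"
  assumes "prime p"
    and "group G" and "locally_finite G" and "subgroup S G"
    and "discrete_p_toral p (G\<lparr>carrier := S\<rparr>)"
    and "saturated p (G\<lparr>carrier := S\<rparr>) F"
    and "F = group_fusion G S"
  shows "(\<exists>H. subgroup H G \<and> countable H \<and> S \<subseteq> H \<and> F = group_fusion (G\<lparr>carrier := H\<rparr>) S) \<and>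
    (countable (carrier G) \<and> S \<in> Syl p G \<longrightarrow>
      (\<exists>Gs. sylow_exhaustion p G S Gs) \<and>
      (\<forall>Gs. sylow_exhaustion p G S Gs \<longrightarrow>
        S = (\<Union>i. S \<inter> Gs i) \<and>
        F = fusion_Union (G\<lparr>carrier := S\<rparr>) (\<lambda>i. S \<inter> Gs i)
              (\<lambda>i. group_fusion (G\<lparr>carrier := Gs i\<rparr>) (S \<inter> Gs i))))"
proof -
  interpret group G
    by (rule assms(2))
  have sat: "saturated p (G\<lparr>carrier := S\<rparr>) (group_fusion G S)"
    using assms(6,7) by simp
  have "S = (\<Union>i. S \<inter> Gs i)" if "sylow_exhaustion p G S Gs" for Gs
    using that subgroup.subset[OF assms(4)] unfolding sylow_exhaustion_def by blast
  then show ?thesis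
    unfolding assms(7)
    using countable_subgroup_realizing[OF assms(1,3,4,5) sat] sylow_exhaustion_exists[OF assms(1,3)]
      fusion_Union_exhaustion[OF assms(4,3) sat] by blast
qed

end
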